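(* Let $V$ be a super vector space with an odd non-degenerate symmetric bilinear form. Given a cyclic strong deformation retract $(i,p,s)$ from $V$ to $\operatorname{H}(V)$, the dgla morphism $$\iota\colon\mathfrak h[\Pi \operatorname{H}(V)]\to\mathfrak h[\Pi V]$$ defined by $f\mapsto ifp$ (the pullback of $f$ along $p$, i.e. its extension by zero on the complement of $\operatorname{im}(i)$) is a filtered quasi-isomorphism with respect to the weight filtrations, and hence induces a bijection $\mathcal{MC}(\mathfrak h[\Pi \operatorname{H}(V)])\to\mathcal{MC}(\mathfrak h[\Pi V])$ between the Maurer–Cartan moduli sets; i.e. the homotopy classes of quantum $L_\infty$-algebra structures in $\mathfrak h[\Pi \operatorname{H}(V)]$ and in $\mathfrak h[\Pi V]$ are in bijective correspondence.
   Context: **Basics.** A super vector space is a $\mathbb Z/2$-graded real vector space with an odd differential $d$; $|v|$ is parity, $\Pi$ is parity reversion, $\operatorname{H}$ is homology. Odd bilinear forms are compatible with $d$: $\langle dx,y\rangle+(-1)^{|x|}\langle x,dy\rangle=0$. Non-degeneracy forces finite dimension. If $V$ carries an odd symmetric non-degenerate form, then $W=\Pi V$ carries the odd symplectic form $\tau(\Pi x,\Pi y)=(-1)^{|x|}\langle x,y\rangle$. $\hat S W^*=\prod_{n\ge 0}S^nW^*$ is the algebra of formal functions, with derivation differential $d$ induced by that of $W$, and Laplacian $\Delta=\sum_i\partial_{x_i}\partial_{\xi_i}$, where $\{x_i,\xi_i\}$ is a basis of $W^*$ ($x_i$ even, $\xi_i$ odd) in which the symplectic form is canonical, $\sum_i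 d_{DR}x_i\,d_{DR}\xi_i$. The odd Poisson bracket is $[f,g]=(-1)^{|f|}\Delta(fg)-(-1)^{|f|}\Delta(f)g-f\Delta(g)$; all is extended $\hbar$-linearly. **Cyclic SDR.** A cyclic strong deformation retract from $V$ to $\operatorname{H}(V)$ (with induced form) consists of even morphisms $i\colon \operatorname{H}(V)\hookrightarrow V$, $p\colon V\twoheadrightarrow \operatorname{H}(V)$ (commuting with differentials) and an odd linear map $s\colon V\to V$ with $pi=\mathrm{id}$, $ds+sd=\mathrm{id}-ip$, $si=0$, $ps=0$, $s^2=0$, $\langle ix,iy\rangle=\langle x,y\rangle$, $\ker p\perp\operatorname{im} i$, $\langle sx,y\rangle=(-1)^{|x|}\langle x,sy\rangle$. **The dgla $\mathfrak h[W]$.** Give $f\hbar^g$, $f$ a monomial of degree $n$ in $\hat SW^*$, the weight $2g+n$. $\mathfrak h[W]\subset\hat SW^*[[\hbar]]$ is the subspace of elements of weight $>2$; with differential $d+\hbar\Delta$ and bracket $[\cdot,\cdot]$ it is a pronilpotent (odd) dgla. The weight filtration is $F_j\mathfrak h[W]=\{\text{elements of weight}\ge j+2\}$, $j\ge1$. A filtered quasi-isomorphism is a filtered morphism inducing quasi-isomorphisms $F_j/F_{j+1}\to F_j/F_{j+1}$ for all $j$. $\operatorname{MC}(\mathfrak h[W])$ is the set of even $m$ with $(d+\hbar\Delta)m+\frac12[m,m]=0$. A quantum $L_\infty$-algebra structure on $V$ is an element of $\operatorname{MC}(\mathfrak h[\Pi V])$. **Homotopy.** $\mathbb R[t,dt]$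 is the free cdga on $t$ (even), $dt$ (odd) with $d(t)=dt$; $\mathfrak g[t,dt]=\mathfrak g\otimes\mathbb R[t,dt]$ (completed tensor product). MC elements $\xi,\eta$ of $\mathfrak g$ are homotopic if there is an MC element $H(t)$ of $\mathfrak g[t,dt]$ with $H(0)=\xi$, $H(1)=\eta$. $\mathcal{MC}(\mathfrak g)$ is the set of equivalence classes of MC elements under homotopy. *)

theory Defs
  imports Complex_Main "HOL-Library.Function_Algebras" "HOL-Library.Product_Plus"
begin

section \<open>Super vector spaces with a differential and an odd form\<close>

text \<open>
  The linear operations are fields of the record, because the same constructions are applied to
  a vector space given by a type of class \<open>real_vector\<close> and to its homology, whose elements are
  cosets.  Parities, and therefore all signs, make sense on homogeneous vectors only.  The vector
  0 is homogeneous of both parities; \<open>par\<close> gives it the value 0, which is harmless because every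
  sign multiplies an expression that is linear in the vector concerned.  The form is only ever
  used on homogeneous vectors.
\<close>

record 'a super_space =
  vcarrier :: "'a set"
  vzero :: 'a
  vadd :: "'a \<Rightarrow> 'a \<Rightarrow> 'a"
  vscale :: "real \<Rightarrow> 'a \<Rightarrow> 'a"
  even_part :: "'a set"
  odd_part :: "'a set"
  vdiff :: "'a \<Rightarrow> 'a"
  form :: "'a \<Rightarrow> 'a \<Rightarrow> real"

definition homog :: "'a super_space \<Rightarrow> 'a set" where
  "homog V = even_part V \<union> odd_part V"

definition par :: "'a super_space \<Rightarrow> 'a \<Rightarrow> nat" where
  "par V x = (if x \<in> even_part V then 0 else 1)"

text \<open>
  A finite-dimensional super vector space, carried by the whole type, with an odd differential
  and an odd non-degenerate symmetric form compatible with it.  Finite dimension is listed because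
  non-degeneracy is understood as \<open>V\<close> being dual to itself, whereas the last clause alone only
  says that the form has no kernel.
\<close>

definition odd_symmetric_space :: "'v::real_vector super_space \<Rightarrow> bool" where
  "odd_symmetric_space V \<longleftrightarrow>
     vcarrier V = UNIV \<and> vzero V = 0 \<and> vadd V = (+) \<and> vscale V = (*\<^sub>R) \<and>
     (\<exists>B :: 'v set. finite B \<and> span B = UNIV) \<and>
     subspace (even_part V) \<and> subspace (odd_part V) \<and>
     even_part V \<inter> odd_part V = {0} \<and>
     (\<forall>x. \<exists>a\<in>even_part V. \<exists>b\<in>odd_part V. x = a + b) \<and>
     linear (vdiff V) \<and>
     vdiff V ` even_part V \<subseteq> odd_part V \<and> vdiff V ` odd_part V \<subseteq> even_part V \<and>
     (\<forall>x. vdiff V (vdiff V x) = 0) \<and>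
     (\<forall>y. linear (\<lambda>x. form V x y)) \<and> (\<forall>x. linear (form V x)) \<and>
     (\<forall>x\<in>even_part V. \<forall>y\<in>even_part V. form V x y = 0) \<and>
     (\<forall>x\<in>odd_part V. \<forall>y\<in>odd_part V. form V x y = 0) \<and>
     (\<forall>x\<in>homog V. \<forall>y\<in>homog V. form V x y = (- 1) ^ (par V x * par V y) * form V y x) \<and>
     (\<forall>x\<in>homog V. \<forall>y. form V (vdiff V x) y + (- 1) ^ par V x * form V x (vdiff V y) = 0) \<and>
     (\<forall>x. (\<forall>y. form V x y = 0) \<longrightarrow> x = 0)"

definition cycles :: "'v::real_vector super_space \<Rightarrow> 'v set" where
  "cycles V = {x. vdiff V x = 0}"

definition boundaries :: "'v::real_vector super_space \<Rightarrow> 'v set" where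
  "boundaries V = range (vdiff V)"

definition hclass :: "'v::real_vector super_space \<Rightarrow> 'v \<Rightarrow> 'v set" where
  "hclass V x = {x + z | z. z \<in> boundaries V}"

text \<open>The values of the form do not depend on the chosen representing cycles.\<close>

definition homology :: "'v::real_vector super_space \<Rightarrow> 'v set super_space" where
  "homology V =
     \<lparr>vcarrier = hclass V ` cycles V,
      vzero = hclass V 0,
      vadd = (\<lambda>C D. {x + y | x y. x \<in> C \<and> y \<in> D}),
      vscale = (\<lambda>c C. {c *\<^sub>R x + z | x z. x \<in> C \<and> z \<in> boundaries V}),
      even_part = hclass V ` (cycles V \<inter> even_part V),
      odd_part = hclass V ` (cycles V \<inter> odd_part V),
      vdiff = (\<lambda>_. hclass V 0),
      form = (\<lambda>C D. form V (SOME x. x \<in> C) (SOME y. y \<in> D))\<rparr>"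

text \<open>
  The parity reversion has the same underlying vector space, with \<open>\<Pi>x\<close> represented by \<open>x\<close>.  Its
  differential is \<open>d(\<Pi>x) = - \<Pi>(dx)\<close> (Koszul rule for the odd symbol \<open>\<Pi>\<close>) and its form is the
  symplectic form \<open>\<tau>(\<Pi>x, \<Pi>y) = (-1)^|x| \<langle>x, y\<rangle>\<close>, with \<open>|x|\<close> the parity in \<open>V\<close>.
\<close>

definition parity_reversion :: "'a super_space \<Rightarrow> 'a super_space" where
  "parity_reversion V =
     V\<lparr>even_part := odd_part V,
       odd_part := even_part V,
       vdiff := (\<lambda>x. vscale V (- 1) (vdiff V x)),
       form := (\<lambda>x y. (- 1) ^ par V x * form V x y)\<rparr>"

definition even_morphism :: "'a super_space \<Rightarrow> 'b super_space \<Rightarrow> ('a \<Rightarrow> 'b) \<Rightarrow> bool" where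
  "even_morphism A B f \<longleftrightarrow>
     f ` vcarrier A \<subseteq> vcarrier B \<and>
     (\<forall>x\<in>vcarrier A. \<forall>y\<in>vcarrier A. f (vadd A x y) = vadd B (f x) (f y)) \<and>
     (\<forall>c. \<forall>x\<in>vcarrier A. f (vscale A c x) = vscale B c (f x)) \<and>
     f ` even_part A \<subseteq> even_part B \<and> f ` odd_part A \<subseteq> odd_part B \<and>
     (\<forall>x\<in>vcarrier A. f (vdiff A x) = vdiff B (f x))"

definition cyclic_sdr ::
    "'v::real_vector super_space \<Rightarrow> ('v set \<Rightarrow> 'v) \<Rightarrow> ('v \<Rightarrow> 'v set) \<Rightarrow> ('v \<Rightarrow> 'v) \<Rightarrow> bool" where
  "cyclic_sdr V i p s \<longleftrightarrow>
     even_morphism (homology V) V i \<and> even_morphism V (homology V) p \<and>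
     linear s \<and> s ` even_part V \<subseteq> odd_part V \<and> s ` odd_part V \<subseteq> even_part V \<and>
     (\<forall>C\<in>vcarrier (homology V). p (i C) = C) \<and>
     (\<forall>x. vdiff V (s x) + s (vdiff V x) = x - i (p x)) \<and>
     (\<forall>C\<in>vcarrier (homology V). s (i C) = 0) \<and>
     (\<forall>x. p (s x) = vzero (homology V)) \<and>
     (\<forall>x. s (s x) = 0) \<and>
     (\<forall>C\<in>vcarrier (homology V). \<forall>D\<in>vcarrier (homology V).
        form V (i C) (i D) = form (homology V) C D) \<and>
     (\<forall>x. \<forall>C\<in>vcarrier (homology V). p x = vzero (homology V) \<longrightarrow> form V x (i C) = 0) \<and>
     (\<forall>x\<in>homog V. \<forall>y. form V (s x) y = (- 1) ^ par V x * form V x (s y))"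

section \<open>Formal functions\<close>

text \<open>
  An element of \<open>S^n W^*\<close> is represented by its polarization, a graded symmetric \<open>n\<close>-linear form
  on \<open>W\<close>: the product of linear forms \<open>\<phi>\<^sub>1, \<dots>, \<phi>\<^sub>n\<close> is the sum over all permutations \<open>\<sigma>\<close> of
  \<open>\<plusminus> \<phi>\<^sub>\<sigma>\<^sub>(\<^sub>1\<^sub>)(w\<^sub>1) \<cdots> \<phi>\<^sub>\<sigma>\<^sub>(\<^sub>n\<^sub>)(w\<^sub>n)\<close>, without a factor \<open>1/n!\<close>.  As usual in super linear algebra such a
  form is given by its values on homogeneous vectors; all other lists of vectors get the value 0.
  For a formal function \<open>f\<close> with coefficients in \<open>\<real>[[\<hbar>]]\<close>, \<open>f k ws\<close> is the value on \<open>ws\<close> of the part of degree \<open>length ws\<close> of the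
  coefficient of \<open>\<hbar>^k\<close>.
\<close>

type_synonym 'w formal = "nat \<Rightarrow> 'w list \<Rightarrow> real"

definition formal_functions :: "'w super_space \<Rightarrow> 'w formal set" where
  "formal_functions W = {f. \<forall>k.
     (\<forall>ws. \<not> set ws \<subseteq> homog W \<longrightarrow> f k ws = 0) \<and>
     (\<forall>us vs. \<forall>P\<in>{even_part W, odd_part W}. \<forall>a\<in>P. \<forall>b\<in>P.
        f k (us @ vadd W a b # vs) = f k (us @ a # vs) + f k (us @ b # vs)) \<and>
     (\<forall>us vs c. \<forall>a\<in>homog W. f k (us @ vscale W c a # vs) = c * f k (us @ a # vs)) \<and>
     (\<forall>us vs. \<forall>a\<in>homog W. \<forall>b\<in>homog W.
        f k (us @ a # b # vs) = (- 1) ^ (par W a * par W b) * f k (us @ b # a # vs))}"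

definition par_list :: "'w super_space \<Rightarrow> 'w list \<Rightarrow> nat" where
  "par_list W ws = (\<Sum>w\<leftarrow>ws. par W w)"

text \<open>
  The grading involution \<open>f \<mapsto> (-1)^|f| f\<close>; it gives formulas with signs \<open>(-1)^|f|\<close> their bilinear
  extension to inhomogeneous \<open>f\<close>.
\<close>

definition ff_involution :: "'w super_space \<Rightarrow> 'w formal \<Rightarrow> 'w formal" where
  "ff_involution W f = (\<lambda>k ws. (- 1) ^ par_list W ws * f k ws)"

text \<open>
  The Koszul sign of \<open>(f \<otimes> g)(w\<^sub>1 \<cdots> w\<^sub>n) = \<plusminus> f(w\<^sub>S) g(w\<^sub>T)\<close>, where \<open>T\<close> is the complement of \<open>S\<close>:
  the sign of the unshuffle of \<open>w\<^sub>1 \<cdots> w\<^sub>n\<close> into \<open>w\<^sub>S w\<^sub>T\<close>, times \<open>(-1)^(|w\<^sub>S| |g|)\<close>, where \<open>|g| = |w\<^sub>T|\<close>.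
\<close>

definition shuffle_sign :: "'w super_space \<Rightarrow> nat set \<Rightarrow> 'w list \<Rightarrow> real" where
  "shuffle_sign W S ws =
     (- 1) ^ card {(a, b). a < b \<and> b < length ws \<and> a \<in> S \<and> b \<notin> S \<and>
                           par W (ws ! a) = 1 \<and> par W (ws ! b) = 1}"

definition ff_mult :: "'w super_space \<Rightarrow> 'w formal \<Rightarrow> 'w formal \<Rightarrow> 'w formal" where
  "ff_mult W f g = (\<lambda>k ws. \<Sum>j\<le>k. \<Sum>S\<in>Pow {..<length ws}.
     shuffle_sign W S ws * f j (nths ws S) * g (k - j) (nths ws (- S)))"

text \<open>
  The derivation extending \<open>(d\<phi>)(w) = - (-1)^|\<phi>| \<phi>(dw)\<close>, \<open>\<phi> \<in> W^*\<close>.  As \<open>|\<phi>| = |w| + 1\<close> whenever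
  \<open>\<phi>(dw) \<noteq> 0\<close>, the sign is \<open>(-1)^|w|\<close>.  On \<open>n\<close>-linear forms this becomes
  \<open>- (-1)^|f| f(d(w\<^sub>1 \<cdots> w\<^sub>n))\<close>, where \<open>d(w\<^sub>1 \<cdots> w\<^sub>n)\<close> is given by the Leibniz rule.
\<close>

definition ff_diff :: "'w super_space \<Rightarrow> 'w formal \<Rightarrow> 'w formal" where
  "ff_diff W f = (\<lambda>k ws. if set ws \<subseteq> homog W
     then \<Sum>j<length ws. (- 1) ^ par_list W (drop j ws) * f k (ws[j := vdiff W (ws ! j)])
     else 0)"

primrec lincomb :: "'w super_space \<Rightarrow> (nat \<Rightarrow> real) \<Rightarrow> (nat \<Rightarrow> 'w) \<Rightarrow> nat \<Rightarrow> 'w" where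
  "lincomb W c e 0 = vzero W"
| "lincomb W c e (Suc n) = vadd W (lincomb W c e n) (vscale W (c n) (e n))"

text \<open>
  \<open>e\<^sub>i, \<epsilon>\<^sub>i\<close> (\<open>i < n\<close>) is the basis of \<open>W\<close> to which a basis \<open>x\<^sub>i, \<xi>\<^sub>i\<close> of \<open>W^*\<close> is dual, such that the
  symplectic form is the canonical one.  Values of the form on vectors of equal parity vanish.
\<close>

definition canonical_basis ::
    "'w super_space \<Rightarrow> nat \<Rightarrow> (nat \<Rightarrow> 'w) \<Rightarrow> (nat \<Rightarrow> 'w) \<Rightarrow> bool" where
  "canonical_basis W n e \<epsilon> \<longleftrightarrow>
     (\<forall>i<n. e i \<in> even_part W \<and> \<epsilon> i \<in> odd_part W) \<and>
     (\<forall>w\<in>even_part W. \<exists>c. w = lincomb W c e n) \<and>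
     (\<forall>w\<in>odd_part W. \<exists>c. w = lincomb W c \<epsilon> n) \<and>
     (\<forall>c. lincomb W c e n = vzero W \<longrightarrow> (\<forall>i<n. c i = 0)) \<and>
     (\<forall>c. lincomb W c \<epsilon> n = vzero W \<longrightarrow> (\<forall>i<n. c i = 0)) \<and>
     (\<forall>i<n. \<forall>j<n. form W (e i) (\<epsilon> j) = (if i = j then 1 else 0) \<and>
                    form W (\<epsilon> j) (e i) = (if i = j then - 1 else 0))"

text \<open>
  The left partial derivative along the coordinate dual to a basis vector \<open>v\<close>.  In terms of
  polarizations \<open>v\<close> is inserted at the end: this makes \<open>\<partial>\<close> a left derivation of parity \<open>|v|\<close>
  for \<open>ff_mult\<close>.
\<close>

definition ff_partial :: "'w \<Rightarrow> 'w formal \<Rightarrow> 'w formal" where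
  "ff_partial v f = (\<lambda>k ws. f k (ws @ [v]))"

text \<open>The Laplacian does not depend on the chosen canonical basis.\<close>

definition laplacian :: "'w super_space \<Rightarrow> 'w formal \<Rightarrow> 'w formal" where
  "laplacian W f = (case (SOME (n, e, \<epsilon>). canonical_basis W n e \<epsilon>) of
     (n, e, \<epsilon>) \<Rightarrow> \<Sum>i<n. ff_partial (e i) (ff_partial (\<epsilon> i) f))"

definition hbar_mult :: "'w formal \<Rightarrow> 'w formal" where
  "hbar_mult f = (\<lambda>k ws. if k = 0 then 0 else f (k - 1) ws)"

definition odd_bracket :: "'w super_space \<Rightarrow> 'w formal \<Rightarrow> 'w formal \<Rightarrow> 'w formal" where
  "odd_bracket W f g =
     laplacian W (ff_mult W (ff_involution W f) g)
     - ff_mult W (laplacian W (ff_involution W f)) g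
     - ff_mult W f (laplacian W g)"

section \<open>Odd differential graded Lie algebras\<close>

text \<open>The grading is given by the involution \<open>gsign\<close>, which is \<open>(-1)^|x|\<close> on homogeneous \<open>x\<close>.\<close>

record 'g dgla =
  gspace :: "'g set"
  gscale :: "real \<Rightarrow> 'g \<Rightarrow> 'g"
  gsign :: "'g \<Rightarrow> 'g"
  gdiff :: "'g \<Rightarrow> 'g"
  gbracket :: "'g \<Rightarrow> 'g \<Rightarrow> 'g"

record 'g filtered_dgla = "'g dgla" +
  gfilt :: "nat \<Rightarrow> 'g set"

definition MC :: "('g::ab_group_add, 'm) dgla_scheme \<Rightarrow> 'g set" where
  "MC \<gg> = {m \<in> gspace \<gg>. gsign \<gg> m = m \<and> gdiff \<gg> m + gscale \<gg> (1 / 2) (gbracket \<gg> m m) = 0}"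

text \<open>
  The completed tensor product of \<open>\<gg>\<close> with \<open>\<real>[t, dt]\<close>: the pair \<open>(a, b)\<close> stands for
  \<open>\<Sum>\<^sub>k a\<^sub>k t^k + \<Sum>\<^sub>k b\<^sub>k t^k dt\<close>, which is polynomial modulo every step of the filtration.  The signs are
  \<open>d(x \<otimes> \<omega>) = dx \<otimes> \<omega> + (-1)^|x| x \<otimes> d\<omega>\<close> and
  \<open>[x \<otimes> \<omega>, y \<otimes> \<eta>] = (-1)^(|\<omega>| (|y| + 1)) [x, y] \<otimes> \<omega>\<eta>\<close>; the summand \<open>|\<omega>|\<close> in the exponent is
  due to the bracket being odd with its symbol placed between the arguments, as in
  \<open>odd_bracket\<close>.
\<close>

definition path_dgla ::
    "'g::ab_group_add filtered_dgla \<Rightarrow> ((nat \<Rightarrow> 'g) \<times> (nat \<Rightarrow> 'g)) dgla" where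
  "path_dgla \<gg> =
     \<lparr>gspace = {(a, b). (\<forall>k. a k \<in> gspace \<gg> \<and> b k \<in> gspace \<gg>) \<and>
        (\<forall>j\<ge>1. finite {k. a k \<notin> gfilt \<gg> j} \<and> finite {k. b k \<notin> gfilt \<gg> j})},
      gscale = (\<lambda>c (a, b). (\<lambda>k. gscale \<gg> c (a k), \<lambda>k. gscale \<gg> c (b k))),
      gsign = (\<lambda>(a, b). (\<lambda>k. gsign \<gg> (a k), \<lambda>k. - gsign \<gg> (b k))),
      gdiff = (\<lambda>(a, b). (\<lambda>k. gdiff \<gg> (a k),
        \<lambda>k. gdiff \<gg> (b k) + gscale \<gg> (real (Suc k)) (gsign \<gg> (a (Suc k))))),
      gbracket = (\<lambda>(a, b) (a', b').
        (\<lambda>k. \<Sum>l\<le>k. gbracket \<gg> (a l) (a' (k - l)),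
         \<lambda>k. \<Sum>l\<le>k. gbracket \<gg> (a l) (b' (k - l)) - gbracket \<gg> (b l) (gsign \<gg> (a' (k - l)))))\<rparr>"

text \<open>\<open>evaluates_to \<gg> H c x\<close> means \<open>H(c) = x\<close>, evaluation at \<open>t = c\<close>, \<open>dt = 0\<close>.\<close>

definition evaluates_to ::
    "'g::ab_group_add filtered_dgla \<Rightarrow> (nat \<Rightarrow> 'g) \<times> (nat \<Rightarrow> 'g) \<Rightarrow> real \<Rightarrow> 'g \<Rightarrow> bool" where
  "evaluates_to \<gg> H c x \<longleftrightarrow>
     (\<forall>j\<ge>1. \<exists>N. \<forall>n\<ge>N. (\<Sum>k<n. gscale \<gg> (c ^ k) (fst H k)) - x \<in> gfilt \<gg> j)"

definition homotopy_rel :: "'g::ab_group_add filtered_dgla \<Rightarrow> ('g \<times> 'g) set" where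
  "homotopy_rel \<gg> = {(\<xi>, \<eta>). \<xi> \<in> MC \<gg> \<and> \<eta> \<in> MC \<gg> \<and>
     (\<exists>H\<in>MC (path_dgla \<gg>). evaluates_to \<gg> H 0 \<xi> \<and> evaluates_to \<gg> H 1 \<eta>)}"

definition MC_moduli :: "'g::ab_group_add filtered_dgla \<Rightarrow> 'g set set" where
  "MC_moduli \<gg> = MC \<gg> // homotopy_rel \<gg>"

definition dgla_morphism ::
    "('g::ab_group_add, 'm) dgla_scheme \<Rightarrow> ('h::ab_group_add, 'n) dgla_scheme \<Rightarrow> ('g \<Rightarrow> 'h) \<Rightarrow> bool"
where
  "dgla_morphism \<gg> \<hh> \<phi> \<longleftrightarrow>
     \<phi> ` gspace \<gg> \<subseteq> gspace \<hh> \<and>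
     (\<forall>x\<in>gspace \<gg>. \<forall>y\<in>gspace \<gg>. \<phi> (x + y) = \<phi> x + \<phi> y) \<and>
     (\<forall>c. \<forall>x\<in>gspace \<gg>. \<phi> (gscale \<gg> c x) = gscale \<hh> c (\<phi> x)) \<and>
     (\<forall>x\<in>gspace \<gg>. \<phi> (gsign \<gg> x) = gsign \<hh> (\<phi> x)) \<and>
     (\<forall>x\<in>gspace \<gg>. \<phi> (gdiff \<gg> x) = gdiff \<hh> (\<phi> x)) \<and>
     (\<forall>x\<in>gspace \<gg>. \<forall>y\<in>gspace \<gg>. \<phi> (gbracket \<gg> x y) = gbracket \<hh> (\<phi> x) (\<phi> y))"

text \<open>
  The homology of \<open>F\<^sub>j / F\<^sub>j\<^sub>+\<^sub>1\<close> consists of the elements of \<open>F\<^sub>j\<close> that are cycles modulo \<open>F\<^sub>j\<^sub>+\<^sub>1\<close>,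
  modulo \<open>d F\<^sub>j + F\<^sub>j\<^sub>+\<^sub>1\<close>.
\<close>

definition gr_cycles :: "'g::ab_group_add filtered_dgla \<Rightarrow> nat \<Rightarrow> 'g set" where
  "gr_cycles \<gg> j = {x \<in> gfilt \<gg> j. gdiff \<gg> x \<in> gfilt \<gg> (Suc j)}"

definition gr_boundaries :: "'g::ab_group_add filtered_dgla \<Rightarrow> nat \<Rightarrow> 'g set" where
  "gr_boundaries \<gg> j = {gdiff \<gg> x + y | x y. x \<in> gfilt \<gg> j \<and> y \<in> gfilt \<gg> (Suc j)}"

definition gr_homologous :: "'g::ab_group_add filtered_dgla \<Rightarrow> nat \<Rightarrow> ('g \<times> 'g) set" where
  "gr_homologous \<gg> j =
     {(x, y). x \<in> gr_cycles \<gg> j \<and> y \<in> gr_cycles \<gg> j \<and> x - y \<in> gr_boundaries \<gg> j}"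

definition gr_homology :: "'g::ab_group_add filtered_dgla \<Rightarrow> nat \<Rightarrow> 'g set set" where
  "gr_homology \<gg> j = gr_cycles \<gg> j // gr_homologous \<gg> j"

definition filtered_quasi_iso ::
    "'g::ab_group_add filtered_dgla \<Rightarrow> 'h::ab_group_add filtered_dgla \<Rightarrow> ('g \<Rightarrow> 'h) \<Rightarrow> bool" where
  "filtered_quasi_iso \<gg> \<hh> \<phi> \<longleftrightarrow>
     dgla_morphism \<gg> \<hh> \<phi> \<and>
     (\<forall>j\<ge>1. \<phi> ` gfilt \<gg> j \<subseteq> gfilt \<hh> j) \<and>
     (\<forall>j\<ge>1. \<exists>\<Phi>. bij_betw \<Phi> (gr_homology \<gg> j) (gr_homology \<hh> j) \<and>
        (\<forall>x\<in>gr_cycles \<gg> j. \<Phi> (gr_homologous \<gg> j `` {x}) = gr_homologous \<hh> j `` {\<phi> x}))"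

section \<open>The dgla of formal functions\<close>

definition weight_filt :: "'w super_space \<Rightarrow> nat \<Rightarrow> 'w formal set" where
  "weight_filt W j =
     {f \<in> formal_functions W. \<forall>k ws. f k ws \<noteq> 0 \<longrightarrow> 2 * k + length ws > 2 \<and> 2 * k + length ws \<ge> j + 2}"

definition h_dgla :: "'w super_space \<Rightarrow> 'w formal filtered_dgla" where
  "h_dgla W =
     \<lparr>gspace = {f \<in> formal_functions W. \<forall>k ws. f k ws \<noteq> 0 \<longrightarrow> 2 * k + length ws > 2},
      gscale = (\<lambda>c f k ws. c * f k ws),
      gsign = ff_involution W,
      gdiff = (\<lambda>f. ff_diff W f + hbar_mult (laplacian W f)),
      gbracket = odd_bracket W,
      gfilt = weight_filt W\<rparr>"

text \<open>
  The pullback along an even linear map into another super vector space, as a formal function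
  on \<open>W\<close>.
\<close>

definition pullback :: "'w super_space \<Rightarrow> ('w \<Rightarrow> 'u) \<Rightarrow> 'u formal \<Rightarrow> 'w formal" where
  "pullback W p f = (\<lambda>k ws. if set ws \<subseteq> homog W then f k (map p ws) else 0)"

end

theory Submission
  imports Defs
begin

text \<open>
  The inclusion \<open>\<iota>\<close> has a filtered homotopy inverse: \<open>s\<close> extends to a derivation of formal functions
  whose anticommutator with \<open>d\<close> counts the arguments in the complement of \<open>im i\<close>; dividing by this
  number and perturbing by \<open>\<hbar>\<Delta>\<close> gives an operator \<open>K\<close> with \<open>K K = 0\<close>, \<open>K \<iota> = 0\<close> and
  \<open>1 - D K - K D\<close> mapping to the image of \<open>\<iota>\<close>.  This yields the quasi-isomorphism.  For the moduli
  sets, a contraction of a complete filtered dgla onto a subalgebra allows one to solve the equation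
  \<open>K (exp(b) m) = 0\<close> for the gauge parameter \<open>b\<close> by a fixed point iteration, and the Maurer-Cartan
  elements with \<open>K x = 0\<close> lie in the subalgebra.  Applied to the algebra itself this is surjectivity;
  applied to the algebra of paths it gives injectivity, and also, with integration as the
  contraction onto constant paths, that homotopy is an equivalence relation.
\<close>

section \<open>Gauge flows in complete filtered odd Lie algebras\<close>

text \<open>The weight explains the shape of the argument. The bracket removes two arguments and
  every element has weight at least 3, so bracketing with anything raises the filtration degree;
  this makes gauge series converge and the iterations contract. The operator \<hbar>\<Delta>,
  however, preserves the weight and survives on the associated graded, so the homotopy for d alone
  does not settle even the quasi-isomorphism and has to be perturbed. The small side keeps its own
  operations: the isometry of i and the orthogonality of ker p and im i make \<iota> commute with
  the Laplacian. The obstacle for the moduli sets is that a homotopy need not stay in the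
  subalgebra. Gauge fixing pushes a path into it, and end points that already lie there must not
  move; this is a uniqueness statement for gauge parameters in the image of \<open>K\<close>
  (\<open>slice_unique\<close>). Gauge transformations are handled one at a time: symmetry and
  transitivity of homotopy come from flows in the path algebra rather than from a group law.\<close>

definition conv :: "('g \<Rightarrow> 'g \<Rightarrow> 'g) \<Rightarrow> (nat \<Rightarrow> 'g) \<Rightarrow> (nat \<Rightarrow> 'g) \<Rightarrow> nat \<Rightarrow> 'g::comm_monoid_add" where
  "conv br a c k = (\<Sum>l\<le>k. br (a l) (c (k - l)))"

lemma sum_atMost_rev: "(\<Sum>l\<le>k. f (k - l)) = (\<Sum>l\<le>(k::nat). f l :: 'a::comm_monoid_add)"
  by (rule sum.reindex_bij_witness[where i="\<lambda>l. k - l" and j="\<lambda>l. k - l"]) auto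

text \<open>Both sides run over the triples with sum \<open>k\<close>. This is associativity of
  Cauchy products; the next lemma exchanges the first two factors, as the Jacobi identity for series
  requires.\<close>

lemma sum_triple_reindex:
  fixes f :: "nat \<Rightarrow> nat \<Rightarrow> nat \<Rightarrow> 'a::comm_monoid_add"
  shows "(\<Sum>j\<le>k. \<Sum>i\<le>j. f i (j - i) (k - j)) = (\<Sum>i\<le>k. \<Sum>j\<le>k - i. f i j (k - i - j))"
proof -
  have "(\<Sum>j\<le>k. \<Sum>i\<le>j. f i (j - i) (k - j)) = (\<Sum>(j, i)\<in>Sigma {..k} (\<lambda>j. {..j}). f i (j - i) (k - j))"
    by (simp add: sum.Sigma)
  also have "\<dots> = (\<Sum>(i, j)\<in>Sigma {..k} (\<lambda>i. {..k - i}). f i j (k - i - j))"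
    by (rule sum.reindex_bij_witness[where i="\<lambda>(i, j). (i + j, i)" and j="\<lambda>(j, i). (i, j - i)"])
      (auto simp: diff_diff_left)
  also have "\<dots> = (\<Sum>i\<le>k. \<Sum>j\<le>k - i. f i j (k - i - j))"
    by (simp add: sum.Sigma)
  finally show ?thesis .
qed

lemma sum_triple_reindex_swap:
  fixes f :: "nat \<Rightarrow> nat \<Rightarrow> nat \<Rightarrow> 'a::comm_monoid_add"
  shows "(\<Sum>i\<le>k. \<Sum>j\<le>k - i. f i j (k - i - j)) = (\<Sum>j\<le>k. \<Sum>i\<le>k - j. f i j (k - j - i))"
proof -
  have "(\<Sum>i\<le>k. \<Sum>j\<le>k - i. f i j (k - i - j)) = (\<Sum>(i, j)\<in>Sigma {..k} (\<lambda>i. {..k - i}). f i j (k - i - j))"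
    by (simp add: sum.Sigma)
  also have "\<dots> = (\<Sum>(j, i)\<in>Sigma {..k} (\<lambda>j. {..k - j}). f i j (k - j - i))"
    by (rule sum.reindex_bij_witness[where i="\<lambda>(i, j). (j, i)" and j="\<lambda>(j, i). (i, j)"])
      (auto simp: algebra_simps)
  also have "\<dots> = (\<Sum>j\<le>k. \<Sum>i\<le>k - j. f i j (k - j - i))"
    by (simp add: sum.Sigma)
  finally show ?thesis .
qed

text \<open>
  Here \<open>F 0\<close> is the underlying space; it is the first step of the filtration, so that bracketing
  with any element raises the filtration degree.
\<close>

locale gauge_algebra = vector_space scale
  for scale :: "real \<Rightarrow> 'g \<Rightarrow> 'g::ab_group_add" (infixr "*s" 75) +
  fixes sg D :: "'g \<Rightarrow> 'g" and br :: "'g \<Rightarrow> 'g \<Rightarrow> 'g" and F :: "nat \<Rightarrow> 'g set"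
  assumes F_zero: "0 \<in> F j"
    and F_add: "x \<in> F j \<Longrightarrow> y \<in> F j \<Longrightarrow> x + y \<in> F j"
    and F_scale: "x \<in> F j \<Longrightarrow> c *s x \<in> F j"
    and F_Suc: "F (Suc j) \<subseteq> F j"
    and separated: "(\<And>j. x \<in> F j) \<Longrightarrow> x = 0"
    and complete: "(\<And>n::nat. S n \<in> F 0) \<Longrightarrow> (\<And>j. \<exists>N. \<forall>n\<ge>N. S n - S N \<in> F j) \<Longrightarrow>
      \<exists>x\<in>F 0. \<forall>j. \<exists>N. \<forall>n\<ge>N. S n - x \<in> F j"
    and sg_add: "sg (x + y) = sg x + sg y" and sg_scale: "sg (c *s x) = c *s sg x"
    and sg_F: "x \<in> F j \<Longrightarrow> sg x \<in> F j" and sg_sg: "x \<in> F 0 \<Longrightarrow> sg (sg x) = x"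
    and D_add: "D (x + y) = D x + D y" and D_scale: "D (c *s x) = c *s D x"
    and D_F: "x \<in> F j \<Longrightarrow> D x \<in> F j" and D_D: "x \<in> F 0 \<Longrightarrow> D (D x) = 0"
    and sg_D: "x \<in> F 0 \<Longrightarrow> sg (D x) = - D (sg x)"
    and br_add_left: "br (x + y) z = br x z + br y z"
    and br_add_right: "br x (y + z) = br x y + br x z"
    and br_scale_left: "br (c *s x) y = c *s br x y"
    and br_scale_right: "br x (c *s y) = c *s br x y"
    and br_F_left: "x \<in> F j \<Longrightarrow> y \<in> F 0 \<Longrightarrow> br x y \<in> F (Suc j)"
    and br_F_right: "x \<in> F 0 \<Longrightarrow> y \<in> F j \<Longrightarrow> br x y \<in> F (Suc j)"
    and sg_br: "x \<in> F 0 \<Longrightarrow> y \<in> F 0 \<Longrightarrow> sg (br x y) = - br (sg x) (sg y)"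
    and br_sym: "x \<in> F 0 \<Longrightarrow> y \<in> F 0 \<Longrightarrow> sg x = x \<Longrightarrow> sg y = y \<Longrightarrow> br y x = br x y"
    and D_br: "x \<in> F 0 \<Longrightarrow> y \<in> F 0 \<Longrightarrow> D (br x y) = br (D x) y - br (sg x) (D y)"
    and jacobi: "x \<in> F 0 \<Longrightarrow> sg x = x \<Longrightarrow> y \<in> F 0 \<Longrightarrow> z \<in> F 0 \<Longrightarrow>
      br x (br y z) = br (br x y) z - br (sg y) (br x z)"
begin

lemma F_minus: "x \<in> F j \<Longrightarrow> - x \<in> F j"
  using F_scale[of x j "- 1"] by simp

lemma F_diff: "x \<in> F j \<Longrightarrow> y \<in> F j \<Longrightarrow> x - y \<in> F j"
  using F_add[of x j "- y"] F_minus by simp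

lemma F_sum: "(\<And>i. i \<in> I \<Longrightarrow> f i \<in> F j) \<Longrightarrow> sum f I \<in> F j"
  by (induction I rule: infinite_finite_induct) (auto simp: F_zero F_add)

lemma F_mono: "i \<le> j \<Longrightarrow> F j \<subseteq> F i"
  by (induction j rule: dec_induct) (use F_Suc in auto)

lemma F_0: "x \<in> F j \<Longrightarrow> x \<in> F 0"
  using F_mono[of 0 j] by auto

lemma half_double: "(1 / 2) *s (x + x) = x"
  by (metis scale_left_distrib scale_right_distrib field_sum_of_halves scale_one)

lemma D_zero [simp]: "D 0 = 0" using D_scale[of 0 0] by simp
lemma D_minus: "D (- x) = - D x" using D_scale[of "-1" x] by simp
lemma D_diff: "D (x - y) = D x - D y" using D_add[of x "- y"] by (simp add: D_minus)
lemma D_sum: "D (sum f I) = (\<Sum>i\<in>I. D (f i))"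
  by (induction I rule: infinite_finite_induct) (auto simp: D_add)
lemma sg_zero [simp]: "sg 0 = 0" using sg_scale[of 0 0] by simp
lemma sg_minus: "sg (- x) = - sg x" using sg_scale[of "-1" x] by simp
lemma sg_diff: "sg (x - y) = sg x - sg y" using sg_add[of x "- y"] by (simp add: sg_minus)
lemma sg_sum: "sg (sum f I) = (\<Sum>i\<in>I. sg (f i))"
  by (induction I rule: infinite_finite_induct) (auto simp: sg_add)
lemma br_zero_left [simp]: "br 0 y = 0" using br_scale_left[of 0 0] by simp
lemma br_zero_right [simp]: "br x 0 = 0" using br_scale_right[of x 0 0] by simp
lemma br_minus_left: "br (- x) y = - br x y" using br_scale_left[of "-1" x] by simp
lemma br_minus_right: "br x (- y) = - br x y" using br_scale_right[of x "-1" y] by simp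
lemma br_diff_left: "br (x - y) z = br x z - br y z"
  using br_add_left[of x "- y"] by (simp add: br_minus_left)
lemma br_diff_right: "br x (y - z) = br x y - br x z"
  using br_add_right[of x y "- z"] by (simp add: br_minus_right)
lemma br_sum_left: "br (sum f I) y = (\<Sum>i\<in>I. br (f i) y)"
  by (induction I rule: infinite_finite_induct) (auto simp: br_add_left)
lemma br_sum_right: "br x (sum f I) = (\<Sum>i\<in>I. br x (f i))"
  by (induction I rule: infinite_finite_induct) (auto simp: br_add_right)

lemma br_F: "x \<in> F j \<Longrightarrow> y \<in> F 0 \<Longrightarrow> br x y \<in> F j"
  using br_F_left F_Suc by blast

lemma br_F': "x \<in> F 0 \<Longrightarrow> y \<in> F j \<Longrightarrow> br x y \<in> F j"
  using br_F_right F_Suc by blast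

section \<open>Limits and sums of series in the filtration topology\<close>

definition tends :: "(nat \<Rightarrow> 'g) \<Rightarrow> 'g \<Rightarrow> bool" where
  "tends S x \<longleftrightarrow> (\<forall>j. \<exists>N. \<forall>n\<ge>N. S n - x \<in> F j)"

definition has_total :: "(nat \<Rightarrow> 'g) \<Rightarrow> 'g \<Rightarrow> bool" where
  "has_total a x \<longleftrightarrow> tends (\<lambda>n. \<Sum>k<n. a k) x"

definition null_seq :: "(nat \<Rightarrow> 'g) \<Rightarrow> bool" where
  "null_seq a \<longleftrightarrow> (\<forall>k. a k \<in> F 0) \<and> (\<forall>j. \<exists>N. \<forall>k\<ge>N. a k \<in> F j)"

lemma tends_diff:
  assumes "tends S x" "tends T y" shows "tends (\<lambda>n. S n - T n) (x - y)"
  unfolding tends_def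
proof
  fix j
  obtain N M where "\<forall>n\<ge>N. S n - x \<in> F j" "\<forall>n\<ge>M. T n - y \<in> F j"
    using assms unfolding tends_def by meson
  then have "\<forall>n\<ge>max N M. (S n - T n) - (x - y) \<in> F j"
  proof (intro allI impI)
    fix n assume "max N M \<le> n"
    then have "(S n - x) - (T n - y) \<in> F j"
      using \<open>\<forall>n\<ge>N. S n - x \<in> F j\<close> \<open>\<forall>n\<ge>M. T n - y \<in> F j\<close> by (simp add: F_diff)
    then show "(S n - T n) - (x - y) \<in> F j" by (simp add: algebra_simps)
  qed
  then show "\<exists>N. \<forall>n\<ge>N. (S n - T n) - (x - y) \<in> F j" by blast
qed

lemma tends_const: "tends (\<lambda>_. x) x"
  by (simp add: tends_def F_zero)

lemma tends_closed:
  assumes "tends S x" "\<And>n. n \<ge> N \<Longrightarrow> S n \<in> F j" shows "x \<in> F j"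
proof -
  obtain M where "\<forall>n\<ge>M. S n - x \<in> F j" using assms(1) unfolding tends_def by blast
  then have "S (max N M) - (S (max N M) - x) \<in> F j"
    by (intro F_diff[OF assms(2), of "max N M" "S (max N M) - x"]) auto
  then show ?thesis by simp
qed

lemma tends_zeroI: "tends S x \<Longrightarrow> (\<And>j. \<exists>N. \<forall>n\<ge>N. S n \<in> F j) \<Longrightarrow> x = 0"
  by (meson separated tends_closed)

lemma tends_unique:
  assumes "tends S x" "tends S y" shows "x = y"
proof -
  have "x - y = 0"
    by (rule tends_zeroI[OF tends_diff[OF assms]]) (simp add: F_zero)
  then show ?thesis by simp
qed

lemma tends_add: "tends S x \<Longrightarrow> tends T y \<Longrightarrow> tends (\<lambda>n. S n + T n) (x + y)"
  using tends_diff[of S x "\<lambda>n. 0 - T n" "0 - y"] tends_diff[OF tends_const[of 0], of T y] by simp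

lemma complete_tends:
  "(\<And>n. S n \<in> F 0) \<Longrightarrow> (\<And>j. \<exists>N. \<forall>n\<ge>N. S n - S N \<in> F j) \<Longrightarrow> \<exists>x\<in>F 0. tends S x"
  using complete[of S] unfolding tends_def by blast

lemma null_has_total:
  assumes "null_seq a" shows "\<exists>x\<in>F 0. has_total a x"
  unfolding has_total_def
proof (rule complete_tends)
  show "(\<Sum>k<n. a k) \<in> F 0" for n using assms by (auto simp: null_seq_def intro: F_sum)
next
  fix j
  obtain N where N: "\<forall>k\<ge>N. a k \<in> F j" using assms unfolding null_seq_def by blast
  have "(\<Sum>k<n. a k) - (\<Sum>k<N. a k) \<in> F j" if "n \<ge> N" for n
  proof -
    have "(\<Sum>k<n. a k) = (\<Sum>k<N. a k) + (\<Sum>k\<in>{N..<n}. a k)"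
      using that by (metis sum.atLeastLessThan_concat lessThan_atLeast0 zero_le)
    then show ?thesis using N by (auto intro!: F_sum)
  qed
  then show "\<exists>N. \<forall>n\<ge>N. (\<Sum>k<n. a k) - (\<Sum>k<N. a k) \<in> F j" by blast
qed

definition total :: "(nat \<Rightarrow> 'g) \<Rightarrow> 'g" where
  "total a = (THE x. has_total a x)"

lemma total_eq: "has_total a x \<Longrightarrow> total a = x"
  unfolding total_def has_total_def using tends_unique by blast

lemma has_total: "null_seq a \<Longrightarrow> has_total a (total a)"
  using null_has_total total_eq by blast

lemma total_F0: "null_seq a \<Longrightarrow> total a \<in> F 0"
  using null_has_total total_eq by blast

lemma has_total_F:
  assumes "has_total a x" "\<And>k. a k \<in> F j" shows "x \<in> F j"
  using assms tends_closed[of _ x 0 j] unfolding has_total_def by (auto intro: F_sum)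

lemma has_total_map:
  assumes "has_total a x" "\<And>x y. L (x + y) = L x + L y" "\<And>x j. x \<in> F j \<Longrightarrow> L x \<in> F j"
  shows "has_total (\<lambda>k. L (a k)) (L x)"
proof -
  have L0: "L 0 = 0" using assms(2)[of 0 0] by simp
  have Ld: "L (u - v) = L u - L v" for u v
    by (metis assms(2) add_diff_cancel diff_add_cancel)
  have "L (\<Sum>k<n. a k) = (\<Sum>k<n. L (a k))" for n
    by (induction n) (auto simp: L0 assms(2))
  then show ?thesis using assms(1,3)
    unfolding has_total_def tends_def by (metis Ld)
qed

lemma has_total_add: "has_total a x \<Longrightarrow> has_total c y \<Longrightarrow> has_total (\<lambda>k. a k + c k) (x + y)"
  unfolding has_total_def sum.distrib by (rule tends_add)

lemma has_total_scale: "has_total a x \<Longrightarrow> has_total (\<lambda>k. c *s a k) (c *s x)"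
  by (rule has_total_map) (auto simp: scale_right_distrib F_scale)

lemma has_total_single: "has_total (\<lambda>k. if k = i then x else 0) x"
  unfolding has_total_def tends_def
proof
  fix j
  have "\<forall>n\<ge>Suc i. (\<Sum>k<n. if k = i then x else 0) - x \<in> F j"
    by (auto simp: F_zero sum.delta)
  then show "\<exists>N. \<forall>n\<ge>N. (\<Sum>k<n. if k = i then x else 0) - x \<in> F j" by blast
qed

lemma null_seq_single: "x \<in> F 0 \<Longrightarrow> null_seq (\<lambda>k. if k = i then x else 0)"
  unfolding null_seq_def using F_zero by (metis Suc_n_not_le_n)

lemma null_seq_conv:
  assumes "null_seq a" "null_seq c" shows "null_seq (conv br a c)"
  unfolding null_seq_def
proof (intro conjI allI)
  show "conv br a c k \<in> F 0" for k
    using assms unfolding conv_def null_seq_def by (auto intro!: F_sum br_F)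
next
  fix j
  obtain N M where NM: "\<forall>k\<ge>N. a k \<in> F j" "\<forall>k\<ge>M. c k \<in> F j"
    using assms unfolding null_seq_def by meson
  have "conv br a c k \<in> F j" if "k \<ge> N + M" for k
    unfolding conv_def
  proof (rule F_sum)
    fix l assume "l \<in> {..k}"
    show "br (a l) (c (k - l)) \<in> F j"
      using NM assms that by (cases "l \<ge> N") (auto simp: null_seq_def intro: br_F br_F')
  qed
  then show "\<exists>N. \<forall>k\<ge>N. conv br a c k \<in> F j" by blast
qed

text \<open>The brackets of the partial sums tend to [x, y] by continuity. They differ from the
  partial sums of the Cauchy product by the terms with indices below \<open>n\<close> whose sum is
  at least \<open>n\<close>; for \<open>n\<close> \<ge> \<open>N + M\<close> one of the two indices
  is so large that the term lies in \<open>F j\<close>.\<close>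

lemma has_total_conv:
  assumes "null_seq a" "null_seq c" "has_total a x" "has_total c y"
  shows "has_total (conv br a c) (br x y)"
proof -
  let ?S = "\<lambda>n. \<Sum>k<n. a k" and ?T = "\<lambda>n. \<Sum>k<n. c k"
  have SF: "?S n \<in> F 0" for n using assms by (auto simp: null_seq_def intro: F_sum)
  have y: "y \<in> F 0"
    using assms null_has_total total_eq by metis
  have 1: "tends (\<lambda>n. br (?S n) (?T n)) (br x y)"
    unfolding tends_def
  proof
    fix j
    obtain N M where NM: "\<forall>n\<ge>N. ?S n - x \<in> F j" "\<forall>n\<ge>M. ?T n - y \<in> F j"
      using assms(3,4) unfolding has_total_def tends_def by meson
    have "br (?S n) (?T n) - br x y \<in> F j" if "n \<ge> max N M" for n
    proof -
      have "br (?S n) (?T n) - br x y = br (?S n) (?T n - y) + br (?S n - x) y"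
        by (simp add: br_diff_left br_diff_right)
      moreover have "br (?S n) (?T n - y) \<in> F j" using NM that SF by (intro br_F') auto
      moreover have "br (?S n - x) y \<in> F j" using NM that y by (intro br_F) auto
      ultimately show ?thesis using F_add by simp
    qed
    then show "\<exists>N. \<forall>n\<ge>N. br (?S n) (?T n) - br x y \<in> F j" by blast
  qed
  have 2: "tends (\<lambda>n. br (?S n) (?T n) - (\<Sum>k<n. conv br a c k)) 0"
    unfolding tends_def
  proof
    fix j
    obtain N M where NM: "\<forall>k\<ge>N. a k \<in> F j" "\<forall>k\<ge>M. c k \<in> F j"
      using assms unfolding null_seq_def by meson
    have "br (?S n) (?T n) - (\<Sum>k<n. conv br a c k) \<in> F j" if n: "n \<ge> N + M" for n
    proof -
      let ?g = "\<lambda>(k, l). br (a k) (c l)"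
      have "br (?S n) (?T n) = (\<Sum>z\<in>{..<n} \<times> {..<n}. ?g z)"
        unfolding br_sum_left unfolding br_sum_right by (simp add: sum.cartesian_product)
      also have "\<dots> = (\<Sum>z\<in>{(k, l). k + l < n}. ?g z) + (\<Sum>z\<in>{..<n} \<times> {..<n} - {(k, l). k + l < n}. ?g z)"
        by (subst add.commute, intro sum.subset_diff) auto
      also have "(\<Sum>z\<in>{(k, l). k + l < n}. ?g z) = (\<Sum>k<n. conv br a c k)"
        unfolding conv_def by (rule sum.triangle_reindex)
      finally have "br (?S n) (?T n) - (\<Sum>k<n. conv br a c k) =
          (\<Sum>z\<in>{..<n} \<times> {..<n} - {(k, l). k + l < n}. ?g z)" by simp
      also have "\<dots> \<in> F j"
      proof (rule F_sum)
        fix z assume "z \<in> {..<n} \<times> {..<n} - {(k, l). k + l < n}"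
        then obtain k l where z: "z = (k, l)" "\<not> k + l < n" by auto
        then show "?g z \<in> F j" using n NM assms
          by (cases "k \<ge> N") (auto simp: null_seq_def intro: br_F br_F')
      qed
      finally show ?thesis .
    qed
    then show "\<exists>N. \<forall>n\<ge>N. br (?S n) (?T n) - (\<Sum>k<n. conv br a c k) - 0 \<in> F j" by auto
  qed
  show ?thesis using tends_diff[OF 1 2] unfolding has_total_def by simp
qed

subsection \<open>The flow of a constant gauge parameter\<close>

definition mc :: "'g set" where
  "mc = {m \<in> F 0. sg m = m \<and> D m + (1 / 2) *s br m m = 0}"

text \<open>The Taylor coefficients of the solution of \<open>a' = - (D b + [a, b])\<close>, \<open>a(0) = m\<close>.\<close>

primrec flow :: "'g \<Rightarrow> 'g \<Rightarrow> nat \<Rightarrow> 'g" where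
  "flow b m 0 = m"
| "flow b m (Suc k) = (- 1 / real (Suc k)) *s ((if k = 0 then D b else 0) + br (flow b m k) b)"

definition gauge :: "'g \<Rightarrow> 'g \<Rightarrow> 'g" where
  "gauge b m = total (flow b m)"

lemma flow_F0: "b \<in> F 0 \<Longrightarrow> m \<in> F 0 \<Longrightarrow> flow b m k \<in> F 0"
  by (induction k) (simp, unfold flow.simps, intro F_scale F_add br_F, auto intro: F_zero D_F)

text \<open>Each step brackets with \<open>b\<close> and so gains one degree. The index is off by
  one because the first step contributes \<open>D b\<close>, which gains nothing.\<close>

lemma flow_F_Suc: "b \<in> F 0 \<Longrightarrow> m \<in> F 0 \<Longrightarrow> flow b m (Suc k) \<in> F k"
proof (induction k)
  case 0 then show ?case using flow_F0[of b m "Suc 0"] by simp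
next
  case (Suc k)
  show ?case
    using br_F_left[OF Suc.IH[OF Suc.prems] Suc.prems(1)]
    unfolding flow.simps(2)[of b m "Suc k"] by (intro F_scale) (simp del: flow.simps)
qed

lemma null_seq_flow:
  assumes "b \<in> F 0" "m \<in> F 0" shows "null_seq (flow b m)"
  unfolding null_seq_def
proof (intro conjI allI)
  fix j
  have "flow b m k \<in> F j" if "k \<ge> Suc j" for k
    using that flow_F_Suc[OF assms, of "k - 1"] F_mono[of j "k - 1"] by (cases k) auto
  then show "\<exists>N. \<forall>k\<ge>N. flow b m k \<in> F j" by blast
qed (use assms flow_F0 in auto)

lemma flow_even:
  assumes "b \<in> F 0" "m \<in> F 0" "sg m = m" "sg b = - b"
  shows "sg (flow b m k) = flow b m k"
proof (induction k)
  case (Suc k)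
  have "sg (br (flow b m k) b) = br (flow b m k) b"
    using Suc by (simp add: sg_br flow_F0 assms br_minus_right)
  then show ?case by (auto simp: sg_scale sg_add sg_diff sg_minus sg_D assms D_minus)
qed (use assms in auto)

lemma has_total_gauge: "b \<in> F 0 \<Longrightarrow> m \<in> F 0 \<Longrightarrow> has_total (flow b m) (gauge b m)"
  unfolding gauge_def by (rule has_total) (rule null_seq_flow)

lemma gauge_F0: "b \<in> F 0 \<Longrightarrow> m \<in> F 0 \<Longrightarrow> gauge b m \<in> F 0"
  unfolding gauge_def by (rule total_F0) (rule null_seq_flow)

lemma gauge_even:
  assumes "b \<in> F 0" "m \<in> F 0" "sg m = m" "sg b = - b"
  shows "sg (gauge b m) = gauge b m"
  using has_total_map[OF has_total_gauge[OF assms(1,2)], of sg] flow_even[OF assms]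
    has_total_gauge[OF assms(1,2)] tends_unique unfolding has_total_def
  by (auto simp: sg_add sg_F)

text \<open>The Leibniz rule for d/dt of a bracket of power series, read off at t^k: the factor k +
  1 is split as l + (k + 1 - l) in each summand.\<close>

lemma conv_Suc_deriv:
  "real (Suc k) *s conv br a c (Suc k) =
    conv br (\<lambda>l. real (Suc l) *s a (Suc l)) c k + conv br a (\<lambda>l. real (Suc l) *s c (Suc l)) k"
proof -
  have "real (Suc k) *s conv br a c (Suc k) =
      (\<Sum>l\<le>Suc k. real l *s br (a l) (c (Suc k - l)) + real (Suc k - l) *s br (a l) (c (Suc k - l)))"
    unfolding conv_def scale_sum_right
    by (intro sum.cong refl) (simp add: scale_left_distrib[symmetric] of_nat_diff del: of_nat_Suc)
  also have "\<dots> = (\<Sum>l\<le>Suc k. real l *s br (a l) (c (Suc k - l))) +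
      (\<Sum>l\<le>Suc k. real (Suc k - l) *s br (a l) (c (Suc k - l)))"
    by (rule sum.distrib)
  also have "(\<Sum>l\<le>Suc k. real l *s br (a l) (c (Suc k - l))) = conv br (\<lambda>l. real (Suc l) *s a (Suc l)) c k"
    unfolding sum.atMost_Suc_shift conv_def by (simp add: br_scale_left)
  also have "(\<Sum>l\<le>Suc k. real (Suc k - l) *s br (a l) (c (Suc k - l))) =
      conv br a (\<lambda>l. real (Suc l) *s c (Suc l)) k"
    unfolding conv_def sum.atMost_Suc
    by (auto simp: br_scale_right Suc_diff_le simp del: of_nat_Suc intro!: sum.cong)
  finally show ?thesis .
qed

lemma conv_sym:
  assumes "\<And>k. a k \<in> F 0" "\<And>k. c k \<in> F 0" "\<And>k. sg (a k) = a k" "\<And>k. sg (c k) = c k"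
  shows "conv br a c k = conv br c a k"
proof -
  have "conv br a c k = (\<Sum>l\<le>k. br (a (k - l)) (c l))"
    unfolding conv_def using sum_atMost_rev[of "\<lambda>l. br (a l) (c (k - l))" k] by simp
  then show ?thesis unfolding conv_def using assms br_sym by simp
qed

text \<open>Bracketing with an odd \<open>b\<close> from the right is a derivation on even elements.
  This form of the Jacobi identity is what makes the curvature equation of the flow linear.\<close>

lemma jacobi_odd:
  assumes "x \<in> F 0" "y \<in> F 0" "b \<in> F 0" "sg x = x" "sg y = y" "sg b = - b"
  shows "br (br x b) y + br (br y b) x = br (br x y) b"
proof -
  have "br (br x b) y = br y (br x b)" "br (br y b) x = br x (br y b)"
    using assms by (auto intro!: br_sym br_F simp: sg_br br_minus_right)
  moreover have "br x (br y b) = br (br x y) b - br y (br x b)"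
    using jacobi[of x y b] assms by simp
  ultimately show ?thesis by simp
qed

text \<open>The curvature of the flow satisfies a linear differential equation.\<close>

lemma flow_curvature:
  assumes b: "b \<in> F 0" "sg b = - b" and m: "m \<in> mc"
  shows "D (flow b m k) + (1 / 2) *s conv br (flow b m) (flow b m) k = 0"
proof (induction k)
  case 0 then show ?case using m by (simp add: mc_def conv_def)
next
  case (Suc k)
  let ?g = "flow b m"
  have m': "m \<in> F 0" "sg m = m" using m by (auto simp: mc_def)
  have gF: "?g l \<in> F 0" and ge: "sg (?g l) = ?g l" for l
    using flow_F0 flow_even b m' by auto
  let ?h = "\<lambda>l. real (Suc l) *s ?g (Suc l)"
  have h: "?h l = - ((if l = 0 then D b else 0) + br (?g l) b)" for l
    by simp
  have "real (Suc k) *s conv br ?g ?g (Suc k) = conv br ?h ?g k + conv br ?g ?h k"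
    by (rule conv_Suc_deriv)
  also have "conv br ?g ?h k = conv br ?h ?g k"
    by (rule conv_sym) (use gF ge F_scale in \<open>auto simp: sg_scale simp del: flow.simps of_nat_Suc\<close>)
  also have "conv br ?h ?g k = - br (D b) (?g k) - (\<Sum>l\<le>k. br (br (?g l) b) (?g (k - l)))"
  proof -
    have "conv br ?h ?g k = (\<Sum>l\<le>k. (if l = 0 then - br (D b) (?g k) else 0) - br (br (?g l) b) (?g (k - l)))"
      unfolding conv_def h by (intro sum.cong) (auto simp: br_minus_left br_add_left br_diff_left)
    then show ?thesis by (simp add: sum_subtractf)
  qed
  finally have "real (Suc k) *s conv br ?g ?g (Suc k) =
      (- br (D b) (?g k) - (\<Sum>l\<le>k. br (br (?g l) b) (?g (k - l)))) +
      (- br (D b) (?g k) - (\<Sum>l\<le>k. br (br (?g l) b) (?g (k - l))))" .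
  then have 1: "real (Suc k) *s ((1/2) *s conv br ?g ?g (Suc k)) =
      - br (D b) (?g k) - (\<Sum>l\<le>k. br (br (?g l) b) (?g (k - l)))"
    by (subst scale_left_commute) (simp only: half_double)
  have 2: "(\<Sum>l\<le>k. br (br (?g l) b) (?g (k - l))) = (1/2) *s br (conv br ?g ?g k) b"
  proof -
    let ?s = "\<Sum>l\<le>k. br (br (?g l) b) (?g (k - l))"
    have "?s + ?s = ?s + (\<Sum>l\<le>k. br (br (?g (k - l)) b) (?g l))"
      using sum_atMost_rev[of "\<lambda>l. br (br (?g l) b) (?g (k - l))" k] by simp
    also have "\<dots> = (\<Sum>l\<le>k. br (br (?g l) (?g (k - l))) b)"
      unfolding sum.distrib[symmetric] using jacobi_odd gF ge b by simp
    also have "\<dots> = br (conv br ?g ?g k) b" by (simp add: conv_def br_sum_left)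
    finally have "(1/2) *s (?s + ?s) = (1/2) *s br (conv br ?g ?g k) b" by simp
    then show ?thesis by (simp only: half_double)
  qed
  have "br (D b) (?g k) = br (?g k) (D b)"
    by (rule br_sym) (use gF ge b in \<open>auto simp: D_F sg_D D_minus\<close>)
  then have "real (Suc k) *s D (?g (Suc k)) = - br (D (?g k)) b + br (D b) (?g k)"
    using h[of k] gF b ge
    by (auto simp: D_scale[symmetric] D_minus D_diff D_add D_D D_br simp del: of_nat_Suc flow.simps)
  \<comment> \<open>With C for the curvature of the flow, the terms containing \<open>D b\<close>
    cancel and C' = - [C, b] remains; since C vanishes at order 0, it vanishes at all
    orders.\<close>
  then have "real (Suc k) *s (D (?g (Suc k)) + (1/2) *s conv br ?g ?g (Suc k)) =
      - br (D (?g k) + (1/2) *s conv br ?g ?g k) b"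
    unfolding scale_right_distrib 1 2 by (simp add: br_add_left br_scale_left)
  then show ?case using Suc by (simp del: of_nat_Suc flow.simps)
qed

lemma gauge_mc:
  assumes "b \<in> F 0" "sg b = - b" "m \<in> mc" shows "gauge b m \<in> mc"
proof -
  have m: "m \<in> F 0" "sg m = m" using assms by (auto simp: mc_def)
  have "has_total (\<lambda>k. D (flow b m k) + (1/2) *s conv br (flow b m) (flow b m) k)
     (D (gauge b m) + (1/2) *s br (gauge b m) (gauge b m))"
    using has_total_map[OF has_total_gauge[OF assms(1) m(1)], of D] m assms has_total_gauge null_seq_flow
    by (intro has_total_add has_total_scale has_total_conv) (auto simp: D_add D_F)
  then have "D (gauge b m) + (1/2) *s br (gauge b m) (gauge b m) = 0"
    unfolding flow_curvature[OF assms] has_total_def using tends_unique[OF _ tends_const[of 0]] by simp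
  then show ?thesis using gauge_F0 gauge_even m assms by (auto simp: mc_def)
qed

lemma flow_zero: "flow 0 m k = (if k = 0 then m else 0)"
  by (cases k) auto

lemma gauge_zero: "gauge 0 m = m"
  unfolding gauge_def by (rule total_eq) (use has_total_single[of 0 m] in \<open>simp add: flow_zero[abs_def]\<close>)

text \<open>Modulo higher terms \<open>gauge b m\<close> is \<open>m - D b\<close>, so adding \<open>D b\<close> leaves a contraction in \<open>b\<close>.\<close>

lemma gauge_diff:
  assumes b: "b \<in> F 0" "c \<in> F 0" "b - c \<in> F j" and m: "m \<in> F 0"
  shows "(gauge b m + D b) - (gauge c m + D c) \<in> F (Suc j)"
proof -
  let ?d = "\<lambda>k. flow b m k - flow c m k"
  have step: "br (flow b m k) b - br (flow c m k) c \<in> F (Suc j)" if "?d k \<in> F j" for k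
  proof -
    have "br (flow b m k) b - br (flow c m k) c = br (?d k) b + br (flow c m k) (b - c)"
      by (simp add: br_diff_left br_diff_right)
    moreover have "br (?d k) b \<in> F (Suc j)" using that b by (intro br_F_left)
    moreover have "br (flow c m k) (b - c) \<in> F (Suc j)" using b m flow_F0 by (intro br_F_right)
    ultimately show ?thesis using F_add by simp
  qed
  have dF: "?d k \<in> F j" for k
  proof (induction k)
    case (Suc k)
    have "?d (Suc k) = (-1 / real (Suc k)) *s ((if k = 0 then D (b - c) else 0) + (br (flow b m k) b - br (flow c m k) c))"
    proof -
      have "?d (Suc k) = (-1 / real (Suc k)) *s (((if k = 0 then D b else 0) + br (flow b m k) b)
         - ((if k = 0 then D c else 0) + br (flow c m k) c))"
        by (simp only: flow.simps scale_right_diff_distrib)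
      then show ?thesis by (cases "k = 0") (simp_all add: D_diff algebra_simps del: of_nat_Suc flow.simps(2))
    qed
    moreover have "br (flow b m k) b - br (flow c m k) c \<in> F j" using step[OF Suc] F_Suc by blast
    moreover have "(if k = 0 then D (b - c) else 0) \<in> F j" using b D_F F_zero by simp
    ultimately show ?case using F_scale F_add by presburger
  qed (simp add: F_zero)
  \<comment> \<open>Only the coefficient of order 1 contains \<open>D\<close> applied to the
    parameter without a bracket. Adding it back leaves brackets with an argument in
    \<open>F j\<close>, which lie one degree higher.\<close>
  let ?e = "\<lambda>k. ?d k + (if k = 1 then D (b - c) else 0)"
  have eF: "?e k \<in> F (Suc j)" for k
  proof (cases k)
    case (Suc l)
    have "?e k = (-1 / real (Suc l)) *s (br (flow b m l) b - br (flow c m l) c)"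
    proof -
      have "?d (Suc l) = (-1 / real (Suc l)) *s (((if l = 0 then D b else 0) + br (flow b m l) b)
         - ((if l = 0 then D c else 0) + br (flow c m l) c))"
        by (simp only: flow.simps scale_right_diff_distrib)
      then show ?thesis unfolding Suc
        by (cases "l = 0") (simp_all add: D_diff scale_right_diff_distrib scale_right_distrib del: flow.simps(2))
    qed
    then show ?thesis using step[OF dF] F_scale by (simp add: F_minus)
  qed (simp add: F_zero)
  have "has_total ?d (gauge b m - gauge c m)"
    using tends_diff[OF has_total_gauge[OF b(1) m, unfolded has_total_def] has_total_gauge[OF b(2) m, unfolded has_total_def]]
    by (simp add: has_total_def sum_subtractf)
  then have "has_total ?e ((gauge b m - gauge c m) + D (b - c))"
    by (rule has_total_add) (rule has_total_single)
  then have "(gauge b m - gauge c m) + D (b - c) \<in> F (Suc j)"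
    using eF by (rule has_total_F)
  then show ?thesis by (simp add: D_diff algebra_simps)
qed

end

text \<open>A strong deformation retraction onto \<open>S\<close>, with \<open>K\<close> as
  homotopy. Closure of \<open>S\<close> under the bracket enters as \<open>S_br\<close>: the
  Maurer-Cartan equation contains squares, and \<open>K\<close> annihilates
  \<open>S\<close>.\<close>

locale gauge_contraction = gauge_algebra scale sg D br F
  for scale :: "real \<Rightarrow> 'g \<Rightarrow> 'g::ab_group_add" and sg D br F +
  fixes K :: "'g \<Rightarrow> 'g" and S :: "'g set"
  assumes K_add: "K (x + y) = K x + K y" and K_scale: "K (scale c x) = scale c (K x)"
    and K_F: "x \<in> F j \<Longrightarrow> K x \<in> F j" and sg_K: "x \<in> F 0 \<Longrightarrow> sg (K x) = - K (sg x)"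
    and K_K: "x \<in> F 0 \<Longrightarrow> K (K x) = 0"
    and K_S: "x \<in> S \<Longrightarrow> K x = 0" and S_F: "S \<subseteq> F 0" and S_br: "x \<in> S \<Longrightarrow> K (br x x) = 0"
    and S_proj: "x \<in> F 0 \<Longrightarrow> x - D (K x) - K (D x) \<in> S"
begin

lemma K_zero [simp]: "K 0 = 0" using K_scale[of 0 0] by simp
lemma K_minus: "K (- x) = - K x" using K_scale[of "-1" x] by simp
lemma K_diff: "K (x - y) = K x - K y" using K_add[of x "- y"] by (simp add: K_minus)

text \<open>Apply \<open>K\<close> to the element of \<open>S\<close> given by \<open>S_proj\<close>
  and use that \<open>K\<close> squares to zero. Hence a parameter in the image of \<open>K\<close>
  is recovered from its differential.\<close>

lemma K_D_K: "x \<in> F 0 \<Longrightarrow> K (D (K x)) = K x"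
  using K_S[OF S_proj[of x]] K_K[of "D x"] D_F[of x 0] by (simp add: K_diff)

text \<open>For \<open>b\<close> in the image of \<open>K\<close> one has K (D b) = b, so the
  equation is the gauge condition K (gauge b m) = 0 in disguise. In this form the right-hand side
  gains one degree in \<open>b\<close> by \<open>gauge_diff\<close>, and iteration from 0
  converges.\<close>

lemma fixed_point:
  assumes m: "m \<in> F 0" "sg m = m"
  shows "\<exists>b. b \<in> F 0 \<and> sg b = - b \<and> b = K (gauge b m + D b)"
proof -
  let ?T = "\<lambda>b. K (gauge b m + D b)"
  let ?b = "\<lambda>n. (?T ^^ n) 0"
  have TF: "?T b \<in> F 0" if "b \<in> F 0" for b
    using that m by (auto intro!: K_F F_add gauge_F0 D_F)
  have To: "sg (?T b) = - ?T b" if "b \<in> F 0" "sg b = - b" for b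
    using that m by (simp add: sg_K F_add gauge_F0 D_F sg_add gauge_even sg_D D_minus)
  have bF: "?b n \<in> F 0" for n by (induction n) (auto simp: F_zero TF)
  have bo: "sg (?b n) = - ?b n" for n by (induction n) (auto simp: To bF)
  have T: "?T b - ?T c \<in> F (Suc j)" if "b \<in> F 0" "c \<in> F 0" "b - c \<in> F j" for b c j
    using gauge_diff[OF that m(1)] K_F by (metis K_diff)
  have step: "?b (Suc n) - ?b n \<in> F n" for n
  proof (induction n)
    case 0 show ?case using F_diff[OF bF[of 1] bF[of 0]] by simp
  next
    case (Suc n) then show ?case using T[OF bF[of "Suc n"] bF[of n]] by simp
  qed
  have cauchy: "?b n - ?b N \<in> F N" if "n \<ge> N" for n N
    using that
  proof (induction n rule: dec_induct)
    case (step n)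
    have "?b (Suc n) - ?b n \<in> F N" using \<open>?b (Suc n) - ?b n \<in> F n\<close> F_mono step by blast
    then have "(?b (Suc n) - ?b n) + (?b n - ?b N) \<in> F N" using step F_add by blast
    then show ?case by simp
  qed (simp add: F_zero)
  have "\<exists>b\<in>F 0. tends ?b b"
    by (rule complete_tends) (use bF cauchy in blast)+
  then obtain b where b: "b \<in> F 0" "tends ?b b" by blast
  have near: "?b n - b \<in> F n" for n
  proof -
    have "tends (\<lambda>k. ?b n - ?b k) (?b n - b)" by (rule tends_diff[OF tends_const b(2)])
    moreover have "?b n - ?b k \<in> F n" if "k \<ge> n" for k
      using F_minus[OF cauchy[OF that]] by simp
    ultimately show ?thesis by (rule tends_closed)
  qed
  have "?T b - b = 0"
  proof (rule separated)
    fix j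
    have "?T (?b j) - ?T b \<in> F (Suc j)" using T[OF bF b(1) near] .
    then have "?b (Suc j) - ?T b \<in> F (Suc j)" by simp
    then have "(?b (Suc j) - b) - (?b (Suc j) - ?T b) \<in> F (Suc j)" using near F_diff by blast
    then show "?T b - b \<in> F j" using F_Suc by auto
  qed
  moreover have "sg b = - b"
  proof -
    have "sg b + b = 0"
    proof (rule separated)
      fix j
      have "sg (?b j - b) + (?b j - b) \<in> F j" using near by (intro F_add sg_F)
      then have "- (sg (?b j - b) + (?b j - b)) \<in> F j" by (rule F_minus)
      then show "sg b + b \<in> F j" using bo[of j] by (simp add: sg_diff add.commute)
    qed
    then show ?thesis by (simp add: eq_neg_iff_add_eq_0)
  qed
  ultimately show ?thesis using b by auto
qed

text \<open>The gauge parameter is the fixed point above, which makes \<open>K x = 0\<close> for \<open>x = gauge b m\<close>.  Then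
  \<open>z = K (D x)\<close> satisfies \<open>z = - K [x, x] / 2\<close> with \<open>x - z \<in> S\<close>, and this forces \<open>z = 0\<close>.\<close>

theorem gauge_fixing:
  assumes m: "m \<in> mc"
  obtains b u where "b \<in> F 0" "sg b = - b" "u \<in> F 0" "b = K u" "gauge b m \<in> mc"
    "gauge b m \<in> S"
proof -
  have m': "m \<in> F 0" "sg m = m" using m by (auto simp: mc_def)
  obtain b where b: "b \<in> F 0" "sg b = - b" "b = K (gauge b m + D b)"
    using fixed_point[OF m'] by auto
  let ?x = "gauge b m"
  let ?u = "?x + D b"
  have u: "?u \<in> F 0" using b m' by (auto intro: F_add gauge_F0 D_F)
  have x: "?x \<in> mc" using gauge_mc b m by auto
  then have xF: "?x \<in> F 0" "sg ?x = ?x" by (auto simp: mc_def)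
  have "K (D b) = b" using K_D_K[OF u] b(3) by metis
  then have Kx: "K ?x = 0" using b(3) by (simp add: K_add)
  define s where "s = ?x - K (D ?x)"
  define z where "z = K (D ?x)"
  have s: "s \<in> S" using S_proj[OF xF(1)] Kx by (simp add: s_def)
  have zF: "z \<in> F 0" "sg z = z" unfolding z_def using xF by (auto simp: sg_K D_F K_F sg_D K_minus)
  have sF: "s \<in> F 0" "sg s = s" using s S_F xF zF by (auto simp: s_def z_def[symmetric] sg_diff)
  have xsz: "?x = s + z" by (simp add: s_def z_def)
  have Dx: "D ?x = - (scale (1 / 2) (br ?x ?x))"
    using x by (auto simp: mc_def eq_neg_iff_add_eq_0)
  have "br ?x ?x = br s s + scale 2 (br s z) + br z z"
    unfolding xsz br_add_left br_add_right using br_sym[OF sF(1) zF(1) sF(2) zF(2)]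
    using scale_left_distrib[of 1 1 "br s z"] by (simp add: add.assoc)
  then have "K (br ?x ?x) = K (scale 2 (br s z) + br z z)"
    using S_br[OF s] by (simp only: K_add add_0)
  then have zeq: "z = - (scale (1 / 2) (K (scale 2 (br s z) + br z z)))"
    using arg_cong[OF Dx, of K] by (simp only: K_minus K_scale z_def[symmetric])
  \<comment> \<open>Every summand under \<open>K\<close> in \<open>zeq\<close> contains a factor
    \<open>z\<close>, so membership in \<open>F j\<close> improves itself to membership in
    \<open>F (Suc j)\<close>.\<close>
  have "z = 0"
  proof (rule separated)
    show "z \<in> F j" for j
    proof (induction j)
      case (Suc j)
      have "- (scale (1 / 2) (K (scale 2 (br s z) + br z z))) \<in> F (Suc j)"
        using Suc sF zF by (intro F_minus F_scale K_F F_add br_F_right br_F_left)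
      then show ?case using zeq by simp
    qed (use zF in simp)
  qed
  then have "?x \<in> S" using xsz s by simp
  then show ?thesis using that b u x by metis
qed

text \<open>Near \<open>m\<close> the orbit is m - D b up to higher terms, and \<open>K\<close>
  sends D b back to \<open>b\<close>; so if \<open>b\<close> lies in \<open>F j\<close>, the two
  conditions K (gauge b m) = 0 and K m = 0 force it into \<open>F (Suc j)\<close>. This keeps the
  end points of a path fixed while the path is gauge fixed.\<close>

lemma slice_unique:
  assumes m: "m \<in> S" and b: "b \<in> F 0" "sg b = - b" "u \<in> F 0" "b = K u" and K: "K (gauge b m) = 0"
  shows "b = 0"
proof (rule separated)
  show "b \<in> F j" for j
  proof (induction j)
    case (Suc j)
    have "(gauge b m + D b) - (gauge 0 m + D 0) \<in> F (Suc j)"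
      using gauge_diff[of b 0 j m] b F_zero Suc m S_F by auto
    then have "K ((gauge b m + D b) - m) \<in> F (Suc j)" using K_F by (simp add: gauge_zero)
    moreover have "K (D b) = b" using K_D_K b by simp
    ultimately show ?case using K K_S[OF m] by (simp add: K_diff K_add)
  qed (use b in simp)
qed

end

text \<open>Compatibility is demanded on \<open>F 0\<close> because one instance is evaluation of
  paths at t = 1, the sum of a series, which is meaningful for null sequences only.\<close>

locale gauge_morphism = A: gauge_algebra scale sg D br F + B: gauge_algebra scale' sg' D' br' F'
  for scale :: "real \<Rightarrow> 'g \<Rightarrow> 'g::ab_group_add" and sg D br F
    and scale' :: "real \<Rightarrow> 'h \<Rightarrow> 'h::ab_group_add" and sg' D' br' F' +
  fixes \<phi> :: "'g \<Rightarrow> 'h"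
  assumes map_F: "x \<in> F j \<Longrightarrow> \<phi> x \<in> F' j"
    and map_add: "x \<in> F 0 \<Longrightarrow> y \<in> F 0 \<Longrightarrow> \<phi> (x + y) = \<phi> x + \<phi> y"
    and map_scale: "x \<in> F 0 \<Longrightarrow> \<phi> (scale c x) = scale' c (\<phi> x)"
    and map_D: "x \<in> F 0 \<Longrightarrow> \<phi> (D x) = D' (\<phi> x)"
    and map_sg: "x \<in> F 0 \<Longrightarrow> \<phi> (sg x) = sg' (\<phi> x)"
    and map_br: "x \<in> F 0 \<Longrightarrow> y \<in> F 0 \<Longrightarrow> \<phi> (br x y) = br' (\<phi> x) (\<phi> y)"
begin

lemma map_zero: "\<phi> 0 = 0"
  using map_scale[of 0 0] A.F_zero by simp

lemma map_diff: "x \<in> F 0 \<Longrightarrow> y \<in> F 0 \<Longrightarrow> \<phi> (x - y) = \<phi> x - \<phi> y"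
  using map_add[of "x - y" y] A.F_diff by auto

lemma map_minus: "x \<in> F 0 \<Longrightarrow> \<phi> (- x) = - \<phi> x"
  using map_diff[of 0 x] A.F_zero by (simp add: map_zero)

lemma map_flow:
  assumes "b \<in> F 0" "m \<in> F 0" shows "\<phi> (A.flow b m k) = B.flow (\<phi> b) (\<phi> m) k"
proof (induction k)
  case (Suc k)
  have "A.flow b m k \<in> F 0" by (rule A.flow_F0[OF assms])
  then have br: "br (A.flow b m k) b \<in> F 0" "\<phi> (br (A.flow b m k) b) = br' (B.flow (\<phi> b) (\<phi> m) k) (\<phi> b)"
    using Suc assms by (auto simp: A.br_F map_br)
  have D: "(if k = 0 then D b else 0) \<in> F 0"
    using assms by (auto simp: A.F_zero A.D_F)
  show ?case
    unfolding A.flow.simps B.flow.simps map_scale[OF A.F_add[OF D br(1)]] map_add[OF D br(1)] br(2)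
    using assms by (simp add: map_D map_zero)
qed simp

lemma map_gauge:
  assumes "b \<in> F 0" "m \<in> F 0" shows "\<phi> (A.gauge b m) = B.gauge (\<phi> b) (\<phi> m)"
proof -
  have flF: "A.flow b m k \<in> F 0" for k by (rule A.flow_F0[OF assms])
  have sF: "(\<Sum>k<n. A.flow b m k) \<in> F 0" for n using flF by (rule A.F_sum)
  have *: "\<phi> (\<Sum>k<n. A.flow b m k) = (\<Sum>k<n. B.flow (\<phi> b) (\<phi> m) k)" for n
    by (induction n) (auto simp: map_zero map_add sF flF map_flow assms)
  have "B.has_total (B.flow (\<phi> b) (\<phi> m)) (\<phi> (A.gauge b m))"
    unfolding B.has_total_def B.tends_def *[symmetric]
    using A.has_total_gauge[OF assms] unfolding A.has_total_def A.tends_def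
    by (metis map_diff map_F A.gauge_F0 assms sF)
  then show ?thesis unfolding B.gauge_def using B.total_eq by metis
qed

lemma map_mc: "m \<in> A.mc \<Longrightarrow> \<phi> m \<in> B.mc"
  unfolding A.mc_def B.mc_def
  by (auto simp: map_F map_sg[symmetric] map_D[symmetric] map_br[symmetric] map_scale[symmetric]
      map_add[symmetric] map_zero A.br_F A.D_F A.F_scale)

end

section \<open>Calculus of formal functions\<close>

lemma sum_fun_apply: "sum f I x = (\<Sum>i\<in>I. f i x)"
  by (induction I rule: infinite_finite_induct) auto

lemma additive_sum:
  fixes L :: "'a::comm_monoid_add \<Rightarrow> 'b::comm_monoid_add"
  assumes "\<And>x y. L (x + y) = L x + L y" "L 0 = 0"
  shows "L (sum f I) = (\<Sum>i\<in>I. L (f i))"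
  by (induction I rule: infinite_finite_induct) (auto simp: assms)

lemma sum_fun_apply2: "sum f I x y = (\<Sum>i\<in>I. f i x y)"
  by (simp add: sum_fun_apply)

definition ff_scale :: "real \<Rightarrow> 'w formal \<Rightarrow> 'w formal" where
  "ff_scale c f = (\<lambda>k ws. c * f k ws)"

lemma ff_scale_apply [simp]: "ff_scale c f k ws = c * f k ws"
  by (simp add: ff_scale_def)

lemma ff_scale_linear:
  "ff_scale c (f + g) = ff_scale c f + ff_scale c g"
  "ff_scale c (f - g) = ff_scale c f - ff_scale c g"
  "ff_scale c (- f) = - ff_scale c f"
  "ff_scale c 0 = 0"
  by (auto simp: fun_eq_iff algebra_simps)

lemma ff_mult_Nil: "ff_mult W f g k [] = (\<Sum>j\<le>k. f j [] * g (k - j) [])"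
  by (simp add: ff_mult_def shuffle_sign_def)

lemma ff_mult_add_left: "ff_mult W (f + f') g = ff_mult W f g + ff_mult W f' g"
  by (simp add: ff_mult_def fun_eq_iff algebra_simps sum.distrib)

lemma ff_mult_add_right: "ff_mult W f (g + g') = ff_mult W f g + ff_mult W f g'"
  by (simp add: ff_mult_def fun_eq_iff algebra_simps sum.distrib)

lemma ff_mult_scale_left: "ff_mult W (ff_scale c f) g = ff_scale c (ff_mult W f g)"
  by (simp add: ff_mult_def fun_eq_iff sum_distrib_left mult_ac)

lemma ff_mult_scale_right: "ff_mult W f (ff_scale c g) = ff_scale c (ff_mult W f g)"
  by (simp add: ff_mult_def fun_eq_iff sum_distrib_left mult_ac)

lemma ff_mult_zero_left [simp]: "ff_mult W 0 g = 0" and ff_mult_zero_right [simp]: "ff_mult W f 0 = 0"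
  by (simp_all add: ff_mult_def fun_eq_iff)

lemma ff_mult_minus_left: "ff_mult W (- f) g = - ff_mult W f g"
  by (simp add: ff_mult_def fun_eq_iff sum_negf)

lemma ff_mult_minus_right: "ff_mult W f (- g) = - ff_mult W f g"
  by (simp add: ff_mult_def fun_eq_iff sum_negf)

lemma ff_mult_minus_left_eta: "ff_mult W (\<lambda>k ws. - f k ws) g = - ff_mult W f g"
  by (simp add: ff_mult_def fun_eq_iff sum_negf)

lemma ff_mult_diff_left: "ff_mult W (f - f') g = ff_mult W f g - ff_mult W f' g"
  using ff_mult_add_left[of W f "- f'"] by (simp add: ff_mult_minus_left)

lemma ff_mult_diff_right: "ff_mult W f (g - g') = ff_mult W f g - ff_mult W f g'"
  using ff_mult_add_right[of W f g "- g'"] by (simp add: ff_mult_minus_right)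

lemma ff_mult_sum_left: "ff_mult W (sum f I) g = (\<Sum>i\<in>I. ff_mult W (f i) g)"
  by (rule additive_sum[of "\<lambda>f. ff_mult W f g"]) (simp_all add: ff_mult_add_left)

lemma ff_mult_sum_right: "ff_mult W f (sum g I) = (\<Sum>i\<in>I. ff_mult W f (g i))"
  by (rule additive_sum[of "ff_mult W f"]) (simp_all add: ff_mult_add_right)

lemmas ff_mult_linear = ff_mult_add_left ff_mult_add_right ff_mult_minus_left ff_mult_minus_right
  ff_mult_diff_left ff_mult_diff_right

lemma ff_partial_apply: "f k (ws @ [v]) = ff_partial v f k ws"
  by (simp add: ff_partial_def)

lemma ff_partial_linear:
  "ff_partial v (f + g) = ff_partial v f + ff_partial v g"
  "ff_partial v (f - g) = ff_partial v f - ff_partial v g"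
  "ff_partial v (- f) = - ff_partial v f"
  "ff_partial v (0 :: 'w formal) = 0"
  "ff_partial v (ff_scale c f) = ff_scale c (ff_partial v f)"
  by (auto simp: ff_partial_def fun_eq_iff)

lemma ff_partial_sum: "ff_partial v (sum f I) = (\<Sum>i\<in>I. ff_partial v (f i))"
  by (rule additive_sum[of "ff_partial v"]) (simp_all add: ff_partial_linear)

lemma ff_involution_linear:
  "ff_involution W (f + g) = ff_involution W f + ff_involution W g"
  "ff_involution W (f - g) = ff_involution W f - ff_involution W g"
  "ff_involution W (- f) = - ff_involution W f"
  "ff_involution W 0 = 0"
  "ff_involution W (ff_scale c f) = ff_scale c (ff_involution W f)"
  by (auto simp: ff_involution_def fun_eq_iff algebra_simps)

lemma ff_involution_sum: "ff_involution W (sum f I) = (\<Sum>i\<in>I. ff_involution W (f i))"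
  by (rule additive_sum[of "ff_involution W"]) (simp_all add: ff_involution_linear)

lemma par_list_append [simp]: "par_list W (us @ vs) = par_list W us + par_list W vs"
  by (simp add: par_list_def)

lemma par_list_simps [simp]: "par_list W [] = 0" "par_list W (v # vs) = par W v + par_list W vs"
  by (simp_all add: par_list_def)

lemma ff_involution_Nil [simp]: "ff_involution W f k [] = f k []"
  by (simp add: ff_involution_def)

lemma minus_one_power_mult_self: "(- 1) ^ m * ((- 1) ^ m * x) = (x :: real)"
  by (metis mult.assoc mult_1 power_mult_distrib power_one minus_mult_minus mult.right_neutral)

lemma ff_involution_involution [simp]: "ff_involution W (ff_involution W f) = f"
  by (simp add: ff_involution_def minus_one_power_mult_self)

lemma par_list_nths: "par_list W (nths ws S) = card {a. a < length ws \<and> a \<in> S \<and> par W (ws ! a) = 1}"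
proof (induction ws rule: rev_induct)
  case (snoc v ws)
  let ?A = "{a. a < length ws \<and> a \<in> S \<and> par W (ws ! a) = 1}"
  let ?B = "if length ws \<in> S \<and> par W v = 1 then {length ws} else {}"
  have "{a. a < length (ws @ [v]) \<and> a \<in> S \<and> par W ((ws @ [v]) ! a) = 1} = ?A \<union> ?B"
    by (auto simp: nth_append less_Suc_eq)
  moreover have "card (?A \<union> ?B) = card ?A + card ?B"
    by (rule card_Un_disjoint) auto
  ultimately show ?case using snoc by (auto simp: nths_append par_def)
qed simp

text \<open>The sign counts pairs of odd vectors whose earlier member is in \<open>S\<close> and
  whose later member is not. A new last vector outside \<open>S\<close> forms such pairs with all
  odd vectors of \<open>S\<close>; one inside \<open>S\<close> would have to be the earlier member
  and forms none.\<close>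

lemma shuffle_sign_snoc:
  assumes S: "S \<subseteq> {..<length ws}"
  shows "shuffle_sign W S (ws @ [v]) = shuffle_sign W S ws * (- 1) ^ (par W v * par_list W (nths ws S))"
    and "shuffle_sign W (insert (length ws) S) (ws @ [v]) = shuffle_sign W S ws"
proof -
  let ?A = "{(a, b). a < b \<and> b < length ws \<and> a \<in> S \<and> b \<notin> S \<and> par W (ws ! a) = 1 \<and> par W (ws ! b) = 1}"
  let ?C = "{a. a < length ws \<and> a \<in> S \<and> par W (ws ! a) = 1}"
  let ?B = "if par W v = 1 then ?C \<times> {length ws} else {}"
  have fin: "finite ?A" by (rule finite_subset[of _ "{..<length ws} \<times> {..<length ws}"]) auto
  have "{(a, b). a < b \<and> b < length (ws @ [v]) \<and> a \<in> S \<and> b \<notin> S \<and> par W ((ws @ [v]) ! a) = 1 \<and> par W ((ws @ [v]) ! b) = 1} = ?A \<union> ?B"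
    using S by (auto simp: nth_append less_Suc_eq)
  moreover have "card (?A \<union> ?B) = card ?A + card ?B"
    using fin by (intro card_Un_disjoint) auto
  moreover have "card ?B = par W v * par_list W (nths ws S)"
    by (auto simp: par_list_nths card_cartesian_product par_def)
  ultimately show "shuffle_sign W S (ws @ [v]) = shuffle_sign W S ws * (- 1) ^ (par W v * par_list W (nths ws S))"
    unfolding shuffle_sign_def by (simp add: power_add)
  have "{(a, b). a < b \<and> b < length (ws @ [v]) \<and> a \<in> insert (length ws) S \<and> b \<notin> insert (length ws) S \<and> par W ((ws @ [v]) ! a) = 1 \<and> par W ((ws @ [v]) ! b) = 1} = ?A"
    using S by (auto simp: nth_append less_Suc_eq)
  then show "shuffle_sign W (insert (length ws) S) (ws @ [v]) = shuffle_sign W S ws"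
    unfolding shuffle_sign_def by simp
qed

text \<open>The sign arising when the partial derivative along \<open>v\<close>, which has the
  parity of \<open>v\<close>, passes the function \<open>f\<close>.\<close>

definition twist :: "'w super_space \<Rightarrow> 'w \<Rightarrow> 'w formal \<Rightarrow> 'w formal" where
  "twist W v f = (\<lambda>k ws. (- 1) ^ (par W v * par_list W ws) * f k ws)"

text \<open>The subsets in the product formula for \<open>ws @ [v]\<close> split according to
  whether they contain the last position, that is, whether \<open>v\<close> goes into
  \<open>f\<close> or into \<open>g\<close>.\<close>

lemma ff_partial_mult:
  fixes v :: 'w
  shows "ff_partial v (ff_mult W f g) = ff_mult W (ff_partial v f) g + ff_mult W (twist W v f) (ff_partial v g)"
proof (intro ext)
  fix k :: nat and ws :: "'w list"
  let ?n = "length ws"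
  have split: "Pow {..<length (ws @ [v])} = Pow {..<?n} \<union> insert ?n ` Pow {..<?n}"
    by (simp add: lessThan_Suc Pow_insert)
  have disj: "Pow {..<?n} \<inter> insert ?n ` Pow {..<?n} = {}" by auto
  have inj: "inj_on (insert ?n) (Pow {..<?n})"
    by (rule inj_onI) (metis Diff_insert_absorb PowD lessThan_iff less_irrefl subsetD)
  have t: "sum h (Pow {..<length (ws @ [v])}) = (\<Sum>S\<in>Pow {..<?n}. h (insert ?n S)) + (\<Sum>S\<in>Pow {..<?n}. h S)"
    for h :: "nat set \<Rightarrow> real"
    unfolding split by (subst sum.union_disjoint[OF _ _ disj]) (auto simp: sum.reindex[OF inj] add.commute)
  have 1: "nths (ws @ [v]) (insert ?n S) = nths ws S @ [v]" "nths (ws @ [v]) (- insert ?n S) = nths ws (- S)"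
    "nths (ws @ [v]) S = nths ws S" "nths (ws @ [v]) (- S) = nths ws (- S) @ [v]" if "S \<in> Pow {..<?n}" for S
  proof -
    have "nths ws (insert ?n S) = nths ws S" "nths ws (- insert ?n S) = nths ws (- S)"
      unfolding nths_def by (auto intro!: arg_cong[of _ _ "map fst"] filter_cong dest: set_zip_rightD)
    then show "nths (ws @ [v]) (insert ?n S) = nths ws S @ [v]" "nths (ws @ [v]) (- insert ?n S) = nths ws (- S)"
      "nths (ws @ [v]) S = nths ws S" "nths (ws @ [v]) (- S) = nths ws (- S) @ [v]"
      using that by (auto simp: nths_append)
  qed
  show "ff_partial v (ff_mult W f g) k ws = (ff_mult W (ff_partial v f) g + ff_mult W (twist W v f) (ff_partial v g)) k ws"
    unfolding ff_partial_def ff_mult_def t plus_fun_apply twist_def sum.distrib[symmetric]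
  proof (intro sum.cong refl arg_cong2[where f="(+)"], goal_cases)
    case (1 j S) then show ?case using 1 \<open>\<And>S. S \<in> Pow {..<?n} \<Longrightarrow> nths (ws @ [v]) (insert ?n S) = nths ws S @ [v]\<close>
        \<open>\<And>S. S \<in> Pow {..<?n} \<Longrightarrow> nths (ws @ [v]) (- insert ?n S) = nths ws (- S)\<close>
      by (simp add: shuffle_sign_snoc)
  next
    case (2 j S) then show ?case using \<open>\<And>S. S \<in> Pow {..<?n} \<Longrightarrow> nths (ws @ [v]) S = nths ws S\<close>
        \<open>\<And>S. S \<in> Pow {..<?n} \<Longrightarrow> nths (ws @ [v]) (- S) = nths ws (- S) @ [v]\<close>
      by (simp add: shuffle_sign_snoc)
  qed
qed

text \<open>The formula of \<open>ff_diff\<close> for an arbitrary map of vectors, so that one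
  calculus serves both the differential and the homotopy \<open>s\<close>.\<close>

definition coderivation :: "'w super_space \<Rightarrow> ('w \<Rightarrow> 'w) \<Rightarrow> 'w formal \<Rightarrow> 'w formal" where
  "coderivation W \<phi> f = (\<lambda>k ws. if set ws \<subseteq> homog W
     then \<Sum>j<length ws. (- 1) ^ par_list W (drop j ws) * f k (ws[j := \<phi> (ws ! j)])
     else 0)"

lemma ff_diff_eq: "ff_diff W = coderivation W (vdiff W)"
  by (simp add: ff_diff_def coderivation_def fun_eq_iff)

lemma coderivation_Nil [simp]: "coderivation W \<phi> f k [] = 0"
  by (simp add: coderivation_def)

lemma coderivation_linear:
  "coderivation W \<phi> (f + g) = coderivation W \<phi> f + coderivation W \<phi> g"
  "coderivation W \<phi> (f - g) = coderivation W \<phi> f - coderivation W \<phi> g"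
  "coderivation W \<phi> (- f) = - coderivation W \<phi> f"
  "coderivation W \<phi> 0 = 0"
  "coderivation W \<phi> (ff_scale c f) = ff_scale c (coderivation W \<phi> f)"
  by (auto simp: coderivation_def fun_eq_iff algebra_simps sum.distrib sum_subtractf sum_negf sum_distrib_left)

lemma coderivation_off: "\<not> set ws \<subseteq> homog W \<Longrightarrow> coderivation W \<phi> f k ws = 0"
  by (simp only: coderivation_def if_False)

lemma par_eq: "v \<in> even_part W \<Longrightarrow> par W v = 0" "v \<notin> even_part W \<Longrightarrow> par W v = 1"
  by (auto simp: par_def)

lemma twist_eq: "v \<in> even_part W \<Longrightarrow> twist W v f = f" "v \<notin> even_part W \<Longrightarrow> twist W v f = ff_involution W f"
  by (auto simp: twist_def par_eq ff_involution_def)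

text \<open>Stated for the bare record so that it covers spaces of cosets as well.
  \<open>null_vector\<close> says that a vector of both parities behaves like zero: formal functions
  vanish on it (\<open>partial_null\<close>), so its ambiguous parity never affects a sign.\<close>

locale super_functions =
  fixes W :: "'w super_space"
  assumes add_even: "a \<in> even_part W \<Longrightarrow> b \<in> even_part W \<Longrightarrow> vadd W a b \<in> even_part W"
    and add_odd: "a \<in> odd_part W \<Longrightarrow> b \<in> odd_part W \<Longrightarrow> vadd W a b \<in> odd_part W"
    and scale_even: "a \<in> even_part W \<Longrightarrow> vscale W c a \<in> even_part W"
    and scale_odd: "a \<in> odd_part W \<Longrightarrow> vscale W c a \<in> odd_part W"
    and null_vector: "a \<in> even_part W \<Longrightarrow> a \<in> odd_part W \<Longrightarrow> vscale W 0 a = a"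
begin

abbreviation "FF \<equiv> formal_functions W"
abbreviation "ev \<equiv> even_part W"
abbreviation "od \<equiv> odd_part W"
abbreviation "grinv \<equiv> ff_involution W"
abbreviation mult (infixl "\<odot>" 70) where "f \<odot> g \<equiv> ff_mult W f g"
abbreviation "\<delta> v f \<equiv> ff_partial v f"
abbreviation "T \<phi> f \<equiv> coderivation W \<phi> f"

lemma homog_cases: "v \<in> homog W \<Longrightarrow> (v \<in> ev \<Longrightarrow> P) \<Longrightarrow> (v \<in> od \<Longrightarrow> v \<notin> ev \<Longrightarrow> P) \<Longrightarrow> P"
  by (auto simp: homog_def)

lemma evD: "v \<in> ev \<Longrightarrow> v \<in> homog W" and odD: "v \<in> od \<Longrightarrow> v \<in> homog W"
  by (auto simp: homog_def)

lemma FF_off: "f \<in> FF \<Longrightarrow> \<not> set ws \<subseteq> homog W \<Longrightarrow> f k ws = 0"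
  by (simp add: formal_functions_def)

lemma FF_add: "f \<in> FF \<Longrightarrow> a \<in> ev \<and> b \<in> ev \<or> a \<in> od \<and> b \<in> od \<Longrightarrow>
    f k (us @ vadd W a b # vs) = f k (us @ a # vs) + f k (us @ b # vs)"
  by (auto simp: formal_functions_def)

lemma FF_scale: "f \<in> FF \<Longrightarrow> a \<in> homog W \<Longrightarrow> f k (us @ vscale W c a # vs) = c * f k (us @ a # vs)"
  by (simp add: formal_functions_def)

lemma FF_swap: "f \<in> FF \<Longrightarrow> a \<in> homog W \<Longrightarrow> b \<in> homog W \<Longrightarrow>
    f k (us @ a # b # vs) = (- 1) ^ (par W a * par W b) * f k (us @ b # a # vs)"
  unfolding formal_functions_def by blast

lemma FFI:
  assumes "\<And>k ws. \<not> set ws \<subseteq> homog W \<Longrightarrow> f k ws = 0"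
    and "\<And>k us vs a b. a \<in> ev \<and> b \<in> ev \<or> a \<in> od \<and> b \<in> od \<Longrightarrow>
      f k (us @ vadd W a b # vs) = f k (us @ a # vs) + f k (us @ b # vs)"
    and "\<And>k us vs a c. a \<in> homog W \<Longrightarrow> f k (us @ vscale W c a # vs) = c * f k (us @ a # vs)"
    and "\<And>k us vs a b. a \<in> homog W \<Longrightarrow> b \<in> homog W \<Longrightarrow>
      f k (us @ a # b # vs) = (- 1) ^ (par W a * par W b) * f k (us @ b # a # vs)"
  shows "f \<in> FF"
  unfolding formal_functions_def using assms by blast

lemma FF_eqI:
  assumes "\<And>ws k. \<not> set ws \<subseteq> homog W \<Longrightarrow> f k ws = 0" "\<And>ws k. \<not> set ws \<subseteq> homog W \<Longrightarrow> g k ws = 0"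
    "\<And>ws k. set ws \<subseteq> homog W \<Longrightarrow> f k ws = g k ws"
  shows "f = g"
  using assms by (intro ext) metis

lemma FF_linear:
  shows "0 \<in> FF" and "f \<in> FF \<Longrightarrow> g \<in> FF \<Longrightarrow> f + g \<in> FF" and "f \<in> FF \<Longrightarrow> g \<in> FF \<Longrightarrow> f - g \<in> FF"
    and "f \<in> FF \<Longrightarrow> - f \<in> FF" and "f \<in> FF \<Longrightarrow> ff_scale c f \<in> FF"
proof -
  show "0 \<in> FF" by (rule FFI) auto
  show S: "ff_scale c f \<in> FF" if f: "f \<in> FF" for f c
  proof (rule FFI)
    fix k us vs a b assume "a \<in> homog W" "b \<in> homog W"
    then show "ff_scale c f k (us @ a # b # vs) = (- 1) ^ (par W a * par W b) * ff_scale c f k (us @ b # a # vs)"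
      using FF_swap[OF f, of a b] by simp
  qed (simp_all add: FF_off f FF_add FF_scale distrib_left)
  show A: "f + g \<in> FF" if f: "f \<in> FF" and g: "g \<in> FF" for f g
  proof (rule FFI)
    fix k us vs a b assume "a \<in> homog W" "b \<in> homog W"
    then show "(f + g) k (us @ a # b # vs) = (- 1) ^ (par W a * par W b) * (f + g) k (us @ b # a # vs)"
      using FF_swap[OF f, of a b] FF_swap[OF g, of a b] by (simp add: distrib_left)
  qed (simp_all add: FF_off f g FF_add FF_scale distrib_left)
  show M: "- f \<in> FF" if "f \<in> FF" for f
  proof -
    have "- f = ff_scale (- 1) f" by (simp add: fun_eq_iff)
    then show ?thesis using S[OF that] by simp
  qed
  show "f - g \<in> FF" if "f \<in> FF" "g \<in> FF" for f g using A[OF that(1) M[OF that(2)]] by simp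
qed

lemma FF_sum: "(\<And>i. i \<in> I \<Longrightarrow> f i \<in> FF) \<Longrightarrow> sum f I \<in> FF"
  by (induction I rule: infinite_finite_induct) (auto simp: FF_linear)

lemma FF_partial:
  assumes f: "f \<in> FF" shows "\<delta> v f \<in> FF"
proof (rule FFI)
  fix k us vs a b assume "a \<in> homog W" "b \<in> homog W"
  then show "\<delta> v f k (us @ a # b # vs) = (- 1) ^ (par W a * par W b) * \<delta> v f k (us @ b # a # vs)"
    using FF_swap[OF f, of a b k us "vs @ [v]"] by (simp add: ff_partial_def)
qed (simp_all add: ff_partial_def FF_off f FF_add FF_scale)

lemma partial_add: "f \<in> FF \<Longrightarrow> a \<in> ev \<and> b \<in> ev \<or> a \<in> od \<and> b \<in> od \<Longrightarrow> \<delta> (vadd W a b) f = \<delta> a f + \<delta> b f"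
  using FF_add[of f a b _ _ "[]"] by (simp add: ff_partial_def fun_eq_iff)

lemma partial_scale: "f \<in> FF \<Longrightarrow> a \<in> homog W \<Longrightarrow> \<delta> (vscale W c a) f = ff_scale c (\<delta> a f)"
  using FF_scale[of f a _ _ c "[]"] by (simp add: ff_partial_def fun_eq_iff)

lemma partial_null: "f \<in> FF \<Longrightarrow> v \<in> ev \<Longrightarrow> v \<in> od \<Longrightarrow> \<delta> v f = 0"
  using partial_scale[of f v 0] null_vector[of v] by (simp add: evD fun_eq_iff)

lemma partial_swap:
  assumes "f \<in> FF" "a \<in> homog W" "b \<in> homog W"
  shows "a \<in> ev \<or> b \<in> ev \<Longrightarrow> \<delta> a (\<delta> b f) = \<delta> b (\<delta> a f)"
    and "a \<in> od \<Longrightarrow> b \<in> od \<Longrightarrow> \<delta> a (\<delta> b f) = - \<delta> b (\<delta> a f)"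
proof -
  have *: "\<delta> a (\<delta> b f) k us = (- 1) ^ (par W a * par W b) * \<delta> b (\<delta> a f) k us" for k us
    using FF_swap[OF assms, of k us "[]"] by (simp add: ff_partial_def)
  show "a \<in> ev \<or> b \<in> ev \<Longrightarrow> \<delta> a (\<delta> b f) = \<delta> b (\<delta> a f)"
    using * by (auto simp: par_eq fun_eq_iff)
  show "\<delta> a (\<delta> b f) = - \<delta> b (\<delta> a f)" if "a \<in> od" "b \<in> od"
  proof (cases "a \<in> ev \<or> b \<in> ev")
    case True
    then have "\<delta> a (\<delta> b f) = 0 \<and> \<delta> b (\<delta> a f) = 0"
      using that assms partial_null FF_partial by (auto simp: ff_partial_linear)
    then show ?thesis by simp
  next
    case False
    then show ?thesis using * by (auto simp: par_eq fun_eq_iff)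
  qed
qed

text \<open>Membership in the formal functions is checked on the last arguments only, for a family of
  functions that is closed under derivatives up to sums of two.\<close>

lemma FF_coinduct:
  assumes f: "f \<in> X"
    and off: "\<And>f k ws. f \<in> X \<Longrightarrow> \<not> set ws \<subseteq> homog W \<Longrightarrow> f k ws = 0"
    and add: "\<And>f a b. f \<in> X \<Longrightarrow> a \<in> ev \<and> b \<in> ev \<or> a \<in> od \<and> b \<in> od \<Longrightarrow> \<delta> (vadd W a b) f = \<delta> a f + \<delta> b f"
    and scale: "\<And>f a c. f \<in> X \<Longrightarrow> a \<in> homog W \<Longrightarrow> \<delta> (vscale W c a) f = ff_scale c (\<delta> a f)"
    and swap: "\<And>f a b. f \<in> X \<Longrightarrow> a \<in> ev \<and> b \<in> homog W \<Longrightarrow> \<delta> a (\<delta> b f) = \<delta> b (\<delta> a f)"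
    and swap': "\<And>f a b. f \<in> X \<Longrightarrow> a \<in> od \<Longrightarrow> b \<in> od \<Longrightarrow> \<delta> a (\<delta> b f) = - \<delta> b (\<delta> a f)"
    and step: "\<And>f v. f \<in> X \<Longrightarrow> v \<in> homog W \<Longrightarrow> \<exists>g\<in>X. \<exists>h\<in>X. \<delta> v f = g + h"
  shows "f \<in> FF"
proof -
  have A: "f k (us @ vadd W a b # vs) = f k (us @ a # vs) + f k (us @ b # vs)"
    if "f \<in> X" "a \<in> ev \<and> b \<in> ev \<or> a \<in> od \<and> b \<in> od" for f k us a b vs
    using that(1)
  proof (induction vs arbitrary: f rule: rev_induct)
    case Nil then show ?case using add[OF Nil that(2)] by (simp add: ff_partial_def fun_eq_iff)
  next
    case (snoc v vs)
    show ?case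
    proof (cases "v \<in> homog W")
      case True
      obtain g h where gh: "g \<in> X" "h \<in> X" "\<delta> v f = g + h" using step[OF snoc.prems True] by blast
      have "f k (xs @ [v]) = g k xs + h k xs" for xs using gh(3) by (simp add: ff_partial_apply)
      from this[of "us @ _ # vs"] show ?thesis using snoc.IH[OF gh(1)] snoc.IH[OF gh(2)] by simp
    next
      case False then show ?thesis using off[OF snoc.prems] by simp
    qed
  qed
  have B: "f k (us @ vscale W c a # vs) = c * f k (us @ a # vs)" if "f \<in> X" "a \<in> homog W" for f k us a c vs
    using that(1)
  proof (induction vs arbitrary: f rule: rev_induct)
    case Nil then show ?case using scale[OF Nil that(2)] by (simp add: ff_partial_def fun_eq_iff)
  next
    case (snoc v vs)
    show ?case
    proof (cases "v \<in> homog W")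
      case True
      obtain g h where gh: "g \<in> X" "h \<in> X" "\<delta> v f = g + h" using step[OF snoc.prems True] by blast
      have "f k (xs @ [v]) = g k xs + h k xs" for xs using gh(3) by (simp add: ff_partial_apply)
      from this[of "us @ _ # vs"] show ?thesis using snoc.IH[OF gh(1)] snoc.IH[OF gh(2)]
        by (simp add: algebra_simps)
    next
      case False then show ?thesis using off[OF snoc.prems] by simp
    qed
  qed
  have C: "f k (us @ a # b # vs) = (- 1) ^ (par W a * par W b) * f k (us @ b # a # vs)"
    if fX: "f \<in> X" and a: "a \<in> homog W" and b: "b \<in> homog W" for f k us a b vs
    using fX
  proof (induction vs arbitrary: f rule: rev_induct)
    case Nil
    have ab: "\<delta> a (\<delta> b f) k us = f k (us @ [a, b])" "\<delta> b (\<delta> a f) k us = f k (us @ [b, a])"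
      by (simp_all add: ff_partial_def)
    consider "a \<in> ev" | "b \<in> ev" | "a \<in> od" "b \<in> od" "a \<notin> ev" "b \<notin> ev" using a b by (auto simp: homog_def)
    then show ?case
    proof cases
      case 1 then show ?thesis using swap[OF Nil, of a b] a b ab by (simp add: par_eq fun_eq_iff)
    next
      case 2 then show ?thesis using swap[OF Nil, of b a] a b ab by (simp add: par_eq fun_eq_iff)
    next
      case 3 then show ?thesis using swap'[OF Nil, of a b] a b ab by (simp add: par_eq fun_eq_iff)
    qed
  next
    case (snoc v vs)
    show ?case
    proof (cases "v \<in> homog W")
      case True
      obtain g h where gh: "g \<in> X" "h \<in> X" "\<delta> v f = g + h" using step[OF snoc.prems True] by blast
      have "f k (xs @ [v]) = g k xs + h k xs" for xs using gh(3) by (simp add: ff_partial_apply)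
      from this[of "us @ _ # _ # vs"] show ?thesis using snoc.IH[OF gh(1)] snoc.IH[OF gh(2)]
        by (simp add: algebra_simps)
    next
      case False then show ?thesis using off[OF snoc.prems] by simp
    qed
  qed
  show ?thesis using off[OF f] A[OF f] B[OF f] C[OF f] unfolding formal_functions_def by blast
qed

subsection \<open>Involution and product\<close>

lemma inv_off: "f \<in> FF \<Longrightarrow> \<not> set ws \<subseteq> homog W \<Longrightarrow> grinv f k ws = 0"
  by (simp add: ff_involution_def FF_off)

lemma partial_inv_even: "v \<in> ev \<Longrightarrow> \<delta> v (grinv f) = grinv (\<delta> v f)"
  by (simp add: ff_partial_def ff_involution_def par_eq)

lemma partial_inv_odd: "v \<in> od \<Longrightarrow> f \<in> FF \<Longrightarrow> \<delta> v (grinv f) = - grinv (\<delta> v f)"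
  using partial_null[of f v] partial_inv_even[of v f]
  by (cases "v \<in> ev") (auto simp: ff_partial_def ff_involution_def par_eq fun_eq_iff)

lemma partial_mult_even: "v \<in> ev \<Longrightarrow> \<delta> v (f \<odot> g) = \<delta> v f \<odot> g + f \<odot> \<delta> v g"
  by (simp add: ff_partial_mult twist_eq)

lemma partial_mult_odd: "v \<in> od \<Longrightarrow> g \<in> FF \<Longrightarrow> \<delta> v (f \<odot> g) = \<delta> v f \<odot> g + grinv f \<odot> \<delta> v g"
  using partial_null[of g v] by (cases "v \<in> ev") (simp_all add: ff_partial_mult twist_eq)

lemmas partial_rules = partial_inv_even partial_inv_odd partial_mult_even partial_mult_odd

lemma FF_inv: "f \<in> FF \<Longrightarrow> grinv f \<in> FF"
proof (rule FF_coinduct[of _ "grinv ` FF"], goal_cases)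
  case (2 f k ws)
  then obtain g where "f = grinv g" "g \<in> FF" by auto
  then show ?case using inv_off 2 by metis
next
  case (3 f a b)
  then show ?case using add_even[of a b] add_odd[of a b]
    by (auto simp: partial_rules partial_add ff_involution_linear)
next
  case (4 f a c)
  then show ?case using scale_even[of a c] scale_odd[of a c]
    by (auto simp: homog_def partial_rules partial_scale ff_involution_linear fun_eq_iff)
next
  case (5 f a b)
  then show ?case
    by (auto simp: homog_def partial_rules ff_partial_linear FF_partial partial_swap(1)[of _ a b])
next
  case (6 f a b)
  then show ?case
    by (auto simp: odD partial_rules ff_partial_linear ff_involution_linear FF_partial partial_swap(2)[of _ a b])
next
  case (7 f v)
  then obtain g where g: "f = grinv g" "g \<in> FF" by auto
  have X: "grinv 0 \<in> grinv ` FF" "grinv (\<delta> v g) \<in> grinv ` FF" "grinv (- \<delta> v g) \<in> grinv ` FF"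
    using FF_partial[OF g(2)] FF_linear by blast+
  from 7(3) show ?case
  proof (rule homog_cases)
    assume "v \<in> ev"
    then have "\<delta> v f = grinv (\<delta> v g) + grinv 0" using g by (simp add: partial_rules ff_involution_linear)
    then show ?thesis by (intro bexI[OF _ X(2)] bexI[OF _ X(1)])
  next
    assume "v \<in> od"
    then have "\<delta> v f = grinv (- \<delta> v g) + grinv 0" using g by (simp add: partial_rules ff_involution_linear)
    then show ?thesis by (intro bexI[OF _ X(3)] bexI[OF _ X(1)])
  qed
qed auto

lemma mult_off:
  assumes "f \<in> FF" "g \<in> FF" "\<not> set ws \<subseteq> homog W" shows "(f \<odot> g) k ws = 0"
proof -
  have "f j (nths ws S) * g (k - j) (nths ws (- S)) = 0" for j S
  proof -
    have "set ws \<subseteq> set (nths ws S) \<union> set (nths ws (- S))" unfolding set_nths by (force simp: in_set_conv_nth)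
    then have "\<not> set (nths ws S) \<subseteq> homog W \<or> \<not> set (nths ws (- S)) \<subseteq> homog W" using assms(3) by blast
    then show ?thesis using FF_off assms by auto
  qed
  then show ?thesis unfolding ff_mult_def mult.assoc by (simp only: mult_zero_right sum.neutral_const)
qed

text \<open>The derivative of a product is a sum of two products, which is the reason for the two
  summands in the closure condition of \<open>FF_coinduct\<close>.\<close>

lemma FF_mult:
  assumes "f \<in> FF" "g \<in> FF" shows "f \<odot> g \<in> FF"
proof (rule FF_coinduct[of _ "{f \<odot> g | f g. f \<in> FF \<and> g \<in> FF}"], goal_cases)
  case (2 f k ws)
  then obtain g h where "f = g \<odot> h" "g \<in> FF" "h \<in> FF" by auto
  then show ?case using mult_off 2(2) by simp
next
  case (3 f a b)
  then show ?case using add_even[of a b] add_odd[of a b]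
    by (auto simp: partial_rules partial_add ff_mult_linear)
next
  case (4 f a c)
  then show ?case using scale_even[of a c] scale_odd[of a c]
    by (auto simp: homog_def partial_rules partial_scale ff_mult_scale_left ff_mult_scale_right ff_scale_linear)
next
  case (5 f a b)
  then show ?case
    by (auto simp: homog_def partial_rules ff_partial_linear FF_partial FF_inv partial_swap(1)[of _ a b])
next
  case (6 f a b)
  then show ?case
    by (auto simp: odD partial_rules ff_partial_linear ff_involution_linear ff_mult_linear FF_partial FF_inv partial_swap(2)[of _ a b])
next
  case (7 f v)
  then obtain g h where g: "f = g \<odot> h" "g \<in> FF" "h \<in> FF" by auto
  let ?X = "{f \<odot> g | f g. f \<in> FF \<and> g \<in> FF}"
  have X: "\<delta> v g \<odot> h \<in> ?X" "g \<odot> \<delta> v h \<in> ?X" "grinv g \<odot> \<delta> v h \<in> ?X"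
    using FF_partial FF_inv g(2,3) by blast+
  from 7(2) show ?case
  proof (rule homog_cases)
    assume "v \<in> ev"
    then have "\<delta> v f = \<delta> v g \<odot> h + g \<odot> \<delta> v h" using g by (simp add: partial_rules)
    then show ?thesis by (intro bexI[OF _ X(1)] bexI[OF _ X(2)])
  next
    assume "v \<in> od"
    then have "\<delta> v f = \<delta> v g \<odot> h + grinv g \<odot> \<delta> v h" using g by (simp add: partial_rules)
    then show ?thesis by (intro bexI[OF _ X(1)] bexI[OF _ X(3)])
  qed
qed (use assms in auto)

text \<open>The pattern of the identities that follow: compare the values at the empty list, and for
  a list ending in \<open>v\<close> differentiate both sides along \<open>v\<close>. The Leibniz
  rules reduce the claim to the same identity for derivatives on a shorter list, hence the induction
  with arbitrary functions.\<close>

lemma inv_mult: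
  assumes "f \<in> FF" "g \<in> FF" shows "grinv (f \<odot> g) = grinv f \<odot> grinv g"
proof (rule FF_eqI)
  show "grinv (f \<odot> g) k ws = (grinv f \<odot> grinv g) k ws" if "set ws \<subseteq> homog W" for ws k
    using that assms
  proof (induction ws arbitrary: f g k rule: rev_induct)
    case Nil then show ?case by (simp add: ff_mult_Nil)
  next
    case (snoc v ws)
    then have v: "v \<in> homog W" and ws: "set ws \<subseteq> homog W" by auto
    note IH = snoc.IH[OF ws] FF_partial FF_inv FF_mult snoc.prems
    from v show ?case unfolding ff_partial_apply
      by (rule homog_cases) (simp_all add: partial_rules ff_involution_linear IH ff_mult_linear)
  qed
qed (simp_all add: assms mult_off inv_off FF_inv FF_mult)

text \<open>Even and odd \<open>f\<close> are treated together because an odd derivative exchanges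
  the two cases. As \<open>g\<close> may be inhomogeneous, the sign (-1)^(|f| |g|) appears as the
  involution applied to \<open>g\<close>.\<close>

lemma mult_commute_aux:
  assumes "set ws \<subseteq> homog W" "f \<in> FF" "g \<in> FF"
  shows "(grinv f = f \<longrightarrow> (f \<odot> g) k ws = (g \<odot> f) k ws) \<and> (grinv f = - f \<longrightarrow> (f \<odot> g) k ws = (grinv g \<odot> f) k ws)"
  using assms
proof (induction ws arbitrary: f g k rule: rev_induct)
  case Nil
  have "f k [] = 0" if "grinv f = - f" for k
    using fun_cong[OF fun_cong[OF that], of k "[]"] by simp
  then show ?case unfolding ff_mult_Nil
    using sum_atMost_rev[of "\<lambda>j. f j [] * g (k - j) []" k] by (auto simp: mult.commute intro: sum.cong)
next
  case (snoc v ws)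
  then have v: "v \<in> homog W" and ws: "set ws \<subseteq> homog W" by auto
  have d: "\<delta> v f \<in> FF" "\<delta> v g \<in> FF" "grinv (\<delta> v g) \<in> FF" using FF_partial FF_inv snoc.prems by auto
  note I = snoc.IH[OF ws d(1) snoc.prems(3), of k] snoc.IH[OF ws snoc.prems(2) d(2), of k]
  from v show ?case
  proof (rule homog_cases)
    assume v: "v \<in> ev"
    note P = partial_mult_even[OF v] partial_inv_even[OF v]
    show ?thesis
    proof (intro conjI impI)
      assume f: "grinv f = f"
      then have "grinv (\<delta> v f) = \<delta> v f" using partial_inv_even[OF v, of f] by simp
      then show "(f \<odot> g) k (ws @ [v]) = (g \<odot> f) k (ws @ [v])"
        unfolding ff_partial_apply P plus_fun_apply using I f by linarith
    next
      assume f: "grinv f = - f"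
      then have "grinv (\<delta> v f) = - \<delta> v f" using partial_inv_even[OF v, of f] by (simp only: ff_partial_linear)
      then show "(f \<odot> g) k (ws @ [v]) = (grinv g \<odot> f) k (ws @ [v])"
        unfolding ff_partial_apply P plus_fun_apply using I f by linarith
    qed
  next
    assume v: "v \<in> od"
    note P = partial_mult_odd[OF v snoc.prems(2)] partial_mult_odd[OF v snoc.prems(3)] partial_inv_odd[OF v snoc.prems(3)]
    show ?thesis
    proof (intro conjI impI)
      assume f: "grinv f = f"
      then have "grinv (\<delta> v f) = - \<delta> v f" using partial_inv_odd[OF v snoc.prems(2)] by (metis minus_minus)
      then show "(f \<odot> g) k (ws @ [v]) = (g \<odot> f) k (ws @ [v])"
        unfolding ff_partial_apply P plus_fun_apply f using I f by linarith
    next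
      assume f: "grinv f = - f"
      then have "grinv (\<delta> v f) = \<delta> v f" using partial_inv_odd[OF v snoc.prems(2)]
        by (metis minus_minus ff_partial_linear(3))
      then show "(f \<odot> g) k (ws @ [v]) = (grinv g \<odot> f) k (ws @ [v])"
        unfolding ff_partial_apply P plus_fun_apply f ff_mult_minus_left ff_involution_involution uminus_apply
        using I f by linarith
    qed
  qed
qed

lemma mult_commute_even: "grinv f = f \<Longrightarrow> f \<in> FF \<Longrightarrow> g \<in> FF \<Longrightarrow> f \<odot> g = g \<odot> f"
  by (rule FF_eqI) (use mult_off mult_commute_aux in blast)+

lemma mult_commute_odd: "grinv f = - f \<Longrightarrow> f \<in> FF \<Longrightarrow> g \<in> FF \<Longrightarrow> f \<odot> g = grinv g \<odot> f"
  by (rule FF_eqI) (use mult_off mult_commute_aux FF_inv in blast)+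

lemma mult_assoc:
  assumes "f \<in> FF" "g \<in> FF" "h \<in> FF" shows "f \<odot> g \<odot> h = f \<odot> (g \<odot> h)"
proof (rule FF_eqI)
  show "(f \<odot> g \<odot> h) k ws = (f \<odot> (g \<odot> h)) k ws" if "set ws \<subseteq> homog W" for ws k
    using that assms
  proof (induction ws arbitrary: f g h k rule: rev_induct)
    case Nil
    then show ?case unfolding ff_mult_Nil sum_distrib_left sum_distrib_right
      using sum_triple_reindex[of "\<lambda>i j l. f i [] * g j [] * h l []" k] by (simp add: mult.assoc)
  next
    case (snoc v ws)
    then have v: "v \<in> homog W" and ws: "set ws \<subseteq> homog W" by auto
    note IH = snoc.IH[OF ws] FF_partial FF_inv FF_mult snoc.prems
    from v show ?case unfolding ff_partial_apply
      by (rule homog_cases) (simp_all add: partial_rules ff_mult_linear IH inv_mult)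
  qed
qed (simp_all add: assms mult_off FF_mult)

subsection \<open>Derivations extending odd linear maps\<close>

definition odd_map :: "('w \<Rightarrow> 'w) \<Rightarrow> bool" where
  "odd_map \<phi> \<longleftrightarrow> \<phi> ` ev \<subseteq> od \<and> \<phi> ` od \<subseteq> ev \<and>
     (\<forall>a b. a \<in> ev \<and> b \<in> ev \<or> a \<in> od \<and> b \<in> od \<longrightarrow> \<phi> (vadd W a b) = vadd W (\<phi> a) (\<phi> b)) \<and>
     (\<forall>a\<in>homog W. \<forall>c. \<phi> (vscale W c a) = vscale W c (\<phi> a))"

lemma odd_mapD:
  assumes "odd_map \<phi>"
  shows "v \<in> ev \<Longrightarrow> \<phi> v \<in> od" "v \<in> od \<Longrightarrow> \<phi> v \<in> ev" "v \<in> homog W \<Longrightarrow> \<phi> v \<in> homog W"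
    "a \<in> ev \<and> b \<in> ev \<or> a \<in> od \<and> b \<in> od \<Longrightarrow> \<phi> (vadd W a b) = vadd W (\<phi> a) (\<phi> b)"
    "a \<in> homog W \<Longrightarrow> \<phi> (vscale W c a) = vscale W c (\<phi> a)"
  using assms unfolding odd_map_def homog_def by auto

text \<open>With \<open>v\<close> as last argument, changing an earlier vector gives the operator on
  the derivative, and changing \<open>v\<close> itself gives the derivative along
  \<open>\<phi> v\<close>. All summands carry the sign of \<open>v\<close>, which belongs to every
  dropped tail.\<close>

lemma partial_coderivation_raw:
  assumes "f \<in> FF" "v \<in> homog W"
  shows "\<delta> v (T \<phi> f) = (\<lambda>k ws. (- 1) ^ par W v * (T \<phi> (\<delta> v f) + \<delta> (\<phi> v) f) k ws)"
proof (intro ext)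
  fix k ws
  show "\<delta> v (T \<phi> f) k ws = (- 1) ^ par W v * (T \<phi> (\<delta> v f) + \<delta> (\<phi> v) f) k ws"
  proof (cases "set ws \<subseteq> homog W")
    case True
    have "(\<Sum>j<length ws. (- 1) ^ par_list W (drop j (ws @ [v])) * f k ((ws @ [v])[j := \<phi> ((ws @ [v]) ! j)])) =
      (\<Sum>j<length ws. (- 1) ^ par W v * ((- 1) ^ par_list W (drop j ws) * f k (ws[j := \<phi> (ws ! j)] @ [v])))"
      by (intro sum.cong refl) (simp add: nth_append list_update_append power_add)
    then show ?thesis using True assms(2)
      by (simp add: ff_partial_def coderivation_def sum_distrib_left[symmetric] algebra_simps)
  next
    case False
    then show ?thesis using FF_off[OF FF_partial[OF assms(1)]] by (simp add: coderivation_off ff_partial_def)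
  qed
qed

lemma partial_coderivation_even:
  "f \<in> FF \<Longrightarrow> v \<in> ev \<Longrightarrow> \<delta> v (T \<phi> f) = T \<phi> (\<delta> v f) + \<delta> (\<phi> v) f"
  using partial_coderivation_raw[of f v \<phi>] by (simp add: evD par_eq fun_eq_iff)

lemma partial_coderivation_odd:
  assumes "odd_map \<phi>" "f \<in> FF" "v \<in> od"
  shows "\<delta> v (T \<phi> f) = - T \<phi> (\<delta> v f) - \<delta> (\<phi> v) f"
proof (cases "v \<in> ev")
  case True
  then have "\<delta> v f = 0" "\<delta> (\<phi> v) f = 0" using partial_null odd_mapD assms by auto
  then show ?thesis using partial_coderivation_even[OF assms(2) True, of \<phi>] by (simp add: coderivation_linear)
next
  case False
  then show ?thesis using partial_coderivation_raw[of f v \<phi>] assms by (simp add: odD par_eq fun_eq_iff)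
qed

lemmas partial_coderivation = partial_coderivation_even partial_coderivation_odd

text \<open>The family includes all formal functions because differentiating
  \<open>T \<phi> f\<close> also produces the plain derivative along
  \<open>\<phi> v\<close>.\<close>

lemma FF_coderivation:
  assumes \<phi>: "odd_map \<phi>" and f: "f \<in> FF" shows "T \<phi> f \<in> FF"
proof (rule FF_coinduct[of _ "T \<phi> ` FF \<union> FF"], goal_cases)
  case 1 then show ?case using f by blast
next
  case (2 f k ws) then show ?case by (elim UnE imageE) (simp_all add: coderivation_off FF_off)
next
  case (3 f a b)
  then show ?case using add_even[of a b] add_odd[of a b] odd_mapD[OF \<phi>]
    by (auto simp: partial_coderivation \<phi> partial_add coderivation_linear)
next
  case (4 f a c)
  have "\<phi> a \<in> homog W" using odd_mapD[OF \<phi>] 4 by blast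
  with 4 show ?case using scale_even[of a c] scale_odd[of a c] odd_mapD(5)[OF \<phi>]
    by (auto simp: homog_def partial_coderivation \<phi> partial_scale coderivation_linear fun_eq_iff algebra_simps)
next
  case (5 f a b)
  have "\<phi> a \<in> homog W" "\<phi> b \<in> homog W" "a \<in> homog W" using odd_mapD[OF \<phi>] 5 by (auto simp: homog_def)
  with 5 show ?case using odd_mapD(1,2)[OF \<phi>] odD evD
    by (auto elim!: homog_cases simp: partial_coderivation \<phi> ff_partial_linear FF_partial partial_swap(1)[of _ a b]
        partial_swap(1)[of _ a "\<phi> b"] partial_swap(1)[of _ "\<phi> a" b] partial_swap(2)[of _ "\<phi> a" b])
next
  case (6 f a b)
  have "\<phi> a \<in> ev" "\<phi> b \<in> ev" "a \<in> homog W" "b \<in> homog W" using odd_mapD[OF \<phi>] 6 by (auto simp: homog_def)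
  with 6 show ?case using odD evD
    by (auto simp: partial_coderivation \<phi> ff_partial_linear coderivation_linear FF_partial partial_swap(2)[of _ a b]
        partial_swap(1)[of _ a "\<phi> b"] partial_swap(1)[of _ "\<phi> a" b])
next
  case (7 f v)
  show ?case
  proof (cases "f \<in> FF")
    case True then show ?thesis using FF_partial FF_linear(1) by (metis UnI2 add_0_right)
  next
    case False
    then obtain g where g: "f = T \<phi> g" "g \<in> FF" using 7 by auto
    have X: "T \<phi> (\<delta> v g) \<in> T \<phi> ` FF \<union> FF" "\<delta> (\<phi> v) g \<in> T \<phi> ` FF \<union> FF"
      "T \<phi> (- \<delta> v g) \<in> T \<phi> ` FF \<union> FF" "- \<delta> (\<phi> v) g \<in> T \<phi> ` FF \<union> FF"
      using FF_partial FF_linear(4) g(2) by simp_all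
    from 7(2) show ?thesis
    proof (rule homog_cases)
      assume "v \<in> ev" then show ?thesis
        unfolding g(1) using partial_coderivation_even[OF g(2)] by (intro bexI[OF _ X(1)] bexI[OF _ X(2)])
    next
      assume "v \<in> od"
      then have "\<delta> v f = T \<phi> (- \<delta> v g) + - \<delta> (\<phi> v) g"
        using partial_coderivation_odd[OF \<phi> g(2)] g(1) by (simp add: coderivation_linear)
      then show ?thesis by (intro bexI[OF _ X(3)] bexI[OF _ X(4)])
    qed
  qed
qed

lemma coderivation_inv:
  assumes \<phi>: "odd_map \<phi>" and f: "f \<in> FF" shows "T \<phi> (grinv f) = - grinv (T \<phi> f)"
proof (rule FF_eqI)
  show "T \<phi> (grinv f) k ws = (- grinv (T \<phi> f)) k ws" if "set ws \<subseteq> homog W" for ws k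
    using that f
  proof (induction ws arbitrary: f k rule: rev_induct)
    case Nil then show ?case by simp
  next
    case (snoc v ws)
    then have v: "v \<in> homog W" and ws: "set ws \<subseteq> homog W" by auto
    note IH = snoc.IH[OF ws] FF_partial FF_inv FF_coderivation[OF \<phi>] snoc.prems
    have "(v \<in> ev \<longrightarrow> \<phi> v \<in> od) \<and> (v \<in> od \<longrightarrow> \<phi> v \<in> ev)" using odd_mapD[OF \<phi>] by blast
    with v show ?case unfolding ff_partial_apply
      by (elim homog_cases) (simp_all add: ff_partial_linear partial_coderivation \<phi> partial_rules ff_involution_linear IH coderivation_linear)
  qed
qed (simp_all add: assms inv_off FF_coderivation coderivation_off)

lemma coderivation_mult:
  assumes \<phi>: "odd_map \<phi>" and "f \<in> FF" "g \<in> FF" shows "T \<phi> (f \<odot> g) = T \<phi> f \<odot> g + grinv f \<odot> T \<phi> g"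
proof (rule FF_eqI)
  show "T \<phi> (f \<odot> g) k ws = (T \<phi> f \<odot> g + grinv f \<odot> T \<phi> g) k ws" if "set ws \<subseteq> homog W" for ws k
    using that assms(2,3)
  proof (induction ws arbitrary: f g k rule: rev_induct)
    case Nil then show ?case by (simp add: ff_mult_Nil)
  next
    case (snoc v ws)
    then have v: "v \<in> homog W" and ws: "set ws \<subseteq> homog W" by auto
    note IH = snoc.IH[OF ws] FF_partial FF_inv FF_mult FF_coderivation[OF \<phi>] snoc.prems
    have "(v \<in> ev \<longrightarrow> \<phi> v \<in> od) \<and> (v \<in> od \<longrightarrow> \<phi> v \<in> ev)" using odd_mapD[OF \<phi>] by blast
    with v show ?case unfolding ff_partial_apply
      by (elim homog_cases) (simp_all add: ff_partial_linear partial_coderivation \<phi> partial_rules ff_mult_linear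
          IH coderivation_linear coderivation_inv[OF \<phi>] ff_mult_minus_left_eta)
  qed
qed (simp_all add: assms mult_off FF_inv FF_mult FF_coderivation coderivation_off)

text \<open>The mixed terms, with one map moved onto \<open>v\<close> and the other still acting on
  the function, cancel in pairs by the signs of odd operators. So the anticommutator is governed by
  \<phi> \<psi> + \<psi> \<phi> on vectors alone.\<close>

lemma partial_coderivation_anticommutator:
  assumes \<phi>: "odd_map \<phi>" and \<psi>: "odd_map \<psi>" and f: "f \<in> FF" and v: "v \<in> homog W"
  shows "\<delta> v (T \<phi> (T \<psi> f) + T \<psi> (T \<phi> f)) =
    T \<phi> (T \<psi> (\<delta> v f)) + T \<psi> (T \<phi> (\<delta> v f)) - \<delta> (\<phi> (\<psi> v)) f - \<delta> (\<psi> (\<phi> v)) f"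
proof -
  note FF = f FF_partial FF_coderivation[OF \<phi>] FF_coderivation[OF \<psi>]
  have p: "(v \<in> ev \<longrightarrow> \<phi> v \<in> od \<and> \<psi> v \<in> od) \<and> (v \<in> od \<longrightarrow> \<phi> v \<in> ev \<and> \<psi> v \<in> ev)"
    using odd_mapD[OF \<phi>] odd_mapD[OF \<psi>] by blast
  from v p show ?thesis
    by (elim homog_cases) (simp_all add: ff_partial_linear partial_coderivation \<phi> \<psi> FF coderivation_linear)
qed

text \<open>The square is half the anticommutator of the operator with itself, and the correction
  terms of that anticommutator are derivatives along null vectors.\<close>

lemma coderivation_square:
  assumes \<phi>: "odd_map \<phi>" and f: "f \<in> FF"
    and null: "\<And>v. v \<in> homog W \<Longrightarrow> \<phi> (\<phi> v) \<in> ev \<inter> od"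
  shows "T \<phi> (T \<phi> f) = 0"
proof (rule FF_eqI)
  show "T \<phi> (T \<phi> f) k ws = 0 k ws" if "set ws \<subseteq> homog W" for ws k
    using that f
  proof (induction ws arbitrary: f k rule: rev_induct)
    case Nil then show ?case by simp
  next
    case (snoc v ws)
    then have v: "v \<in> homog W" and ws: "set ws \<subseteq> homog W" by auto
    have "\<delta> (\<phi> (\<phi> v)) f = 0" using partial_null snoc.prems null[OF v] by blast
    then have "\<delta> v (T \<phi> (T \<phi> f)) + \<delta> v (T \<phi> (T \<phi> f)) = T \<phi> (T \<phi> (\<delta> v f)) + T \<phi> (T \<phi> (\<delta> v f))"
      using partial_coderivation_anticommutator[OF \<phi> \<phi> snoc.prems(2) v]
      by (simp only: ff_partial_linear diff_zero)
    then have "\<delta> v (T \<phi> (T \<phi> f)) k ws + \<delta> v (T \<phi> (T \<phi> f)) k ws = T \<phi> (T \<phi> (\<delta> v f)) k ws + T \<phi> (T \<phi> (\<delta> v f)) k ws"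
      unfolding plus_fun_apply[symmetric] by (rule arg_cong)
    then show ?case unfolding ff_partial_apply using snoc.IH[OF ws FF_partial[OF snoc.prems(2)]] by (simp add: ff_partial_linear)
  qed
qed (simp_all add: coderivation_off)

end


section \<open>The Laplacian and the bracket\<close>

lemma hbar_mult_linear:
  "hbar_mult (f + g) = hbar_mult f + hbar_mult g"
  "hbar_mult (f - g) = hbar_mult f - hbar_mult g"
  "hbar_mult (- f) = - hbar_mult f"
  "hbar_mult 0 = 0"
  "hbar_mult (ff_scale c f) = ff_scale c (hbar_mult f)"
  by (auto simp: hbar_mult_def fun_eq_iff)

lemma hbar_mult_sum: "hbar_mult (sum f I) = (\<Sum>i\<in>I. hbar_mult (f i))"
  by (rule additive_sum[of hbar_mult]) (simp_all add: hbar_mult_linear)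

lemma partial_hbar_mult: "ff_partial v (hbar_mult f) = hbar_mult (ff_partial v f)"
  by (simp add: ff_partial_def hbar_mult_def fun_eq_iff)

lemma involution_hbar_mult: "ff_involution W (hbar_mult f) = hbar_mult (ff_involution W f)"
  by (simp add: ff_involution_def hbar_mult_def fun_eq_iff)

lemma coderivation_hbar_mult: "coderivation W \<phi> (hbar_mult f) = hbar_mult (coderivation W \<phi> f)"
  by (simp add: coderivation_def hbar_mult_def fun_eq_iff)

lemma hbar_mult_mult_left: "ff_mult W (hbar_mult f) g = hbar_mult (ff_mult W f g)"
proof (intro ext)
  fix k ws
  show "ff_mult W (hbar_mult f) g k ws = hbar_mult (ff_mult W f g) k ws"
  proof (cases k)
    case (Suc l)
    show ?thesis unfolding Suc ff_mult_def sum.atMost_Suc_shift by (simp add: hbar_mult_def)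
  qed (simp add: ff_mult_def hbar_mult_def)
qed

lemma hbar_mult_mult_right: "ff_mult W f (hbar_mult g) = hbar_mult (ff_mult W f g)"
proof (intro ext)
  fix k ws
  show "ff_mult W f (hbar_mult g) k ws = hbar_mult (ff_mult W f g) k ws"
  proof (cases k)
    case (Suc l)
    show ?thesis unfolding Suc ff_mult_def
      by (auto simp: hbar_mult_def Suc_diff_le intro!: sum.cong)
  qed (simp add: ff_mult_def hbar_mult_def)
qed

lemma sum_antisymmetric:
  fixes a :: "nat \<Rightarrow> nat \<Rightarrow> 'w formal"
  assumes "\<And>i j. i < n \<Longrightarrow> j < n \<Longrightarrow> a i j = - a j i"
  shows "(\<Sum>i<n. \<Sum>j<n. a i j) = 0"
proof -
  have 1: "(\<Sum>i<n. \<Sum>j<n. a i j) = (\<Sum>i<n. \<Sum>j<n. - a j i)" by (intro sum.cong refl assms) auto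
  have 2: "(\<Sum>i<n. \<Sum>j<n. - a j i) = - (\<Sum>i<n. \<Sum>j<n. a i j)"
    unfolding sum_negf by (rule arg_cong[of _ _ uminus], rule sum.swap)
  show ?thesis using trans[OF 1 2] by (simp add: fun_eq_iff)
qed

text \<open>The basis is only recorded through the Laplacian that it defines.
  \<open>diff_compatible\<close> is the compatibility of d with the symplectic form in the shape
  needed for functions: d annihilates the bivector of the Laplacian.\<close>

locale symplectic_functions = super_functions W for W :: "'w super_space" +
  fixes n :: nat and e \<epsilon> :: "nat \<Rightarrow> 'w"
  assumes e_even: "i < n \<Longrightarrow> e i \<in> even_part W" and \<epsilon>_odd: "i < n \<Longrightarrow> \<epsilon> i \<in> odd_part W"
    and laplacian_eq: "laplacian W f = (\<Sum>i<n. ff_partial (e i) (ff_partial (\<epsilon> i) f))"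
    and diff_odd_map: "super_functions.odd_map W (vdiff W)"
    and diff_diff: "v \<in> homog W \<Longrightarrow> vdiff W (vdiff W v) \<in> even_part W \<inter> odd_part W"
    and diff_compatible: "f \<in> formal_functions W \<Longrightarrow>
      (\<Sum>i<n. ff_partial (vdiff W (e i)) (ff_partial (\<epsilon> i) f) + ff_partial (e i) (ff_partial (vdiff W (\<epsilon> i)) f)) = 0"
begin

abbreviation "\<Delta> \<equiv> laplacian W"
abbreviation "d \<equiv> ff_diff W"
abbreviation "br \<equiv> odd_bracket W"

lemma laplacian_linear:
  "\<Delta> (f + g) = \<Delta> f + \<Delta> g" "\<Delta> (f - g) = \<Delta> f - \<Delta> g" "\<Delta> (- f) = - \<Delta> f" "\<Delta> 0 = 0"
  "\<Delta> (ff_scale c f) = ff_scale c (\<Delta> f)"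
  unfolding laplacian_eq ff_partial_linear
  by (simp_all add: sum.distrib sum_subtractf sum_negf fun_eq_iff sum_fun_apply2 sum_distrib_left)

lemma diff_linear:
  "d (f + g) = d f + d g" "d (f - g) = d f - d g" "d (- f) = - d f" "d 0 = 0" "d (ff_scale c f) = ff_scale c (d f)"
  by (simp_all add: ff_diff_eq coderivation_linear)

lemma FF_laplacian: "f \<in> FF \<Longrightarrow> \<Delta> f \<in> FF"
  unfolding laplacian_eq by (intro FF_sum FF_partial)

lemma FF_diff: "f \<in> FF \<Longrightarrow> d f \<in> FF"
  unfolding ff_diff_eq by (rule FF_coderivation[OF diff_odd_map])

lemma diff_inv: "f \<in> FF \<Longrightarrow> d (grinv f) = - grinv (d f)"
  unfolding ff_diff_eq by (rule coderivation_inv[OF diff_odd_map])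

lemma diff_mult: "f \<in> FF \<Longrightarrow> g \<in> FF \<Longrightarrow> d (f \<odot> g) = d f \<odot> g + grinv f \<odot> d g"
  unfolding ff_diff_eq by (rule coderivation_mult[OF diff_odd_map])

lemma diff_square: "f \<in> FF \<Longrightarrow> d (d f) = 0"
  unfolding ff_diff_eq by (rule coderivation_square[OF diff_odd_map _ diff_diff])

lemma laplacian_inv: "f \<in> FF \<Longrightarrow> \<Delta> (grinv f) = - grinv (\<Delta> f)"
  unfolding laplacian_eq ff_involution_sum sum_negf[symmetric]
  by (intro sum.cong refl) (simp add: partial_rules e_even \<epsilon>_odd FF_partial ff_partial_linear)

lemma laplacian_mult:
  assumes "f \<in> FF" "g \<in> FF"
  shows "\<Delta> (f \<odot> g) = \<Delta> f \<odot> g + grinv f \<odot> \<Delta> g +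
    (\<Sum>i<n. \<delta> (\<epsilon> i) f \<odot> \<delta> (e i) g + grinv (\<delta> (e i) f) \<odot> \<delta> (\<epsilon> i) g)"
  unfolding laplacian_eq ff_mult_sum_left ff_mult_sum_right sum.distrib[symmetric]
  by (intro sum.cong refl)
    (simp add: partial_rules e_even \<epsilon>_odd FF_partial FF_inv assms ff_partial_linear algebra_simps)

text \<open>The second derivatives of the two factors cancel, leaving the coordinate formula of an
  odd Poisson bracket; product rule, symmetry and weight estimate are read off from it.\<close>

lemma bracket_eq:
  assumes "f \<in> FF" "g \<in> FF"
  shows "br f g = (\<Sum>i<n. \<delta> (e i) f \<odot> \<delta> (\<epsilon> i) g - grinv (\<delta> (\<epsilon> i) f) \<odot> \<delta> (e i) g)"
proof -
  have "br f g = (\<Sum>i<n. \<delta> (\<epsilon> i) (grinv f) \<odot> \<delta> (e i) g + grinv (\<delta> (e i) (grinv f)) \<odot> \<delta> (\<epsilon> i) g)"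
    unfolding odd_bracket_def laplacian_mult[OF FF_inv[OF assms(1)] assms(2)] by simp
  also have "\<dots> = (\<Sum>i<n. \<delta> (e i) f \<odot> \<delta> (\<epsilon> i) g - grinv (\<delta> (\<epsilon> i) f) \<odot> \<delta> (e i) g)"
    by (intro sum.cong refl) (simp add: partial_rules e_even \<epsilon>_odd assms ff_mult_linear)
  finally show ?thesis .
qed

lemma FF_bracket: "f \<in> FF \<Longrightarrow> g \<in> FF \<Longrightarrow> br f g \<in> FF"
  unfolding odd_bracket_def by (intro FF_linear(3) FF_laplacian FF_mult FF_inv)

lemma bracket_linear:
  "br (f + f') g = br f g + br f' g" "br f (g + g') = br f g + br f g'"
  "br (- f) g = - br f g" "br f (- g) = - br f g"
  "br (ff_scale c f) g = ff_scale c (br f g)" "br f (ff_scale c g) = ff_scale c (br f g)"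
  unfolding odd_bracket_def
  by (simp_all add: ff_involution_linear laplacian_linear ff_mult_linear ff_mult_scale_left ff_mult_scale_right
      ff_scale_linear)

text \<open>Exchanging the indices of the two Laplacians exchanges one pair of odd derivatives, so
  the double sum is antisymmetric.\<close>

lemma laplacian_square: assumes "f \<in> FF" shows "\<Delta> (\<Delta> f) = 0"
proof -
  let ?g = "\<lambda>i j. \<delta> (e i) (\<delta> (\<epsilon> i) (\<delta> (e j) (\<delta> (\<epsilon> j) f)))"
  have g: "?g i j = - ?g j i" if "i < n" "j < n" for i j
  proof -
    note m = e_even[OF that(1)] e_even[OF that(2)] \<epsilon>_odd[OF that(1)] \<epsilon>_odd[OF that(2)]
    have "?g i j = \<delta> (e i) (\<delta> (e j) (\<delta> (\<epsilon> i) (\<delta> (\<epsilon> j) f)))"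
      using partial_swap(1)[of "\<delta> (\<epsilon> j) f" "\<epsilon> i" "e j"] m assms by (simp add: FF_partial evD odD)
    also have "\<dots> = \<delta> (e j) (\<delta> (e i) (\<delta> (\<epsilon> i) (\<delta> (\<epsilon> j) f)))"
      using partial_swap(1)[of "\<delta> (\<epsilon> i) (\<delta> (\<epsilon> j) f)" "e i" "e j"] m assms by (simp add: FF_partial evD)
    also have "\<dots> = - \<delta> (e j) (\<delta> (e i) (\<delta> (\<epsilon> j) (\<delta> (\<epsilon> i) f)))"
      using partial_swap(2)[of f "\<epsilon> i" "\<epsilon> j"] m assms by (simp add: odD ff_partial_linear)
    also have "\<dots> = - ?g j i"
      using partial_swap(1)[of "\<delta> (\<epsilon> i) f" "e i" "\<epsilon> j"] m assms by (simp add: FF_partial evD odD)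
    finally show ?thesis .
  qed
  have "\<Delta> (\<Delta> f) = (\<Sum>i<n. \<Sum>j<n. ?g i j)" unfolding laplacian_eq by (simp add: ff_partial_sum)
  then show ?thesis using sum_antisymmetric[of n ?g, OF g] by simp
qed

text \<open>Moving d past two derivatives of opposite parity gives a minus sign and correction terms
  along d of the basis vectors, whose sum vanishes by \<open>diff_compatible\<close>.\<close>

lemma diff_laplacian: assumes "f \<in> FF" shows "d (\<Delta> f) = - \<Delta> (d f)"
proof -
  have "\<delta> (e i) (\<delta> (\<epsilon> i) (d f)) = - d (\<delta> (e i) (\<delta> (\<epsilon> i) f)) -
     (\<delta> (vdiff W (e i)) (\<delta> (\<epsilon> i) f) + \<delta> (e i) (\<delta> (vdiff W (\<epsilon> i)) f))" if "i < n" for i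
    using that assms
    by (simp add: ff_diff_eq partial_coderivation diff_odd_map e_even \<epsilon>_odd FF_partial ff_partial_linear)
  then have "\<Delta> (d f) = (\<Sum>i<n. - d (\<delta> (e i) (\<delta> (\<epsilon> i) f))) -
     (\<Sum>i<n. \<delta> (vdiff W (e i)) (\<delta> (\<epsilon> i) f) + \<delta> (e i) (\<delta> (vdiff W (\<epsilon> i)) f))"
    unfolding laplacian_eq sum_subtractf[symmetric] by (intro sum.cong refl) auto
  also have "\<dots> = - (\<Sum>i<n. d (\<delta> (e i) (\<delta> (\<epsilon> i) f)))"
    unfolding diff_compatible[OF assms] by (simp add: sum_negf)
  also have "(\<Sum>i<n. d (\<delta> (e i) (\<delta> (\<epsilon> i) f))) = d (\<Delta> f)"
    unfolding laplacian_eq by (rule additive_sum[of d, symmetric]) (simp_all add: diff_linear)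
  finally have "\<Delta> (d f) = - d (\<Delta> f)" .
  then show ?thesis by (metis minus_minus)
qed

text \<open>A derivation whose commutator with the Laplacian is a derivation is a derivation of the
  bracket.  This applies both to the differential and to the operators \<open>[f, -]\<close>, and gives the
  Jacobi identity in the second case.\<close>

lemma odd_derivation_bracket:
  assumes XF: "\<And>f. f \<in> FF \<Longrightarrow> X f \<in> FF"
    and X: "\<And>f g. f \<in> FF \<Longrightarrow> g \<in> FF \<Longrightarrow> X (f \<odot> g) = X f \<odot> g + grinv f \<odot> X g"
    and X_inv: "\<And>f. f \<in> FF \<Longrightarrow> X (grinv f) = - grinv (X f)"
    and X_diff: "\<And>f g. X (f - g) = X f - X g"
    and X\<Delta>: "\<And>f. f \<in> FF \<Longrightarrow> X (\<Delta> f) = Y f - \<Delta> (X f)"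
    and Y: "\<And>f g. f \<in> FF \<Longrightarrow> g \<in> FF \<Longrightarrow> Y (f \<odot> g) = Y f \<odot> g + f \<odot> Y g"
    and g: "g \<in> FF" and h: "h \<in> FF"
  shows "X (br g h) = br (X g) h - br (grinv g) (X h)"
proof -
  have X_minus: "X (- f) = - X f" for f using X_diff[of 0 f] X_diff[of 0 0] by simp
  \<comment> \<open>\<open>Y\<close> is the anticommutator of two odd operators on formal functions,
    and this determines its parity.\<close>
  have "Y u = X (\<Delta> u) + \<Delta> (X u)" if "u \<in> FF" for u using X\<Delta>[OF that] by simp
  then have Y_inv: "Y (grinv u) = grinv (Y u)" if "u \<in> FF" for u
    using that by (simp add: FF_inv FF_laplacian XF laplacian_inv X_inv X_minus laplacian_linear ff_involution_linear)
  show ?thesis unfolding odd_bracket_def X_diff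
    by (simp add: X\<Delta> X X_inv X_minus Y Y_inv FF_mult FF_inv FF_laplacian XF g h laplacian_linear ff_mult_linear
        laplacian_inv ff_involution_linear algebra_simps)
qed

lemma even_derivation_bracket:
  assumes XF: "\<And>f. f \<in> FF \<Longrightarrow> X f \<in> FF"
    and X: "\<And>f g. f \<in> FF \<Longrightarrow> g \<in> FF \<Longrightarrow> X (f \<odot> g) = X f \<odot> g + f \<odot> X g"
    and X_inv: "\<And>f. f \<in> FF \<Longrightarrow> X (grinv f) = grinv (X f)"
    and X_diff: "\<And>f g. X (f - g) = X f - X g"
    and X\<Delta>: "\<And>f. f \<in> FF \<Longrightarrow> X (\<Delta> f) = Y f + \<Delta> (X f)"
    and Y: "\<And>f g. f \<in> FF \<Longrightarrow> g \<in> FF \<Longrightarrow> Y (f \<odot> g) = Y f \<odot> g + grinv f \<odot> Y g"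
    and g: "g \<in> FF" and h: "h \<in> FF"
  shows "X (br g h) = br (X g) h + br g (X h)"
proof -
  have X_minus: "X (- f) = - X f" for f using X_diff[of 0 f] X_diff[of 0 0] by simp
  have "Y u = X (\<Delta> u) - \<Delta> (X u)" if "u \<in> FF" for u using X\<Delta>[OF that] by simp
  then have Y_inv: "Y (grinv u) = - grinv (Y u)" if "u \<in> FF" for u
    using that by (simp add: FF_inv FF_laplacian XF laplacian_inv X_inv X_minus laplacian_linear ff_involution_linear)
  show ?thesis unfolding odd_bracket_def X_diff
    by (simp add: X\<Delta> X X_inv X_minus Y Y_inv FF_mult FF_inv FF_laplacian XF g h laplacian_linear ff_mult_linear
        laplacian_inv ff_involution_linear algebra_simps)
qed

lemma diff_bracket:
  assumes "f \<in> FF" "g \<in> FF" shows "d (br f g) = br (d f) g - br (grinv f) (d g)"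
proof (rule odd_derivation_bracket[where Y="\<lambda>_. 0"])
  show "d (\<Delta> f) = 0 - \<Delta> (d f)" if "f \<in> FF" for f using diff_laplacian[OF that] by simp
qed (rule assms FF_diff diff_mult diff_inv diff_linear | assumption | simp)+

text \<open>Immediate from the definition of the bracket as the defect of \<Delta> from being a
  derivation, because \<Delta> squares to zero.\<close>

lemma laplacian_bracket:
  assumes "f \<in> FF" "g \<in> FF" shows "\<Delta> (br f g) = br (\<Delta> f) g - br (grinv f) (\<Delta> g)"
  unfolding odd_bracket_def
  by (simp add: assms FF_mult FF_inv FF_laplacian laplacian_linear laplacian_inv laplacian_square
      ff_mult_linear ff_involution_linear)

lemma inv_bracket:
  assumes "f \<in> FF" "g \<in> FF" shows "grinv (br f g) = - br (grinv f) (grinv g)"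
proof -
  have "grinv (\<Delta> u) = - \<Delta> (grinv u)" if "u \<in> FF" for u using laplacian_inv[OF that] by simp
  then show ?thesis unfolding odd_bracket_def
    by (simp add: assms FF_mult FF_inv FF_laplacian inv_mult ff_mult_linear ff_involution_linear)
qed

text \<open>For even \<open>f\<close> the operator [f, -] is an odd derivation of the product. In
  coordinates the even derivative of \<open>f\<close> along \<open>e i\<close> and the odd one along
  \<open>\<epsilon> i\<close> have to be moved past \<open>g\<close>.\<close>

lemma bracket_mult_even:
  assumes f: "f \<in> FF" "grinv f = f" and g: "g \<in> FF" and h: "h \<in> FF"
  shows "br f (g \<odot> h) = br f g \<odot> h + grinv g \<odot> br f h"
proof -
  have "\<delta> (e i) f \<odot> \<delta> (\<epsilon> i) (g \<odot> h) - grinv (\<delta> (\<epsilon> i) f) \<odot> \<delta> (e i) (g \<odot> h) =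
    (\<delta> (e i) f \<odot> \<delta> (\<epsilon> i) g - grinv (\<delta> (\<epsilon> i) f) \<odot> \<delta> (e i) g) \<odot> h +
    grinv g \<odot> (\<delta> (e i) f \<odot> \<delta> (\<epsilon> i) h - grinv (\<delta> (\<epsilon> i) f) \<odot> \<delta> (e i) h)" if "i < n" for i
  proof -
    let ?a = "\<delta> (e i) f" and ?b = "\<delta> (\<epsilon> i) f"
    have m: "e i \<in> ev" "\<epsilon> i \<in> od" using that e_even \<epsilon>_odd by auto
    have F: "?a \<in> FF" "?b \<in> FF" using f FF_partial by auto
    have a: "grinv ?a = ?a" using partial_inv_even[OF m(1), of f] f by simp
    have b: "grinv ?b = - ?b" using partial_inv_odd[OF m(2) f(1)] f by (metis minus_minus)
    have "?a \<odot> (grinv g \<odot> \<delta> (\<epsilon> i) h) = grinv g \<odot> (?a \<odot> \<delta> (\<epsilon> i) h)"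
      using mult_commute_even[OF a F(1) FF_inv[OF g]]
      by (simp add: mult_assoc[symmetric] F FF_inv FF_partial g h)
    moreover have "?b \<odot> (g \<odot> \<delta> (e i) h) = grinv g \<odot> (?b \<odot> \<delta> (e i) h)"
      using mult_commute_odd[OF b F(2) g]
      by (simp add: mult_assoc[symmetric] F FF_inv FF_partial g h)
    ultimately show ?thesis
      by (simp add: partial_rules m g h b mult_assoc F FF_partial FF_inv ff_mult_linear algebra_simps)
  qed
  then show ?thesis
    unfolding bracket_eq[OF f(1) FF_mult[OF g h]] bracket_eq[OF f(1) g] bracket_eq[OF f(1) h]
      ff_mult_sum_left ff_mult_sum_right sum.distrib[symmetric]
    by (intro sum.cong refl) auto
qed

lemma bracket_mult_odd:
  assumes f: "f \<in> FF" "grinv f = - f" and g: "g \<in> FF" and h: "h \<in> FF"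
  shows "br f (g \<odot> h) = br f g \<odot> h + g \<odot> br f h"
proof -
  have "\<delta> (e i) f \<odot> \<delta> (\<epsilon> i) (g \<odot> h) - grinv (\<delta> (\<epsilon> i) f) \<odot> \<delta> (e i) (g \<odot> h) =
    (\<delta> (e i) f \<odot> \<delta> (\<epsilon> i) g - grinv (\<delta> (\<epsilon> i) f) \<odot> \<delta> (e i) g) \<odot> h +
    g \<odot> (\<delta> (e i) f \<odot> \<delta> (\<epsilon> i) h - grinv (\<delta> (\<epsilon> i) f) \<odot> \<delta> (e i) h)" if "i < n" for i
  proof -
    let ?a = "\<delta> (e i) f" and ?b = "\<delta> (\<epsilon> i) f"
    have m: "e i \<in> ev" "\<epsilon> i \<in> od" using that e_even \<epsilon>_odd by auto
    have F: "?a \<in> FF" "?b \<in> FF" using f FF_partial by auto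
    have a: "grinv ?a = - ?a" using partial_inv_even[OF m(1), of f] f by (simp add: ff_partial_linear)
    have b: "grinv ?b = ?b" using partial_inv_odd[OF m(2) f(1)] f by (simp add: ff_partial_linear)
    have "?a \<odot> (grinv g \<odot> \<delta> (\<epsilon> i) h) = g \<odot> (?a \<odot> \<delta> (\<epsilon> i) h)"
      using mult_commute_odd[OF a F(1) FF_inv[OF g]]
      by (simp add: mult_assoc[symmetric] F FF_inv FF_partial g h)
    moreover have "?b \<odot> (g \<odot> \<delta> (e i) h) = g \<odot> (?b \<odot> \<delta> (e i) h)"
      using mult_commute_even[OF b F(2) g]
      by (simp add: mult_assoc[symmetric] F FF_inv FF_partial g h)
    ultimately show ?thesis
      by (simp add: partial_rules m g h b mult_assoc F FF_partial FF_inv ff_mult_linear algebra_simps)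
  qed
  then show ?thesis
    unfolding bracket_eq[OF f(1) FF_mult[OF g h]] bracket_eq[OF f(1) g] bracket_eq[OF f(1) h]
      ff_mult_sum_left ff_mult_sum_right sum.distrib[symmetric]
    by (intro sum.cong refl) auto
qed

lemma bracket_diff_right: "br f (g - g') = br f g - br f g'"
  using bracket_linear(2)[of f g "- g'"] by (simp add: bracket_linear)

text \<open>By \<open>laplacian_bracket\<close> the anticommutator of [f, -] with \<Delta> is
  [\<Delta> f, -], and this is an even derivation since \<Delta> f is odd.\<close>

lemma jacobi_even:
  assumes f: "f \<in> FF" "grinv f = f" and g: "g \<in> FF" and h: "h \<in> FF"
  shows "br f (br g h) = br (br f g) h - br (grinv g) (br f h)"
proof (rule odd_derivation_bracket[where Y="br (\<Delta> f)"])
  have \<Delta>f: "\<Delta> f \<in> FF" "grinv (\<Delta> f) = - \<Delta> f"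
    using f FF_laplacian laplacian_inv[OF f(1)] by (simp, metis minus_minus)
  show "br (\<Delta> f) (g \<odot> h) = br (\<Delta> f) g \<odot> h + g \<odot> br (\<Delta> f) h" if "g \<in> FF" "h \<in> FF" for g h
    by (rule bracket_mult_odd[OF \<Delta>f that])
  show "br f (\<Delta> g) = br (\<Delta> f) g - \<Delta> (br f g)" if "g \<in> FF" for g
    using laplacian_bracket[OF f(1) that] f by simp
  show "br f (grinv g) = - grinv (br f g)" if "g \<in> FF" for g
    using inv_bracket[OF f(1) that] f by simp
qed (rule f g h FF_bracket bracket_mult_even bracket_diff_right | assumption)+

lemma jacobi_odd:
  assumes f: "f \<in> FF" "grinv f = - f" and g: "g \<in> FF" and h: "h \<in> FF"
  shows "br f (br g h) = br (br f g) h + br g (br f h)"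
proof (rule even_derivation_bracket[where Y="\<lambda>g. - br (\<Delta> f) g"])
  have \<Delta>f: "\<Delta> f \<in> FF" "grinv (\<Delta> f) = \<Delta> f"
    using f FF_laplacian laplacian_inv[OF f(1)] by (simp_all add: laplacian_linear)
  show "- br (\<Delta> f) (g \<odot> h) = - br (\<Delta> f) g \<odot> h + grinv g \<odot> - br (\<Delta> f) h" if "g \<in> FF" "h \<in> FF" for g h
    using bracket_mult_even[OF \<Delta>f that] by (simp add: ff_mult_linear)
  show "br f (\<Delta> g) = - br (\<Delta> f) g + \<Delta> (br f g)" if "g \<in> FF" for g
    using laplacian_bracket[OF f(1) that] f by (simp add: bracket_linear)
  show "br f (grinv g) = grinv (br f g)" if "g \<in> FF" for g
    using inv_bracket[OF f(1) that] f by (simp add: bracket_linear)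
qed (rule f g h FF_bracket bracket_mult_odd bracket_diff_right | assumption)+

lemma bracket_sym_even:
  assumes f: "f \<in> FF" "grinv f = f" and g: "g \<in> FF" "grinv g = g"
  shows "br g f = br f g"
  unfolding bracket_eq[OF f(1) g(1)] bracket_eq[OF g(1) f(1)]
proof (intro sum.cong refl)
  fix i assume "i \<in> {..<n}"
  then have m: "e i \<in> ev" "\<epsilon> i \<in> od" using e_even \<epsilon>_odd by auto
  note F = FF_partial[OF f(1)] FF_partial[OF g(1)]
  have a: "grinv (\<delta> (e i) f) = \<delta> (e i) f" "grinv (\<delta> (e i) g) = \<delta> (e i) g"
    using partial_inv_even[OF m(1), of f] partial_inv_even[OF m(1), of g] f g by simp_all
  have b: "grinv (\<delta> (\<epsilon> i) f) = - \<delta> (\<epsilon> i) f" "grinv (\<delta> (\<epsilon> i) g) = - \<delta> (\<epsilon> i) g"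
    using partial_inv_odd[OF m(2) f(1)] partial_inv_odd[OF m(2) g(1)] f g by (metis minus_minus)+
  show "\<delta> (e i) g \<odot> \<delta> (\<epsilon> i) f - grinv (\<delta> (\<epsilon> i) g) \<odot> \<delta> (e i) f =
      \<delta> (e i) f \<odot> \<delta> (\<epsilon> i) g - grinv (\<delta> (\<epsilon> i) f) \<odot> \<delta> (e i) g"
    unfolding b ff_mult_linear mult_commute_even[OF a(2) F(2) F(1)] mult_commute_even[OF a(1) F(1) F(2)]
    by simp
qed

lemma bracket_antisym_odd:
  assumes f: "f \<in> FF" "grinv f = - f" and g: "g \<in> FF"
  shows "br g f = - br f g"
  unfolding bracket_eq[OF f(1) g(1)] bracket_eq[OF g(1) f(1)] sum_negf[symmetric]
proof (intro sum.cong refl)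
  fix i assume "i \<in> {..<n}"
  then have m: "e i \<in> ev" "\<epsilon> i \<in> od" using e_even \<epsilon>_odd by auto
  note F = FF_partial[OF f(1)] FF_partial[OF g(1)]
  have a: "grinv (\<delta> (e i) f) = - \<delta> (e i) f"
    using partial_inv_even[OF m(1), of f] f by (simp add: ff_partial_linear)
  have b: "grinv (\<delta> (\<epsilon> i) f) = \<delta> (\<epsilon> i) f"
    using partial_inv_odd[OF m(2) f(1)] f by (simp add: ff_partial_linear)
  show "\<delta> (e i) g \<odot> \<delta> (\<epsilon> i) f - grinv (\<delta> (\<epsilon> i) g) \<odot> \<delta> (e i) f =
      - (\<delta> (e i) f \<odot> \<delta> (\<epsilon> i) g - grinv (\<delta> (\<epsilon> i) f) \<odot> \<delta> (e i) g)"
    unfolding b mult_commute_even[OF b F(1) F(2)] mult_commute_odd[OF a F(1) F(2)] by simp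
qed

end

section \<open>Paths and homotopy\<close>

text \<open>The rules for odd left arguments are needed for paths: the dt component of an even path
  is odd in the coefficient algebra.\<close>

locale odd_dgla =
  fixes \<gg> :: "'g::ab_group_add filtered_dgla"
  assumes gauge_algebra: "gauge_algebra (gscale \<gg>) (gsign \<gg>) (gdiff \<gg>) (gbracket \<gg>) (gfilt \<gg>)"
    and gspace: "gspace \<gg> = gfilt \<gg> 0"
    and jacobi_odd_left: "x \<in> gfilt \<gg> 0 \<Longrightarrow> gsign \<gg> x = - x \<Longrightarrow> y \<in> gfilt \<gg> 0 \<Longrightarrow> z \<in> gfilt \<gg> 0 \<Longrightarrow>
      gbracket \<gg> x (gbracket \<gg> y z) = gbracket \<gg> (gbracket \<gg> x y) z + gbracket \<gg> y (gbracket \<gg> x z)"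
    and br_antisym: "x \<in> gfilt \<gg> 0 \<Longrightarrow> gsign \<gg> x = - x \<Longrightarrow> y \<in> gfilt \<gg> 0 \<Longrightarrow>
      gbracket \<gg> y x = - gbracket \<gg> x y"
begin

abbreviation "sc \<equiv> gscale \<gg>"
abbreviation "sg \<equiv> gsign \<gg>"
abbreviation "D \<equiv> gdiff \<gg>"
abbreviation "br \<equiv> gbracket \<gg>"
abbreviation "F \<equiv> gfilt \<gg>"

sublocale gauge_algebra sc sg D br F
  by (rule gauge_algebra)

section \<open>Brackets of series with coefficients in an odd dgla\<close>

lemma conv_add_left: "conv br (\<lambda>k. a k + a' k) c k = conv br a c k + conv br a' c k"
  by (simp add: conv_def br_add_left sum.distrib)
lemma conv_add_right: "conv br a (\<lambda>k. c k + c' k) k = conv br a c k + conv br a c' k"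
  by (simp add: conv_def br_add_right sum.distrib)
lemma conv_diff_left: "conv br (\<lambda>k. a k - a' k) c k = conv br a c k - conv br a' c k"
  by (simp add: conv_def br_diff_left sum_subtractf)
lemma conv_diff_right: "conv br a (\<lambda>k. c k - c' k) k = conv br a c k - conv br a c' k"
  by (simp add: conv_def br_diff_right sum_subtractf)
lemma conv_minus_left: "conv br (\<lambda>k. - a k) c k = - conv br a c k"
  by (simp add: conv_def br_minus_left sum_negf)
lemma conv_minus_right: "conv br a (\<lambda>k. - c k) k = - conv br a c k"
  by (simp add: conv_def br_minus_right sum_negf)
lemma conv_scale_left: "conv br (\<lambda>k. sc t (a k)) c k = sc t (conv br a c k)"
  by (simp add: conv_def br_scale_left scale_sum_right)
lemma conv_scale_right: "conv br a (\<lambda>k. sc t (c k)) k = sc t (conv br a c k)"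
  by (simp add: conv_def br_scale_right scale_sum_right)

lemmas conv_linear = conv_add_left conv_add_right conv_diff_left conv_diff_right
  conv_minus_left conv_minus_right conv_scale_left conv_scale_right

lemma conv_single_right: "conv br a (\<lambda>k. if k = 0 then x else 0) k = br (a k) x"
proof -
  have "conv br a (\<lambda>k. if k = 0 then x else 0) k = (\<Sum>l\<le>k. if l = k then br (a k) x else 0)"
    unfolding conv_def by (intro sum.cong) auto
  then show ?thesis by simp
qed

lemma conv_single_left: "conv br (\<lambda>k. if k = 0 then x else 0) a k = br x (a k)"
proof -
  have "conv br (\<lambda>k. if k = 0 then x else 0) a k = (\<Sum>l\<le>k. if l = 0 then br x (a k) else 0)"
    unfolding conv_def by (intro sum.cong) auto
  then show ?thesis by simp
qed

lemma conv_zero: "conv br a (\<lambda>_. 0) k = 0" "conv br (\<lambda>_. 0) a k = 0"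
  by (auto simp: conv_def)

lemma sg_conv:
  "(\<And>k. a k \<in> F 0) \<Longrightarrow> (\<And>k. c k \<in> F 0) \<Longrightarrow> sg (conv br a c k) = - conv br (\<lambda>k. sg (a k)) (\<lambda>k. sg (c k)) k"
  by (simp add: conv_def sg_sum sg_br sum_negf)

lemma D_conv:
  "(\<And>k. a k \<in> F 0) \<Longrightarrow> (\<And>k. c k \<in> F 0) \<Longrightarrow>
    D (conv br a c k) = conv br (\<lambda>k. D (a k)) c k - conv br (\<lambda>k. sg (a k)) (\<lambda>k. D (c k)) k"
  by (simp add: conv_def D_sum D_br sum_subtractf)

lemma conv_F: "(\<And>k. a k \<in> F j) \<Longrightarrow> (\<And>k. c k \<in> F 0) \<Longrightarrow> conv br a c k \<in> F (Suc j)"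
  unfolding conv_def by (intro F_sum br_F_left)

lemma conv_F': "(\<And>k. a k \<in> F 0) \<Longrightarrow> (\<And>k. c k \<in> F j) \<Longrightarrow> conv br a c k \<in> F (Suc j)"
  unfolding conv_def by (intro F_sum br_F_right)

lemma conv_antisym:
  assumes "\<And>k. x k \<in> F 0" "\<And>k. y k \<in> F 0" "\<And>k. sg (x k) = - x k"
  shows "conv br y x k = - conv br x y k"
proof -
  have "conv br y x k = (\<Sum>l\<le>k. br (y (k - l)) (x l))"
    unfolding conv_def using sum_atMost_rev[of "\<lambda>l. br (y l) (x (k - l))" k] by simp
  also have "\<dots> = (\<Sum>l\<le>k. - br (x l) (y (k - l)))"
    by (intro sum.cong refl br_antisym assms)
  finally show ?thesis by (simp add: conv_def sum_negf)
qed

lemma conv_conv_right: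
  "conv br x (conv br y z) k = (\<Sum>i\<le>k. \<Sum>j\<le>k - i. br (x i) (br (y j) (z (k - i - j))))"
  by (simp add: conv_def br_sum_right)

lemma conv_conv_left:
  "conv br (conv br x y) z k = (\<Sum>i\<le>k. \<Sum>j\<le>k - i. br (br (x i) (y j)) (z (k - i - j)))"
  unfolding conv_def br_sum_left
  by (rule sum_triple_reindex[of "\<lambda>i j l. br (br (x i) (y j)) (z l)"])

lemma conv_conv_right':
  "conv br y (conv br x z) k = (\<Sum>i\<le>k. \<Sum>j\<le>k - i. br (y j) (br (x i) (z (k - i - j))))"
  unfolding conv_conv_right by (rule sum_triple_reindex_swap[symmetric])

lemma conv_jacobi_even:
  assumes "\<And>k. x k \<in> F 0" "\<And>k. y k \<in> F 0" "\<And>k. z k \<in> F 0" "\<And>k. sg (x k) = x k"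
  shows "conv br x (conv br y z) k = conv br (conv br x y) z k - conv br (\<lambda>k. sg (y k)) (conv br x z) k"
  unfolding conv_conv_right[of x] conv_conv_left conv_conv_right'[of _ x] sum_subtractf[symmetric]
  by (intro sum.cong refl jacobi assms)

lemma conv_jacobi_odd:
  assumes "\<And>k. x k \<in> F 0" "\<And>k. y k \<in> F 0" "\<And>k. z k \<in> F 0" "\<And>k. sg (x k) = - x k"
  shows "conv br x (conv br y z) k = conv br (conv br x y) z k + conv br y (conv br x z) k"
  unfolding conv_conv_right[of x] conv_conv_left conv_conv_right'[of _ x] sum.distrib[symmetric]
  by (intro sum.cong refl jacobi_odd_left assms)

section \<open>The dgla of paths as a complete filtered algebra\<close>

definition path_filt :: "nat \<Rightarrow> ((nat \<Rightarrow> 'g) \<times> (nat \<Rightarrow> 'g)) set" where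
  "path_filt j = {(a, b). null_seq a \<and> null_seq b \<and> (\<forall>k. a k \<in> F j \<and> b k \<in> F j)}"

abbreviation "Psc \<equiv> gscale (path_dgla \<gg>)"
abbreviation "Psg \<equiv> gsign (path_dgla \<gg>)"
abbreviation "PD \<equiv> gdiff (path_dgla \<gg>)"
abbreviation "Pbr \<equiv> gbracket (path_dgla \<gg>)"

lemma null_seq_finite:
  "null_seq a \<longleftrightarrow> (\<forall>k. a k \<in> F 0) \<and> (\<forall>j\<ge>1. finite {k. a k \<notin> F j})"
proof -
  have "(\<exists>N. \<forall>k\<ge>N. a k \<in> F j) \<longleftrightarrow> finite {k. a k \<notin> F j}" for j
    unfolding finite_nat_set_iff_bounded_le by (auto simp: not_le) (metis Suc_leD le_less_linear not_less_eq_eq)+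
  moreover have "(\<forall>j. \<exists>N. \<forall>k\<ge>N. a k \<in> F j) \<longleftrightarrow> (\<forall>j\<ge>1. \<exists>N. \<forall>k\<ge>N. a k \<in> F j)"
    using F_0 by (metis less_one not_less)
  ultimately show ?thesis unfolding null_seq_def by simp
qed

lemma gspace_path: "gspace (path_dgla \<gg>) = path_filt 0"
  unfolding path_filt_def path_dgla_def gspace null_seq_finite by auto

lemma path_simps:
  "Psc c (a, b) = (\<lambda>k. sc c (a k), \<lambda>k. sc c (b k))"
  "Psg (a, b) = (\<lambda>k. sg (a k), \<lambda>k. - sg (b k))"
  "PD (a, b) = (\<lambda>k. D (a k), \<lambda>k. D (b k) + sc (real (Suc k)) (sg (a (Suc k))))"
  "Pbr (a, b) (a', b') = (conv br a a', \<lambda>k. conv br a b' k - conv br b (\<lambda>k. sg (a' k)) k)"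
  by (auto simp: path_dgla_def conv_def sum_subtractf fun_eq_iff)

lemma null_seqD: "null_seq a \<Longrightarrow> a k \<in> F 0"
  by (simp add: null_seq_def)

lemma null_seq_map: "null_seq a \<Longrightarrow> (\<And>x j. x \<in> F j \<Longrightarrow> L x \<in> F j) \<Longrightarrow> null_seq (\<lambda>k. L (a k))"
  unfolding null_seq_def by meson

lemma null_seq_add:
  assumes "null_seq a" "null_seq b" shows "null_seq (\<lambda>k. a k + b k)"
  unfolding null_seq_def
proof (intro conjI allI)
  show "a k + b k \<in> F 0" for k using assms null_seqD F_add by blast
  fix j
  obtain N M where "\<forall>k\<ge>N. a k \<in> F j" "\<forall>k\<ge>M. b k \<in> F j" using assms unfolding null_seq_def by meson
  then have "\<forall>k\<ge>max N M. a k + b k \<in> F j" by (simp add: F_add)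
  then show "\<exists>N. \<forall>k\<ge>N. a k + b k \<in> F j" by blast
qed

lemma null_seq_zero: "null_seq (\<lambda>_. 0)"
  by (simp add: null_seq_def F_zero)

lemma null_seq_scaled:
  assumes "null_seq a" shows "null_seq (\<lambda>k. sc (t k) (a k))"
  using assms unfolding null_seq_def by (meson F_scale)

lemma null_seq_diff: "null_seq a \<Longrightarrow> null_seq b \<Longrightarrow> null_seq (\<lambda>k. a k - b k)"
  using null_seq_add[of a "\<lambda>k. sc (-1) (b k)"] null_seq_scaled[of b "\<lambda>_. -1"] by simp

lemma null_seq_shift: "null_seq a \<Longrightarrow> null_seq (\<lambda>k. a (Suc k))"
  unfolding null_seq_def by (meson le_SucI)

lemma path_filtI:
  "null_seq a \<Longrightarrow> null_seq b \<Longrightarrow> (\<And>k. a k \<in> F j) \<Longrightarrow> (\<And>k. b k \<in> F j) \<Longrightarrow> (a, b) \<in> path_filt j"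
  by (simp add: path_filt_def)

lemma path_filt_0: "(a, b) \<in> path_filt 0 \<longleftrightarrow> null_seq a \<and> null_seq b"
  by (auto simp: path_filt_def null_seq_def)

text \<open>The limit is taken coefficient by coefficient. The Cauchy condition is uniform in the
  coefficient index, so one \<open>N\<close> serves all coefficients (\<open>near\<close>); this
  carries the decay of the coefficients of \<open>S N\<close> over to the limit.\<close>

lemma path_complete:
  assumes S: "\<And>n::nat. S n \<in> path_filt 0"
    and cauchy: "\<And>j. \<exists>N. \<forall>n\<ge>N. S n - S N \<in> path_filt j"
  shows "\<exists>x\<in>path_filt 0. \<forall>j. \<exists>N. \<forall>n\<ge>N. S n - x \<in> path_filt j"
proof -
  have comp: "\<exists>x. null_seq x \<and> (\<forall>j N. (\<forall>n\<ge>N. \<forall>k. f (S n) k - f (S N) k \<in> F j) \<longrightarrow> (\<forall>n\<ge>N. \<forall>k. f (S n) k - x k \<in> F j))"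
    if f: "f = fst \<or> f = snd" for f :: "(nat \<Rightarrow> 'g) \<times> (nat \<Rightarrow> 'g) \<Rightarrow> nat \<Rightarrow> 'g"
  proof -
    have fS: "null_seq (f (S n))" for n using S[of n] f by (auto simp: path_filt_def split: prod.splits)
    have fc: "\<exists>N. \<forall>n\<ge>N. \<forall>k. f (S n) k - f (S N) k \<in> F j" for j
    proof -
      obtain N where N: "\<forall>n\<ge>N. S n - S N \<in> path_filt j" using cauchy by blast
      have "f (S n) k - f (S N) k \<in> F j" if "n \<ge> N" for n k
        using N that f unfolding path_filt_def by (auto simp: case_prod_beta)
      then show ?thesis by blast
    qed
    have "\<exists>x\<in>F 0. tends (\<lambda>n. f (S n) k) x" for k
      by (rule complete_tends) (use fS fc null_seqD in blast)+
    then obtain x where x: "\<And>k. x k \<in> F 0" "\<And>k. tends (\<lambda>n. f (S n) k) (x k)" by metis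
    have near: "\<forall>n\<ge>N. \<forall>k. f (S n) k - x k \<in> F j" if N: "\<forall>n\<ge>N. \<forall>k. f (S n) k - f (S N) k \<in> F j" for N j
    proof (intro allI impI)
      fix n k assume n: "n \<ge> N"
      have "tends (\<lambda>m. f (S n) k - f (S m) k) (f (S n) k - x k)" by (rule tends_diff[OF tends_const x(2)])
      moreover have "f (S n) k - f (S m) k \<in> F j" if "m \<ge> N" for m
        using F_diff[of "f (S n) k - f (S N) k" j "f (S m) k - f (S N) k"] N n that by simp
      ultimately show "f (S n) k - x k \<in> F j" by (rule tends_closed)
    qed
    have "null_seq x"
      unfolding null_seq_def
    proof (intro conjI allI x(1))
      fix j
      obtain N where N: "\<forall>n\<ge>N. \<forall>k. f (S n) k - f (S N) k \<in> F j" using fc by blast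
      obtain M where M: "\<forall>k\<ge>M. f (S N) k \<in> F j" using fS[of N] unfolding null_seq_def by blast
      have "x k \<in> F j" if "k \<ge> M" for k
        using F_diff[of "f (S N) k" j "f (S N) k - x k"] near[OF N] M that by simp
      then show "\<exists>N. \<forall>k\<ge>N. x k \<in> F j" by blast
    qed
    then show ?thesis using near by blast
  qed
  obtain x y where x: "null_seq x"
      "\<And>j N. (\<forall>n\<ge>N. \<forall>k. fst (S n) k - fst (S N) k \<in> F j) \<Longrightarrow> (\<forall>n\<ge>N. \<forall>k. fst (S n) k - x k \<in> F j)"
    and y: "null_seq y"
      "\<And>j N. (\<forall>n\<ge>N. \<forall>k. snd (S n) k - snd (S N) k \<in> F j) \<Longrightarrow> (\<forall>n\<ge>N. \<forall>k. snd (S n) k - y k \<in> F j)"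
    using comp[of fst] comp[of snd] by blast
  have Sn: "null_seq (fst (S n))" "null_seq (snd (S n))" for n
    using S[of n] by (auto simp: path_filt_def case_prod_beta)
  have "\<exists>N. \<forall>n\<ge>N. S n - (x, y) \<in> path_filt j" for j
  proof -
    obtain N where N: "\<forall>n\<ge>N. S n - S N \<in> path_filt j" using cauchy by blast
    then have "\<forall>n\<ge>N. \<forall>k. fst (S n) k - fst (S N) k \<in> F j" "\<forall>n\<ge>N. \<forall>k. snd (S n) k - snd (S N) k \<in> F j"
      by (auto simp: path_filt_def case_prod_beta)
    then have "\<forall>n\<ge>N. S n - (x, y) \<in> path_filt j"
      using x y Sn by (auto simp: path_filt_def case_prod_beta fun_diff_def intro: null_seq_diff)
    then show ?thesis by blast
  qed
  then show ?thesis using x(1) y(1) path_filt_0 by blast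
qed

lemma null_seq_PD: "null_seq a \<Longrightarrow> null_seq b \<Longrightarrow> null_seq (\<lambda>k. D (b k) + sc (real (Suc k)) (sg (a (Suc k))))"
  by (intro null_seq_add null_seq_scaled null_seq_map[of "\<lambda>k. a (Suc k)" sg] null_seq_map[of b D] null_seq_shift)
    (auto simp: D_F sg_F)

sublocale path: gauge_algebra Psc Psg PD Pbr path_filt
proof (unfold_locales, goal_cases)
  case (1 a x y) then show ?case by (cases x; cases y) (auto simp: path_simps scale_right_distrib)
next
  case (2 a b x) then show ?case by (cases x) (auto simp: path_simps scale_left_distrib)
next
  case (3 a b x) then show ?case by (cases x) (auto simp: path_simps)
next
  case (4 x) then show ?case by (cases x) (auto simp: path_simps)
next
  case 5 then show ?case by (auto simp: path_filt_def zero_prod_def null_seq_zero zero_fun_def F_zero)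
next
  case 6 then show ?case by (auto simp: path_filt_def plus_fun_def null_seq_add F_add)
next
  case 7 then show ?case by (auto simp: path_filt_def path_simps null_seq_scaled F_scale)
next
  case 8 then show ?case using F_Suc by (auto simp: path_filt_def)
next
  case (9 x)
  obtain a b where x: "x = (a, b)" by fastforce
  have "a k = 0 \<and> b k = 0" for k using 9 separated by (auto simp: x path_filt_def)
  then show ?case by (auto simp: x zero_prod_def)
next
  case (10 S) then show ?case by (rule path_complete)
next
  case (11 x y) then show ?case by (cases x; cases y) (auto simp: path_simps sg_add)
next
  case (12 c x) then show ?case by (cases x) (auto simp: path_simps sg_scale)
next
  case (13 x j)
  then obtain a b where x: "x = (a, b)" "null_seq a" "null_seq b" "\<And>k. a k \<in> F j" "\<And>k. b k \<in> F j"
    by (auto simp: path_filt_def)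
  then show ?case unfolding x(1) path_simps
    by (intro path_filtI null_seq_map[of a sg] null_seq_map[of b "\<lambda>x. - sg x"]) (auto simp: sg_F F_minus)
next
  case (14 x) then show ?case by (auto simp: path_filt_def path_simps sg_sg sg_minus)
next
  case (15 x y) then show ?case by (cases x; cases y) (auto simp: path_simps sg_add D_add scale_right_distrib simp del: of_nat_Suc)
next
  case (16 c x) then show ?case by (cases x) (auto simp: path_simps D_scale sg_scale scale_right_distrib mult.commute simp del: of_nat_Suc)
next
  case (17 x j)
  then obtain a b where x: "x = (a, b)" "null_seq a" "null_seq b" "\<And>k. a k \<in> F j" "\<And>k. b k \<in> F j"
    by (auto simp: path_filt_def)
  then show ?case unfolding x(1) path_simps
    by (intro path_filtI null_seq_map[of a D] null_seq_PD F_add F_scale) (auto simp: sg_F D_F)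
next
  case (18 x) then show ?case
    by (auto simp: path_filt_def path_simps D_D sg_D D_add D_scale zero_prod_def fun_eq_iff simp del: of_nat_Suc)
next
  case (19 x) then show ?case
    by (auto simp: path_filt_def path_simps sg_D sg_add D_minus sg_scale sg_sg fun_eq_iff simp del: of_nat_Suc)
next
  case (20 x y z) then show ?case
    by (cases x; cases y; cases z) (auto simp: path_simps plus_fun_def fun_eq_iff conv_linear)
next
  case (21 x y z) then show ?case
    by (cases x; cases y; cases z) (auto simp: path_simps plus_fun_def fun_eq_iff conv_linear sg_add)
next
  case (22 c x y) then show ?case
    by (cases x; cases y) (auto simp: path_simps fun_eq_iff conv_linear scale_right_diff_distrib)
next
  case (23 x c y) then show ?case
    by (cases x; cases y) (auto simp: path_simps fun_eq_iff conv_linear scale_right_diff_distrib sg_scale)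
next
  case (24 x j y)
  then obtain a b c e where x: "x = (a, b)" "y = (c, e)" and n: "null_seq a" "null_seq b" "null_seq c" "null_seq e"
    and F: "\<And>k. a k \<in> F j" "\<And>k. b k \<in> F j"
    by (auto simp: path_filt_def)
  show ?case unfolding x path_simps
    by (intro path_filtI null_seq_diff null_seq_conv[of a] null_seq_conv[of b] null_seq_map[of c sg] F_diff conv_F n F)
      (use n null_seqD in \<open>auto simp: sg_F\<close>)
next
  case (25 x y j)
  then obtain a b c e where x: "x = (a, b)" "y = (c, e)" and n: "null_seq a" "null_seq b" "null_seq c" "null_seq e"
    and F: "\<And>k. c k \<in> F j" "\<And>k. e k \<in> F j"
    by (auto simp: path_filt_def)
  show ?case unfolding x path_simps
    by (intro path_filtI null_seq_diff null_seq_conv[of a] null_seq_conv[of b] null_seq_map[of c sg] F_diff conv_F' n F)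
      (use n F null_seqD in \<open>auto simp: sg_F\<close>)
next
  case (26 x y)
  then show ?case
    by (auto simp: path_filt_def path_simps fun_eq_iff sg_conv sg_diff conv_linear sg_F)
next
  case (27 x y)
  then obtain a b c e where x: "x = (a, b)" "y = (c, e)"
    and n: "\<And>k. a k \<in> F 0" "\<And>k. b k \<in> F 0" "\<And>k. c k \<in> F 0" "\<And>k. e k \<in> F 0"
    by (auto simp: path_filt_def)
  have s': "sg (a k) = a k" "- sg (b k) = b k" "sg (c k) = c k" "- sg (e k) = e k" for k
    using 27 unfolding x path_simps by (auto simp: fun_eq_iff)
  then have s: "sg (a k) = a k" "sg (b k) = - b k" "sg (c k) = c k" "sg (e k) = - e k" for k
    by (metis minus_minus)+
  have "conv br c a = conv br a c" using conv_sym n s by (auto simp: fun_eq_iff)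
  moreover have "conv br c b k = - conv br b c k" "conv br a e k = - conv br e a k" for k
    using conv_antisym n s by auto
  ultimately show ?case unfolding x path_simps s by (simp add: fun_eq_iff)
next
  case (28 x y)
  then obtain a b c e where x: "x = (a, b)" "y = (c, e)"
    and n: "\<And>k. a k \<in> F 0" "\<And>k. b k \<in> F 0" "\<And>k. c k \<in> F 0" "\<And>k. e k \<in> F 0"
    by (auto simp: path_filt_def)
  \<comment> \<open>The contribution of d/dt to the derivation property. The coefficientwise
    contribution of \<open>D\<close> is \<open>D_conv\<close>.\<close>
  have "sc (real (Suc k)) (sg (conv br a c (Suc k))) =
     - conv br (\<lambda>k. sc (real (Suc k)) (sg (a (Suc k)))) (\<lambda>k. sg (c k)) k
     - conv br (\<lambda>k. sg (a k)) (\<lambda>k. sc (real (Suc k)) (sg (c (Suc k)))) k" for k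
    using conv_Suc_deriv[of k "\<lambda>k. sg (a k)" "\<lambda>k. sg (c k)"] n by (simp add: sg_conv del: of_nat_Suc)
  then show ?case unfolding x path_simps using n
    by (simp add: fun_eq_iff D_conv conv_linear D_diff sg_F sg_sg sg_D del: of_nat_Suc)
next
  case (29 x y z)
  then obtain a b c e u v where x: "x = (a, b)" "y = (c, e)" "z = (u, v)"
    and n: "\<And>k. a k \<in> F 0" "\<And>k. b k \<in> F 0" "\<And>k. c k \<in> F 0" "\<And>k. e k \<in> F 0" "\<And>k. u k \<in> F 0" "\<And>k. v k \<in> F 0"
    by (auto simp: path_filt_def)
  have s': "sg (a k) = a k" "- sg (b k) = b k" for k
    using 29 unfolding x path_simps by (auto simp: fun_eq_iff)
  then have s: "sg (a k) = a k" "sg (b k) = - b k" for k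
    by (metis minus_minus)+
  note J = conv_jacobi_even[of a c u] conv_jacobi_even[of a c v] conv_jacobi_even[of a e "\<lambda>k. sg (u k)"]
    conv_jacobi_odd[of b "\<lambda>k. sg (c k)" "\<lambda>k. sg (u k)"]
  show ?case unfolding x path_simps using n s
    by (simp add: fun_eq_iff conv_linear sg_conv J sg_F sg_sg)
qed

section \<open>Evaluation at the end points and the homotopy relation\<close>

definition ev0 :: "(nat \<Rightarrow> 'g) \<times> (nat \<Rightarrow> 'g) \<Rightarrow> 'g" where
  "ev0 H = fst H 0"

definition ev1 :: "(nat \<Rightarrow> 'g) \<times> (nat \<Rightarrow> 'g) \<Rightarrow> 'g" where
  "ev1 H = total (fst H)"

lemma ev1_eq: "has_total (fst H) x \<Longrightarrow> ev1 H = x"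
  unfolding ev1_def by (rule total_eq)

lemma has_total_ev1: "H \<in> path_filt 0 \<Longrightarrow> has_total (fst H) (ev1 H)"
  unfolding ev1_def by (rule has_total) (auto simp: path_filt_def)

sublocale ev0: gauge_morphism Psc Psg PD Pbr path_filt sc sg D br F ev0
proof (unfold_locales, goal_cases)
  case (6 x y) then show ?case
    by (cases x; cases y) (auto simp: ev0_def path_simps conv_def)
qed (auto simp: ev0_def path_filt_def path_simps)

sublocale ev1: gauge_morphism Psc Psg PD Pbr path_filt sc sg D br F ev1
proof (unfold_locales, goal_cases)
  case (1 x j)
  then have "has_total (fst x) (ev1 x)" "fst x k \<in> F j" for k
    using has_total_ev1 path.F_0 by (auto simp: path_filt_def)
  then show ?case by (rule has_total_F)
next
  case (2 x y) then show ?case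
    using has_total_add[OF has_total_ev1[of x] has_total_ev1[of y]] by (intro ev1_eq) (simp add: plus_fun_def)
next
  case (3 x c) then show ?case
    using has_total_scale[OF has_total_ev1[of x]] by (intro ev1_eq) (cases x, simp add: path_simps)
next
  case (4 x) then show ?case
    using has_total_map[OF has_total_ev1[of x], of D] by (intro ev1_eq) (cases x, simp add: path_simps D_add D_F)
next
  case (5 x) then show ?case
    using has_total_map[OF has_total_ev1[of x], of sg] by (intro ev1_eq) (cases x, simp add: path_simps sg_add sg_F)
next
  case (6 x y) then show ?case
    using has_total_conv[OF _ _ has_total_ev1[of x] has_total_ev1[of y]]
    by (intro ev1_eq) (cases x; cases y, simp add: path_simps path_filt_0)
qed

lemma MC_eq: "MC \<gg> = mc"
  unfolding MC_def mc_def gspace by (auto simp: zero_fun_def)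

lemma MC_path: "MC (path_dgla \<gg>) = path.mc"
  unfolding MC_def path.mc_def gspace_path by auto

lemma tends_Suc: "tends S x \<longleftrightarrow> (\<forall>j\<ge>1. \<exists>N. \<forall>n\<ge>N. S n - x \<in> F j)"
  unfolding tends_def using F_0 by (metis less_one not_less)

lemma evaluates_to_0: "evaluates_to \<gg> H 0 x \<longleftrightarrow> x = ev0 H"
proof -
  have "(\<Sum>k<n. sc (0 ^ k) (fst H k)) = (\<Sum>k<n. if k = 0 then ev0 H else 0)" for n
    by (intro sum.cong) (auto simp: ev0_def)
  then have "evaluates_to \<gg> H 0 x \<longleftrightarrow> has_total (\<lambda>k. if k = 0 then ev0 H else 0) x"
    unfolding evaluates_to_def has_total_def tends_Suc by simp
  also have "\<dots> \<longleftrightarrow> x = ev0 H"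
    using has_total_single[of 0 "ev0 H"] tends_unique unfolding has_total_def by blast
  finally show ?thesis .
qed

lemma evaluates_to_1: "H \<in> path_filt 0 \<Longrightarrow> evaluates_to \<gg> H 1 x \<longleftrightarrow> x = ev1 H"
proof -
  assume "H \<in> path_filt 0"
  then have "has_total (fst H) (ev1 H)" by (rule has_total_ev1)
  moreover have "evaluates_to \<gg> H 1 x \<longleftrightarrow> has_total (fst H) x"
    unfolding evaluates_to_def has_total_def tends_Suc by simp
  ultimately show ?thesis using tends_unique unfolding has_total_def by blast
qed

text \<open>Both evaluations are morphisms, so the end points of a Maurer-Cartan path are
  Maurer-Cartan elements automatically.\<close>

lemma homotopy_rel_eq: "homotopy_rel \<gg> = {(ev0 H, ev1 H) | H. H \<in> path.mc}"
proof -
  have "H \<in> path_filt 0" if "H \<in> path.mc" for H using that by (simp add: path.mc_def)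
  then show ?thesis
    unfolding homotopy_rel_def MC_eq MC_path
    using ev0.map_mc ev1.map_mc by (auto simp: evaluates_to_0 evaluates_to_1)
qed

lemma homotopy_relI: "H \<in> path.mc \<Longrightarrow> ev0 H = x \<Longrightarrow> ev1 H = y \<Longrightarrow> (x, y) \<in> homotopy_rel \<gg>"
  unfolding homotopy_rel_eq by blast

definition const_path :: "'g \<Rightarrow> (nat \<Rightarrow> 'g) \<times> (nat \<Rightarrow> 'g)" where
  "const_path x = (\<lambda>k. if k = 0 then x else 0, \<lambda>_. 0)"

lemma const_path_F: "x \<in> F 0 \<Longrightarrow> const_path x \<in> path_filt 0"
  unfolding const_path_def path_filt_0 using null_seq_single null_seq_zero by auto

lemma ev_const_path [simp]: "ev0 (const_path x) = x" "ev1 (const_path x) = x"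
  using ev1_eq[of "const_path x" x] has_total_single[of 0 x] by (auto simp: const_path_def ev0_def)

text \<open>The path is a(t) + b dt with a(t) the flow and \<open>b\<close> constant in t. Its
  Maurer-Cartan equation splits into the vanishing of the curvature of a(t) and, in the dt
  component, a' + D b + [a, b] = 0, the flow equation itself.\<close>

lemma gauge_homotopic:
  assumes b: "b \<in> F 0" "sg b = - b" and m: "m \<in> mc"
  shows "(m, gauge b m) \<in> homotopy_rel \<gg>"
proof (rule homotopy_relI)
  let ?d = "\<lambda>k. if k = 0 then b else 0"
  let ?H = "(flow b m, ?d)"
  have m': "m \<in> F 0" "sg m = m" using m by (auto simp: mc_def)
  have fF: "flow b m k \<in> F 0" and fe: "sg (flow b m k) = flow b m k" for k
    using flow_F0 flow_even b m' by auto
  have H: "?H \<in> path_filt 0" unfolding path_filt_0 using null_seq_flow null_seq_single b m' by auto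
  have c: "conv br ?d (flow b m) k = - br (flow b m k) b" for k
    unfolding conv_single_left using br_antisym[of b "flow b m k"] b fF by simp
  have *: "D (?d k) + sc (real (Suc k)) (flow b m (Suc k)) + br (flow b m k) b = 0" for k
    by (simp add: scale_right_distrib)
  have "sc (1 / 2) (br (flow b m k) b + br (flow b m k) b) = br (flow b m k) b" for k
    by (rule half_double)
  then have "PD ?H + Psc (1 / 2) (Pbr ?H ?H) = 0"
    unfolding path_simps fe c conv_single_right using flow_curvature[OF b m] *
    by (simp add: zero_prod_def fun_eq_iff del: flow.simps of_nat_Suc)
  then show "?H \<in> path.mc" using H b unfolding path.mc_def
    by (auto simp: path_simps fe fun_eq_iff)
  show "ev1 ?H = gauge b m" by (simp add: ev1_def gauge_def)
qed (simp add: ev0_def)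

text \<open>Integration of the dt component from 0 to t. The sign \<open>sg\<close> matches the one
  that \<open>PD\<close> attaches to d/dt.\<close>

definition path_integral :: "(nat \<Rightarrow> 'g) \<times> (nat \<Rightarrow> 'g) \<Rightarrow> (nat \<Rightarrow> 'g) \<times> (nat \<Rightarrow> 'g)" where
  "path_integral H = (\<lambda>k. case k of 0 \<Rightarrow> 0 | Suc l \<Rightarrow> sc (1 / real k) (sg (snd H l)), \<lambda>_. 0)"

lemma ev0_path_integral [simp]: "ev0 (path_integral H) = 0"
  by (simp add: ev0_def path_integral_def)

text \<open>The Poincare lemma on the interval: by the fundamental theorem of calculus the
  projection sends a path to the constant path at its value for t = 0.\<close>

sublocale integral: gauge_contraction Psc Psg PD Pbr path_filt path_integral "const_path ` F 0"
proof (unfold_locales, goal_cases)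
  case (1 x y) then show ?case
    by (auto simp: path_integral_def sg_add scale_right_distrib fun_eq_iff split: nat.splits)
next
  case (2 c x) then show ?case
    by (cases x) (auto simp: path_integral_def path_simps sg_scale fun_eq_iff mult.commute split: nat.splits)
next
  case (3 x j)
  have 1: "null_seq (\<lambda>k. sc (1 / real (Suc k)) (sg (snd x k)))"
    using 3 by (intro null_seq_scaled null_seq_map[of _ sg]) (auto simp: path_filt_def sg_F)
  have "null_seq (fst (path_integral x))"
    unfolding null_seq_def
  proof (intro conjI allI)
    show "fst (path_integral x) k \<in> F 0" for k
      using null_seqD[OF 1] by (auto simp: path_integral_def F_zero simp del: of_nat_Suc split: nat.splits)
    fix i
    obtain N where N: "\<forall>k\<ge>N. sc (1 / real (Suc k)) (sg (snd x k)) \<in> F i" using 1 unfolding null_seq_def by blast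
    have "\<forall>k\<ge>Suc N. fst (path_integral x) k \<in> F i"
      using N by (auto simp: path_integral_def simp del: of_nat_Suc split: nat.splits)
    then show "\<exists>N. \<forall>k\<ge>N. fst (path_integral x) k \<in> F i" by blast
  qed
  then show ?case using 3 null_seq_zero F_zero
    by (auto simp: path_filt_def path_integral_def F_scale sg_F split: nat.splits)
next
  case (4 x) then show ?case
    by (auto simp: path_integral_def path_simps path_filt_def fun_eq_iff sg_scale sg_minus split: nat.splits)
next
  case (5 x) then show ?case by (simp add: path_integral_def zero_prod_def fun_eq_iff split: nat.splits)
next
  case (6 x) then show ?case by (auto simp: path_integral_def const_path_def zero_prod_def fun_eq_iff split: nat.splits)
next
  case 7 then show ?case using const_path_F by blast
next
  case (8 x) then show ?case
    by (auto simp: path_integral_def const_path_def path_simps conv_zero zero_prod_def fun_eq_iff split: nat.splits)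
next
  case (9 x)
  then obtain a b where x: "x = (a, b)" "\<And>k. a k \<in> F 0" "\<And>k. b k \<in> F 0" by (auto simp: path_filt_def)
  have "x - PD (path_integral x) - path_integral (PD x) = const_path (a 0)"
    using x by (auto simp: path_simps path_integral_def const_path_def fun_eq_iff sg_add sg_scale sg_sg sg_D D_scale
        scale_right_distrib scale_right_diff_distrib F_scale sg_F split: nat.splits)
  then show ?case using x by auto
qed

text \<open>Gauge fixing makes the path constant. The parameter is an integral starting at t = 0, so
  it vanishes there and the constant is \<open>x\<close>; at t = 1 its value transforms
  \<open>y\<close> into that same constant.\<close>

lemma homotopic_gauge:
  assumes "(x, y) \<in> homotopy_rel \<gg>"
  obtains b where "b \<in> F 0" "sg b = - b" "gauge b y = x"
proof -
  obtain H where H: "H \<in> path.mc" "ev0 H = x" "ev1 H = y" using assms unfolding homotopy_rel_eq by blast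
  then have HF: "H \<in> path_filt 0" by (simp add: path.mc_def)
  obtain B U where B: "B \<in> path_filt 0" "Psg B = - B" "B = path_integral U" "path.gauge B H \<in> const_path ` F 0"
    using integral.gauge_fixing[OF H(1)] by metis
  obtain c where c: "path.gauge B H = const_path c" using B by blast
  have "gauge (ev0 B) x = c" using ev0.map_gauge[OF B(1) HF] c H by simp
  then have "c = x" using B by (simp add: gauge_zero)
  then have "gauge (ev1 B) y = x" using ev1.map_gauge[OF B(1) HF] c H by simp
  moreover have "ev1 B \<in> F 0" "sg (ev1 B) = - ev1 B"
    using ev1.map_F[OF B(1)] ev1.map_sg[OF B(1)] ev1.map_minus[OF B(1)] B(2) by auto
  ultimately show ?thesis using that by blast
qed

lemma homotopy_rel_mc: "(x, y) \<in> homotopy_rel \<gg> \<Longrightarrow> x \<in> mc \<and> y \<in> mc"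
  unfolding homotopy_rel_def MC_eq by auto

text \<open>A homotopy from \<open>x\<close> to \<open>y\<close> yields a gauge transformation in
  the opposite direction, and its flow is a homotopy from \<open>y\<close> to
  \<open>x\<close>.\<close>

lemma homotopy_rel_sym: "(x, y) \<in> homotopy_rel \<gg> \<Longrightarrow> (y, x) \<in> homotopy_rel \<gg>"
  by (metis homotopic_gauge gauge_homotopic homotopy_rel_mc)

lemma homotopy_rel_refl: "x \<in> mc \<Longrightarrow> (x, x) \<in> homotopy_rel \<gg>"
  using gauge_homotopic[of 0 x] by (simp add: F_zero gauge_zero)

text \<open>Acting on a path with the gauge parameter \<open>t b\<close> moves its end point only.\<close>

lemma homotopy_rel_trans:
  assumes "(x, y) \<in> homotopy_rel \<gg>" "(y, z) \<in> homotopy_rel \<gg>" shows "(x, z) \<in> homotopy_rel \<gg>"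
proof -
  obtain b where b: "b \<in> F 0" "sg b = - b" "gauge b y = z"
    using homotopic_gauge[OF homotopy_rel_sym[OF assms(2)]] by blast
  obtain H where H: "H \<in> path.mc" "ev0 H = x" "ev1 H = y" using assms unfolding homotopy_rel_eq by blast
  then have HF: "H \<in> path_filt 0" by (simp add: path.mc_def)
  define B where "B = (\<lambda>k::nat. if k = 1 then b else 0, \<lambda>_::nat. 0 :: 'g)"
  have B: "B \<in> path_filt 0" unfolding B_def path_filt_0 using null_seq_single null_seq_zero b by auto
  have Bo: "Psg B = - B" using b by (auto simp: B_def path_simps fun_eq_iff)
  have "ev0 B = 0" "ev1 B = b"
    using ev1_eq[of B b] has_total_single[of 1 b] by (auto simp: B_def ev0_def)
  then have "ev0 (path.gauge B H) = x" "ev1 (path.gauge B H) = z"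
    using ev0.map_gauge[OF B HF] ev1.map_gauge[OF B HF] H b by (auto simp: gauge_zero)
  with path.gauge_mc[OF B Bo H(1)] show ?thesis by (rule homotopy_relI)
qed

lemma equiv_homotopy_rel: "equiv mc (homotopy_rel \<gg>)"
  by (rule equivI) (auto intro!: refl_onI symI transI dest: homotopy_rel_mc
      intro: homotopy_rel_refl homotopy_rel_sym homotopy_rel_trans)

lemma equiv_gr_homologous: "equiv (gr_cycles \<gg> j) (gr_homologous \<gg> j)"
proof -
  have z: "0 \<in> gr_boundaries \<gg> j" unfolding gr_boundaries_def using F_zero by force
  have add: "u + v \<in> gr_boundaries \<gg> j" if uv: "u \<in> gr_boundaries \<gg> j" "v \<in> gr_boundaries \<gg> j" for u v
  proof -
    obtain x y x' y' where *: "u = D x + y" "x \<in> F j" "y \<in> F (Suc j)" "v = D x' + y'" "x' \<in> F j" "y' \<in> F (Suc j)"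
      using uv unfolding gr_boundaries_def by blast
    then have "u + v = D (x + x') + (y + y')" by (simp add: D_add)
    then show ?thesis unfolding gr_boundaries_def using * F_add by blast
  qed
  have neg: "- u \<in> gr_boundaries \<gg> j" if uv: "u \<in> gr_boundaries \<gg> j" for u
  proof -
    obtain x y where *: "u = D x + y" "x \<in> F j" "y \<in> F (Suc j)"
      using uv unfolding gr_boundaries_def by auto
    then have "- u = D (- x) + (- y)" by (simp add: D_minus)
    then show ?thesis unfolding gr_boundaries_def using * F_minus by blast
  qed
  show ?thesis
  proof (rule equivI)
    show "gr_homologous \<gg> j \<subseteq> gr_cycles \<gg> j \<times> gr_cycles \<gg> j" by (auto simp: gr_homologous_def)
    show "refl_on (gr_cycles \<gg> j) (gr_homologous \<gg> j)" using z by (auto simp: gr_homologous_def refl_on_def)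
    show "sym (gr_homologous \<gg> j)" using neg by (fastforce simp: gr_homologous_def sym_def)
    show "trans (gr_homologous \<gg> j)" using add by (fastforce simp: gr_homologous_def trans_def)
  qed
qed

end

section \<open>Contractions onto a subalgebra\<close>

text \<open>\<open>reflects\<close> is strictness of \<iota> with respect to the filtrations. It
  returns convergence of coefficients from \<open>\<gg>\<close> to \<open>\<hh>\<close>, and lifts
  projected elements of \<open>\<gg>\<close> without loss of filtration degree.\<close>

locale dgla_retract = H: odd_dgla \<hh> + G: odd_dgla \<gg>
  for \<hh> :: "'h::ab_group_add filtered_dgla" and \<gg> :: "'g::ab_group_add filtered_dgla" +
  fixes \<iota> :: "'h \<Rightarrow> 'g" and K :: "'g \<Rightarrow> 'g"
  assumes gauge_morphism: "gauge_morphism (gscale \<hh>) (gsign \<hh>) (gdiff \<hh>) (gbracket \<hh>) (gfilt \<hh>)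
      (gscale \<gg>) (gsign \<gg>) (gdiff \<gg>) (gbracket \<gg>) (gfilt \<gg>) \<iota>"
    and inj: "x \<in> gfilt \<hh> 0 \<Longrightarrow> \<iota> x = 0 \<Longrightarrow> x = 0"
    and reflects: "x \<in> gfilt \<hh> 0 \<Longrightarrow> \<iota> x \<in> gfilt \<gg> j \<Longrightarrow> x \<in> gfilt \<hh> j"
    and K_add: "K (u + v) = K u + K v" and K_scale: "K (gscale \<gg> c u) = gscale \<gg> c (K u)"
    and K_F: "u \<in> gfilt \<gg> j \<Longrightarrow> K u \<in> gfilt \<gg> j"
    and sg_K: "u \<in> gfilt \<gg> 0 \<Longrightarrow> gsign \<gg> (K u) = - K (gsign \<gg> u)"
    and K_K: "u \<in> gfilt \<gg> 0 \<Longrightarrow> K (K u) = 0"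
    and K_\<iota>: "y \<in> gfilt \<hh> 0 \<Longrightarrow> K (\<iota> y) = 0"
    and proj: "u \<in> gfilt \<gg> 0 \<Longrightarrow> u - gdiff \<gg> (K u) - K (gdiff \<gg> u) \<in> \<iota> ` gfilt \<hh> 0"
begin

sublocale emb: gauge_morphism H.sc H.sg H.D H.br H.F G.sc G.sg G.D G.br G.F \<iota>
  by (rule gauge_morphism)

lemma inj': "x \<in> H.F 0 \<Longrightarrow> y \<in> H.F 0 \<Longrightarrow> \<iota> x = \<iota> y \<Longrightarrow> x = y"
  using inj[of "x - y"] emb.map_diff H.F_diff by simp

sublocale gauge_contraction G.sc G.sg G.D G.br G.F K "\<iota> ` H.F 0"
proof (unfold_locales, goal_cases)
  case (8 x) then show ?case using K_\<iota> H.br_F by (auto simp: emb.map_br[symmetric])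
qed (auto simp: K_add K_scale K_F sg_K K_K K_\<iota> proj emb.map_F)

section \<open>Paths in the subalgebra\<close>

definition path_map :: "(nat \<Rightarrow> 'h) \<times> (nat \<Rightarrow> 'h) \<Rightarrow> (nat \<Rightarrow> 'g) \<times> (nat \<Rightarrow> 'g)" where
  "path_map H = (\<lambda>k. \<iota> (fst H k), \<lambda>k. \<iota> (snd H k))"

lemma null_seq_\<iota>: "H.null_seq a \<Longrightarrow> G.null_seq (\<lambda>k. \<iota> (a k))"
  unfolding H.null_seq_def G.null_seq_def using emb.map_F by meson

lemma map_conv:
  "(\<And>k. a k \<in> H.F 0) \<Longrightarrow> (\<And>k. c k \<in> H.F 0) \<Longrightarrow>
    \<iota> (conv H.br a c k) = conv G.br (\<lambda>k. \<iota> (a k)) (\<lambda>k. \<iota> (c k)) k"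
proof -
  assume a: "\<And>k. a k \<in> H.F 0" "\<And>k. c k \<in> H.F 0"
  have "\<iota> (sum f I) = (\<Sum>l\<in>I. \<iota> (f l))" if "\<And>l. f l \<in> H.F 0" for f and I :: "nat set"
    by (induction I rule: infinite_finite_induct)
      (use that in \<open>auto simp: emb.map_zero emb.map_add H.F_sum\<close>)
  then show ?thesis unfolding conv_def using a by (simp add: emb.map_br H.br_F)
qed

sublocale path: gauge_morphism H.Psc H.Psg H.PD H.Pbr H.path_filt G.Psc G.Psg G.PD G.Pbr G.path_filt path_map
proof (unfold_locales, goal_cases)
  case 1 then show ?case by (auto simp: H.path_filt_def G.path_filt_def path_map_def null_seq_\<iota> emb.map_F)
next
  case 2 then show ?case by (auto simp: H.path_filt_def path_map_def emb.map_add fun_eq_iff)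
next
  case 3 then show ?case by (auto simp: H.path_filt_def path_map_def H.path_simps G.path_simps emb.map_scale)
next
  case 4 then show ?case
    by (auto simp: H.path_filt_def path_map_def H.path_simps G.path_simps emb.map_scale emb.map_add emb.map_D
        emb.map_sg H.sg_F H.D_F H.F_scale simp del: of_nat_Suc)
next
  case 5 then show ?case
    by (auto simp: H.path_filt_def path_map_def H.path_simps G.path_simps emb.map_sg emb.map_minus H.sg_F)
next
  case (6 x y)
  then obtain a b c e where x: "x = (a, b)" "y = (c, e)"
    and n: "\<And>k. a k \<in> H.F 0" "\<And>k. b k \<in> H.F 0" "\<And>k. c k \<in> H.F 0" "\<And>k. e k \<in> H.F 0"
    by (auto simp: H.path_filt_def)
  show ?case unfolding x path_map_def H.path_simps fst_conv snd_conv G.path_simps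
    using n H.F_0[OF H.conv_F[of _ 0]]
    by (auto simp: fun_eq_iff map_conv emb.map_diff H.sg_F emb.map_sg)
qed

lemma ev_path_map:
  assumes "H \<in> H.path_filt 0"
  shows "G.ev0 (path_map H) = \<iota> (H.ev0 H)" "G.ev1 (path_map H) = \<iota> (H.ev1 H)"
proof -
  show "G.ev0 (path_map H) = \<iota> (H.ev0 H)" by (simp add: G.ev0_def H.ev0_def path_map_def)
  have a: "fst H k \<in> H.F 0" for k using assms by (auto simp: H.path_filt_def)
  have s: "(\<Sum>k<n. fst H k) \<in> H.F 0" for n using a by (rule H.F_sum)
  have *: "\<iota> (\<Sum>k<n. fst H k) = (\<Sum>k<n. \<iota> (fst H k))" for n
    by (induction n) (auto simp: emb.map_zero emb.map_add s a)
  have "H.ev1 H \<in> H.F 0" using H.ev1.map_F[OF assms] .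
  then have "G.has_total (fst (path_map H)) (\<iota> (H.ev1 H))"
    unfolding path_map_def fst_conv G.has_total_def G.tends_def *[symmetric]
    using H.has_total_ev1[OF assms] unfolding H.has_total_def H.tends_def
    by (metis emb.map_diff emb.map_F s)
  then show "G.ev1 (path_map H) = \<iota> (H.ev1 H)" by (rule G.ev1_eq)
qed

lemma homotopy_rel_map:
  "(x, y) \<in> homotopy_rel \<hh> \<Longrightarrow> (\<iota> x, \<iota> y) \<in> homotopy_rel \<gg>"
  unfolding H.homotopy_rel_eq G.homotopy_rel_eq
  using path.map_mc ev_path_map H.path.mc_def by (smt (verit, best) mem_Collect_eq prod.inject)

definition path_contraction :: "(nat \<Rightarrow> 'g) \<times> (nat \<Rightarrow> 'g) \<Rightarrow> (nat \<Rightarrow> 'g) \<times> (nat \<Rightarrow> 'g)" where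
  "path_contraction X = (\<lambda>k. K (fst X k), \<lambda>k. K (snd X k))"

lemma null_seq_reflects:
  "G.null_seq (\<lambda>k. \<iota> (a k)) \<Longrightarrow> (\<And>k. a k \<in> H.F 0) \<Longrightarrow> H.null_seq a"
  unfolding H.null_seq_def G.null_seq_def using reflects by meson

lemma path_map_image:
  assumes "(a, b) \<in> G.path_filt 0" "\<And>k. a k \<in> \<iota> ` H.F 0" "\<And>k. b k \<in> \<iota> ` H.F 0"
  shows "(a, b) \<in> path_map ` H.path_filt 0"
proof -
  obtain a' b' where *: "\<And>k. a k = \<iota> (a' k)" "\<And>k. a' k \<in> H.F 0" "\<And>k. b k = \<iota> (b' k)" "\<And>k. b' k \<in> H.F 0"
    using assms(2,3) unfolding image_iff by metis
  have "G.null_seq (\<lambda>k. \<iota> (a' k))" "G.null_seq (\<lambda>k. \<iota> (b' k))"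
    using assms(1) unfolding G.path_filt_0 *(1,3)[symmetric] by auto
  then have "(a', b') \<in> H.path_filt 0" unfolding H.path_filt_0 using null_seq_reflects * by blast
  moreover have "(a, b) = path_map (a', b')" using * by (auto simp: path_map_def)
  ultimately show ?thesis by blast
qed

text \<open>Since \<open>K\<close> is odd, the two contributions of d/dt to the anticommutator
  cancel (\<open>sg_K\<close>), and the projection acts coefficient by coefficient.\<close>

sublocale path_K: gauge_contraction G.Psc G.Psg G.PD G.Pbr G.path_filt path_contraction "path_map ` H.path_filt 0"
proof (unfold_locales, goal_cases)
  case (3 x j) then show ?case
    by (auto simp: path_contraction_def G.path_filt_def K_F intro: G.null_seq_map)
next
  case (8 x)
  then obtain a b where x: "x = path_map (a, b)" "(a, b) \<in> H.path_filt 0" by auto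
  then have "G.Pbr x x = path_map (H.Pbr (a, b) (a, b))" by (simp add: path.map_br)
  moreover have "H.Pbr (a, b) (a, b) \<in> H.path_filt 0" using x H.path.br_F by blast
  ultimately show ?case
    by (auto simp: path_contraction_def path_map_def K_\<iota> H.path_filt_def zero_prod_def fun_eq_iff)
next
  case (9 x)
  then obtain a b where x: "x = (a, b)" "\<And>k. a k \<in> G.F 0" "\<And>k. b k \<in> G.F 0" by (auto simp: G.path_filt_def)
  have cF: "path_contraction x \<in> G.path_filt 0" if "x \<in> G.path_filt 0" for x
    using that by (auto simp: path_contraction_def G.path_filt_def K_F intro: G.null_seq_map)
  have eq: "x - G.PD (path_contraction x) - path_contraction (G.PD x) =
     (\<lambda>k. a k - G.D (K (a k)) - K (G.D (a k)), \<lambda>k. b k - G.D (K (b k)) - K (G.D (b k)))"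
    using x by (auto simp: G.path_simps path_contraction_def fun_eq_iff sg_K K_add K_scale simp del: of_nat_Suc)
  have "x - G.PD (path_contraction x) - path_contraction (G.PD x) \<in> G.path_filt 0"
    using 9 by (intro G.path.F_diff cF G.path.D_F)
  then show ?case unfolding eq using x proj by (intro path_map_image) auto
qed (auto simp: path_contraction_def G.path_filt_def path_map_def G.path_simps H.path_filt_def K_add K_scale
    sg_K K_K K_\<iota> K_minus fun_eq_iff zero_prod_def null_seq_\<iota> emb.map_F)

text \<open>Gauge fixing moves the homotopy into the paths of the subalgebra. The values of the
  parameter \<open>B\<close> at the end points lie in the image of \<open>K\<close> and transform
  elements of the subalgebra into elements on which \<open>K\<close> vanishes, so they are 0 by
  \<open>slice_unique\<close> and the end points stay. Injectivity of \<iota> then pulls back the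
  Maurer-Cartan equation.\<close>

lemma homotopy_rel_reflect:
  assumes x: "x \<in> H.F 0" and y: "y \<in> H.F 0" and xy: "(\<iota> x, \<iota> y) \<in> homotopy_rel \<gg>"
  shows "(x, y) \<in> homotopy_rel \<hh>"
proof -
  obtain H where H: "H \<in> G.path.mc" "G.ev0 H = \<iota> x" "G.ev1 H = \<iota> y"
    using xy unfolding G.homotopy_rel_eq by auto
  then have HF: "H \<in> G.path_filt 0" by (simp add: G.path.mc_def)
  obtain B U where B: "B \<in> G.path_filt 0" "G.Psg B = - B" "U \<in> G.path_filt 0" "B = path_contraction U"
      "G.path.gauge B H \<in> G.path.mc" "G.path.gauge B H \<in> path_map ` H.path_filt 0"
    using path_K.gauge_fixing[OF H(1)] by metis
  obtain Y where Y: "Y \<in> H.path_filt 0" "G.path.gauge B H = path_map Y" using B by blast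
  have "G.ev0 B = 0"
  proof (rule slice_unique)
    show "G.ev0 B \<in> G.F 0" "G.ev0 U \<in> G.F 0" using G.ev0.map_F B by auto
    show "G.sg (G.ev0 B) = - G.ev0 B" using G.ev0.map_sg[OF B(1)] G.ev0.map_minus[OF B(1)] B(2) by simp
    show "G.ev0 B = K (G.ev0 U)" using B(4) by (simp add: path_contraction_def G.ev0_def)
    show "K (G.gauge (G.ev0 B) (\<iota> x)) = 0"
      using G.ev0.map_gauge[OF B(1) HF] H Y ev_path_map(1)[OF Y(1)] K_\<iota>[OF H.ev0.map_F[OF Y(1)]] by metis
  qed (use x in auto)
  then have 0: "\<iota> (H.ev0 Y) = \<iota> x"
    using G.ev0.map_gauge[OF B(1) HF] H Y ev_path_map[OF Y(1)] by (simp add: G.gauge_zero)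
  have "G.ev1 B = 0"
  proof (rule slice_unique)
    show "G.ev1 B \<in> G.F 0" "G.ev1 U \<in> G.F 0" using G.ev1.map_F B by auto
    show "G.sg (G.ev1 B) = - G.ev1 B" using G.ev1.map_sg[OF B(1)] G.ev1.map_minus[OF B(1)] B(2) by simp
    show "G.ev1 B = K (G.ev1 U)"
      using G.has_total_map[OF G.has_total_ev1[OF B(3)], of K] K_add K_F B(4)
      by (intro G.ev1_eq) (simp add: path_contraction_def)
    show "K (G.gauge (G.ev1 B) (\<iota> y)) = 0"
      using G.ev1.map_gauge[OF B(1) HF] H Y ev_path_map(2)[OF Y(1)] K_\<iota>[OF H.ev1.map_F[OF Y(1)]] by metis
  qed (use y in auto)
  then have 1: "\<iota> (H.ev1 Y) = \<iota> y"
    using G.ev1.map_gauge[OF B(1) HF] H Y ev_path_map[OF Y(1)] by (simp add: G.gauge_zero)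
  have path_inj: "X = X'" if "X \<in> H.path_filt 0" "X' \<in> H.path_filt 0" "path_map X = path_map X'" for X X'
    using that inj' by (auto simp: H.path_filt_def path_map_def fun_eq_iff)
  have "path_map (H.Psg Y) = path_map Y"
    using B(5) Y path.map_sg[OF Y(1)] by (simp add: G.path.mc_def)
  then have sY: "H.Psg Y = Y" using path_inj H.path.sg_F Y by blast
  have "path_map (H.PD Y + H.Psc (1 / 2) (H.Pbr Y Y)) = path_map 0"
    using B(5) Y by (simp add: G.path.mc_def path.map_add path.map_scale path.map_D path.map_br path.map_zero
        H.path.D_F H.path.br_F H.path.F_scale)
  then have "H.PD Y + H.Psc (1 / 2) (H.Pbr Y Y) = 0"
    using path_inj Y by (meson H.path.F_add H.path.D_F H.path.F_scale H.path.br_F H.path.F_zero)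
  then have "Y \<in> H.path.mc" using sY Y by (simp add: H.path.mc_def)
  moreover have "H.ev0 Y = x" using 0 inj' x H.ev0.map_F[OF Y(1)] by blast
  moreover have "H.ev1 Y = y" using 1 inj' y H.ev1.map_F[OF Y(1)] by blast
  ultimately show ?thesis by (rule H.homotopy_relI)
qed

lemma homotopic_to_image:
  assumes "m \<in> G.mc" shows "\<exists>x\<in>H.mc. (m, \<iota> x) \<in> homotopy_rel \<gg>"
proof -
  obtain b where b: "b \<in> G.F 0" "G.sg b = - b" "G.gauge b m \<in> G.mc" "G.gauge b m \<in> \<iota> ` H.F 0"
    using gauge_fixing[OF assms] by metis
  obtain x where x: "x \<in> H.F 0" "G.gauge b m = \<iota> x" using b by blast
  have "\<iota> (H.sg x) = \<iota> x" "\<iota> (H.D x + H.sc (1 / 2) (H.br x x)) = \<iota> 0"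
    using b(3) x by (auto simp: G.mc_def emb.map_sg emb.map_add emb.map_scale emb.map_D emb.map_br emb.map_zero
        H.D_F H.br_F H.F_scale)
  then have "H.sg x = x" "H.D x + H.sc (1 / 2) (H.br x x) = 0"
    using inj' x by (meson H.F_add H.D_F H.F_scale H.br_F H.F_zero H.sg_F)+
  then have "x \<in> H.mc" using x by (simp add: H.mc_def)
  then show ?thesis using b x assms G.gauge_homotopic by metis
qed

text \<open>The map does not depend on the chosen representatives by
  \<open>homotopy_rel_map\<close>; it is injective by \<open>homotopy_rel_reflect\<close> and
  surjective by \<open>homotopic_to_image\<close>.\<close>

theorem MC_moduli_bij:
  "\<exists>\<Phi>. bij_betw \<Phi> (MC_moduli \<hh>) (MC_moduli \<gg>) \<and>
    (\<forall>\<xi>\<in>MC \<hh>. \<Phi> (homotopy_rel \<hh> `` {\<xi>}) = homotopy_rel \<gg> `` {\<iota> \<xi>})"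
proof -
  let ?\<Phi> = "\<lambda>C. homotopy_rel \<gg> `` {\<iota> (SOME x. x \<in> C)}"
  have mcF: "x \<in> H.mc \<Longrightarrow> x \<in> H.F 0" for x by (simp add: H.mc_def)
  have \<Phi>: "?\<Phi> (homotopy_rel \<hh> `` {x}) = homotopy_rel \<gg> `` {\<iota> x}" if x: "x \<in> H.mc" for x
  proof -
    have "(x, SOME z. z \<in> homotopy_rel \<hh> `` {x}) \<in> homotopy_rel \<hh>"
      using someI[of "\<lambda>z. z \<in> homotopy_rel \<hh> `` {x}" x] H.homotopy_rel_refl[OF x] by auto
    then have "(\<iota> x, \<iota> (SOME z. z \<in> homotopy_rel \<hh> `` {x})) \<in> homotopy_rel \<gg>" by (rule homotopy_rel_map)
    then show ?thesis using equiv_class_eq[OF G.equiv_homotopy_rel] by metis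
  qed
  have "bij_betw ?\<Phi> (H.mc // homotopy_rel \<hh>) (G.mc // homotopy_rel \<gg>)"
    unfolding bij_betw_def
  proof
    show "inj_on ?\<Phi> (H.mc // homotopy_rel \<hh>)"
    proof (rule inj_onI)
    fix C C' assume "C \<in> H.mc // homotopy_rel \<hh>" "C' \<in> H.mc // homotopy_rel \<hh>" and eq: "?\<Phi> C = ?\<Phi> C'"
    then obtain x y where xy: "x \<in> H.mc" "y \<in> H.mc" "C = homotopy_rel \<hh> `` {x}" "C' = homotopy_rel \<hh> `` {y}"
      by (auto elim!: quotientE)
    then have "homotopy_rel \<gg> `` {\<iota> x} = homotopy_rel \<gg> `` {\<iota> y}" using eq \<Phi> by simp
    then have "(\<iota> x, \<iota> y) \<in> homotopy_rel \<gg>"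
      using eq_equiv_class[OF _ G.equiv_homotopy_rel] emb.map_mc xy by blast
    then have "(x, y) \<in> homotopy_rel \<hh>" using homotopy_rel_reflect xy mcF by blast
    then show "C = C'" using xy equiv_class_eq[OF H.equiv_homotopy_rel] by simp
    qed
  next
    show "?\<Phi> ` (H.mc // homotopy_rel \<hh>) = G.mc // homotopy_rel \<gg>"
    proof (intro subset_antisym subsetI)
    fix C assume "C \<in> ?\<Phi> ` (H.mc // homotopy_rel \<hh>)"
    then obtain x where "x \<in> H.mc" "C = ?\<Phi> (homotopy_rel \<hh> `` {x})" by (auto elim!: quotientE)
    then show "C \<in> G.mc // homotopy_rel \<gg>" using \<Phi> emb.map_mc by (metis quotientI)
  next
    fix C assume "C \<in> G.mc // homotopy_rel \<gg>"
    then obtain m where m: "m \<in> G.mc" "C = homotopy_rel \<gg> `` {m}" by (auto elim!: quotientE)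
    obtain x where x: "x \<in> H.mc" "(m, \<iota> x) \<in> homotopy_rel \<gg>" using homotopic_to_image m by blast
    then have "C = ?\<Phi> (homotopy_rel \<hh> `` {x})"
      using \<Phi> m equiv_class_eq[OF G.equiv_homotopy_rel] by simp
    then show "C \<in> ?\<Phi> ` (H.mc // homotopy_rel \<hh>)" using x by (blast intro: quotientI)
  qed
    qed
  then show ?thesis unfolding MC_moduli_def H.MC_eq G.MC_eq using \<Phi> by blast
qed

text \<open>The projection \<open>1 - D K - K D\<close> is a chain map onto the image of \<open>\<iota>\<close> and inverts \<open>\<iota>\<close> on
  the homology of the associated graded.\<close>

lemma filtered_quasi_iso: "filtered_quasi_iso \<hh> \<gg> \<iota>"
proof -
  define P where "P x = x - G.D (K x) - K (G.D x)" for x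
  have PF: "P x \<in> G.F j" if "x \<in> G.F j" for x j
    unfolding P_def using that by (intro G.F_diff G.D_F K_F)
  have PD: "P (G.D x) = G.D (P x)" if "x \<in> G.F 0" for x
    unfolding P_def using that by (simp add: G.D_diff G.D_D K_F G.D_F)
  have Padd: "P (x + y) = P x + P y" for x y by (simp add: P_def G.D_add K_add)
  have P\<iota>: "P (\<iota> y) = \<iota> y" if "y \<in> H.F 0" for y
    unfolding P_def using that by (simp add: K_\<iota> emb.map_D[symmetric] H.D_F)
  have lift: "\<exists>y\<in>H.F j. P x = \<iota> y" if "x \<in> G.F j" for x j
    using proj[of x] PF[OF that] reflects that G.F_0 unfolding P_def[symmetric] by auto
  have hom: "dgla_morphism \<hh> \<gg> \<iota>"
    unfolding dgla_morphism_def H.gspace G.gspace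
    by (auto simp: emb.map_F emb.map_add emb.map_scale emb.map_D emb.map_sg emb.map_br)
  have cyc: "\<iota> x \<in> gr_cycles \<gg> j" if "x \<in> gr_cycles \<hh> j" for x j
    using that emb.map_F H.F_0 unfolding gr_cycles_def by (auto simp: emb.map_D[symmetric])
  have cycF: "x \<in> gr_cycles \<hh> j \<Longrightarrow> x \<in> H.F 0" for x j using H.F_0 by (auto simp: gr_cycles_def)
  have iff: "(x, y) \<in> gr_homologous \<hh> j \<longleftrightarrow> (\<iota> x, \<iota> y) \<in> gr_homologous \<gg> j"
    if xy: "x \<in> gr_cycles \<hh> j" "y \<in> gr_cycles \<hh> j" for x y j
  proof
    assume "(x, y) \<in> gr_homologous \<hh> j"
    then obtain u v where uv: "x - y = H.D u + v" "u \<in> H.F j" "v \<in> H.F (Suc j)"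
      unfolding gr_homologous_def gr_boundaries_def by auto
    then have "\<iota> x - \<iota> y = G.D (\<iota> u) + \<iota> v"
      using cycF xy H.F_0 by (metis emb.map_diff emb.map_add emb.map_D H.D_F)
    then show "(\<iota> x, \<iota> y) \<in> gr_homologous \<gg> j"
      using cyc xy uv emb.map_F unfolding gr_homologous_def gr_boundaries_def by blast
  next
    assume "(\<iota> x, \<iota> y) \<in> gr_homologous \<gg> j"
    then obtain u v where uv: "\<iota> x - \<iota> y = G.D u + v" "u \<in> G.F j" "v \<in> G.F (Suc j)"
      unfolding gr_homologous_def gr_boundaries_def by auto
    \<comment> \<open>The witnesses \<open>u\<close> and \<open>v\<close> need not come from the
      subalgebra. Applying \<open>P\<close>, which commutes with the differential and fixes the
      image of \<iota>, replaces them by ones that do.\<close>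
    obtain u' v' where uv': "u' \<in> H.F j" "P u = \<iota> u'" "v' \<in> H.F (Suc j)" "P v = \<iota> v'"
      using lift uv by meson
    have F0: "x - y \<in> H.F 0" "u' \<in> H.F 0" "v' \<in> H.F 0" "u \<in> G.F 0"
      using cycF xy uv uv' H.F_0 G.F_0 H.F_diff by auto
    have "\<iota> (x - y) = P (\<iota> (x - y))" using F0 P\<iota> by simp
    also have "\<dots> = P (G.D u + v)" using uv emb.map_diff cycF xy by simp
    also have "\<dots> = \<iota> (H.D u' + v')"
      using F0 uv' by (simp add: Padd PD emb.map_add emb.map_D H.D_F)
    finally have "x - y = H.D u' + v'" using inj' F0 H.F_add H.D_F by blast
    then show "(x, y) \<in> gr_homologous \<hh> j"
      using uv' xy unfolding gr_homologous_def gr_boundaries_def by blast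
  qed
  have surj: "\<exists>y\<in>gr_cycles \<hh> j. (x, \<iota> y) \<in> gr_homologous \<gg> j" if x: "x \<in> gr_cycles \<gg> j" for x j
  proof -
    have xF: "x \<in> G.F j" "G.D x \<in> G.F (Suc j)" "x \<in> G.F 0" using x G.F_0 by (auto simp: gr_cycles_def)
    obtain y where y: "y \<in> H.F j" "P x = \<iota> y" using lift xF by blast
    have y0: "y \<in> H.F 0" using y H.F_0 by blast
    have "\<iota> (H.D y) \<in> G.F (Suc j)" using PD[OF xF(3)] PF[OF xF(2)] y y0 by (simp add: emb.map_D)
    then have "y \<in> gr_cycles \<hh> j" using y y0 reflects H.D_F unfolding gr_cycles_def by blast
    \<comment> \<open>The second summand lies in \<open>F (Suc j)\<close> because \<open>x\<close>
      is a cycle modulo that step.\<close>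
    moreover have "x - \<iota> y = G.D (K x) + K (G.D x)" using y(2) by (simp add: P_def algebra_simps)
    then have "x - \<iota> y \<in> gr_boundaries \<gg> j" unfolding gr_boundaries_def using xF K_F by blast
    ultimately show ?thesis using x cyc unfolding gr_homologous_def by blast
  qed
  have "\<exists>\<Phi>. bij_betw \<Phi> (gr_homology \<hh> j) (gr_homology \<gg> j) \<and>
        (\<forall>x\<in>gr_cycles \<hh> j. \<Phi> (gr_homologous \<hh> j `` {x}) = gr_homologous \<gg> j `` {\<iota> x})" for j
  proof -
    note eqH = H.equiv_gr_homologous[of j] and eqG = G.equiv_gr_homologous[of j]
    let ?\<Phi> = "\<lambda>C. gr_homologous \<gg> j `` {\<iota> (SOME x. x \<in> C)}"
    have \<Phi>: "?\<Phi> (gr_homologous \<hh> j `` {x}) = gr_homologous \<gg> j `` {\<iota> x}" if x: "x \<in> gr_cycles \<hh> j" for x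
    proof -
      have "(x, SOME z. z \<in> gr_homologous \<hh> j `` {x}) \<in> gr_homologous \<hh> j"
        using someI[of "\<lambda>z. z \<in> gr_homologous \<hh> j `` {x}" x] equiv_class_self[OF eqH x] by auto
      then have "(\<iota> x, \<iota> (SOME z. z \<in> gr_homologous \<hh> j `` {x})) \<in> gr_homologous \<gg> j"
        using iff x by (auto simp: gr_homologous_def)
      then show ?thesis using equiv_class_eq[OF eqG] by metis
    qed
    have "bij_betw ?\<Phi> (gr_homology \<hh> j) (gr_homology \<gg> j)"
      unfolding bij_betw_def gr_homology_def
    proof
    show "inj_on ?\<Phi> (gr_cycles \<hh> j // gr_homologous \<hh> j)"
    proof (rule inj_onI)
      fix C C' assume "C \<in> gr_cycles \<hh> j // gr_homologous \<hh> j" "C' \<in> gr_cycles \<hh> j // gr_homologous \<hh> j"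
        and eq: "?\<Phi> C = ?\<Phi> C'"
      then obtain x y where xy: "x \<in> gr_cycles \<hh> j" "y \<in> gr_cycles \<hh> j"
          "C = gr_homologous \<hh> j `` {x}" "C' = gr_homologous \<hh> j `` {y}"
        by (auto elim!: quotientE)
      then have "gr_homologous \<gg> j `` {\<iota> x} = gr_homologous \<gg> j `` {\<iota> y}" using eq \<Phi> by simp
      then have "(\<iota> x, \<iota> y) \<in> gr_homologous \<gg> j" using eq_equiv_class[OF _ eqG] cyc xy by blast
      then show "C = C'" using xy iff equiv_class_eq[OF eqH] by simp
    qed
    next
    show "?\<Phi> ` (gr_cycles \<hh> j // gr_homologous \<hh> j) = gr_cycles \<gg> j // gr_homologous \<gg> j"
    proof (intro subset_antisym subsetI)
      fix C assume "C \<in> ?\<Phi> ` (gr_cycles \<hh> j // gr_homologous \<hh> j)"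
      then obtain x where "x \<in> gr_cycles \<hh> j" "C = ?\<Phi> (gr_homologous \<hh> j `` {x})" by (auto elim!: quotientE)
      then show "C \<in> gr_cycles \<gg> j // gr_homologous \<gg> j" using \<Phi> cyc by (metis quotientI)
    next
      fix C assume "C \<in> gr_cycles \<gg> j // gr_homologous \<gg> j"
      then obtain m where m: "m \<in> gr_cycles \<gg> j" "C = gr_homologous \<gg> j `` {m}" by (auto elim!: quotientE)
      obtain x where x: "x \<in> gr_cycles \<hh> j" "(m, \<iota> x) \<in> gr_homologous \<gg> j" using surj m by blast
      then have "C = ?\<Phi> (gr_homologous \<hh> j `` {x})" using \<Phi> m equiv_class_eq[OF eqG] by simp
      then show "C \<in> ?\<Phi> ` (gr_cycles \<hh> j // gr_homologous \<hh> j)" using x by (blast intro: quotientI)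
    qed
    qed
    then show ?thesis using \<Phi> by blast
  qed
  then show ?thesis unfolding filtered_quasi_iso_def using hom emb.map_F by blast
qed

end

section \<open>The dgla of formal functions\<close>

lemma gscale_h_dgla: "gscale (h_dgla W) = ff_scale"
  by (simp add: h_dgla_def fun_eq_iff)

text \<open>Weights are followed through supports; the lemmas named \<open>_nonzero\<close> supply
  the third premise for the individual operators.\<close>

lemma weight_filtI:
  assumes "f \<in> weight_filt W j" "g \<in> formal_functions W'"
    and "\<And>k ws. g k ws \<noteq> 0 \<Longrightarrow> \<exists>k' us. f k' us \<noteq> 0 \<and> 2 * k' + length us = 2 * k + length ws"
  shows "g \<in> weight_filt W' j"
proof -
  have f: "f k us \<noteq> 0 \<Longrightarrow> 2 * k + length us > 2 \<and> 2 * k + length us \<ge> j + 2" for k us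
    using assms(1) by (simp add: weight_filt_def)
  have "2 * k + length ws > 2 \<and> 2 * k + length ws \<ge> j + 2" if "g k ws \<noteq> 0" for k ws
    using assms(3)[OF that] f by metis
  then show ?thesis using assms(2) by (simp add: weight_filt_def)
qed

lemma weight_filt_FF: "f \<in> weight_filt W j \<Longrightarrow> f \<in> formal_functions W"
  by (simp add: weight_filt_def)

lemma weight_filtD: "f \<in> weight_filt W j \<Longrightarrow> f k ws \<noteq> 0 \<Longrightarrow> 2 * k + length ws > 2 \<and> 2 * k + length ws \<ge> j + 2"
  by (simp add: weight_filt_def)

lemma coderivation_nonzero:
  assumes "coderivation W \<phi> f k ws \<noteq> 0" shows "\<exists>us. f k us \<noteq> 0 \<and> length us = length ws"
proof (rule ccontr)
  assume "\<not> ?thesis"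
  then have "f k (ws[j := \<phi> (ws ! j)]) = 0" for j by auto
  then show False using assms by (simp add: coderivation_def split: if_splits)
qed

lemma ff_mult_nonzero:
  assumes "ff_mult W f g k ws \<noteq> 0"
  shows "\<exists>j\<le>k. \<exists>us vs. f j us \<noteq> 0 \<and> g (k - j) vs \<noteq> 0 \<and> length us + length vs = length ws"
proof (rule ccontr)
  assume *: "\<not> ?thesis"
  have l: "length (nths ws S) + length (nths ws (- S)) = length ws" for S
  proof -
    have "{i. i < length ws \<and> i \<in> S} \<union> {i. i < length ws \<and> i \<in> - S} = {..<length ws}" by auto
    then have "card {i. i < length ws \<and> i \<in> S} + card {i. i < length ws \<and> i \<in> - S} = length ws"
      by (subst card_Un_disjoint[symmetric]) auto
    then show ?thesis by (simp add: length_nths)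
  qed
  have "f j (nths ws S) * g (k - j) (nths ws (- S)) = 0" if "j \<le> k" for j S
    using * that l by auto
  then have "ff_mult W f g k ws = 0" unfolding ff_mult_def mult.assoc
    by (intro sum.neutral ballI) simp
  then show False using assms by simp
qed

lemma hbar_mult_nonzero: "hbar_mult f k ws \<noteq> 0 \<Longrightarrow> \<exists>l. k = Suc l \<and> f l ws \<noteq> 0"
  by (cases k) (auto simp: hbar_mult_def)

context super_functions
begin

lemma FF_hbar_mult:
  assumes f: "f \<in> FF" shows "hbar_mult f \<in> FF"
proof (rule FFI)
  fix k us vs a b assume "a \<in> homog W" "b \<in> homog W"
  then show "hbar_mult f k (us @ a # b # vs) = (- 1) ^ (par W a * par W b) * hbar_mult f k (us @ b # a # vs)"
    using FF_swap[OF f, of a b] by (simp add: hbar_mult_def)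
qed (simp_all add: hbar_mult_def FF_off f FF_add FF_scale)

text \<open>Each defining condition compares values at one power of \<hbar> on lists of one length.
  This serves functions assembled from different formal functions in different degrees, such as
  limits and the perturbed homotopy.\<close>

lemma FF_local:
  assumes "\<And>k m. \<exists>g\<in>FF. \<forall>ws. length ws = m \<longrightarrow> f k ws = g k ws" shows "f \<in> FF"
proof (rule FFI)
  fix k ws assume "\<not> set ws \<subseteq> homog W"
  then show "f k ws = 0" using assms[of "length ws" k] FF_off by metis
next
  fix k a b and us vs :: "'w list" assume ab: "a \<in> ev \<and> b \<in> ev \<or> a \<in> od \<and> b \<in> od"
  obtain g where "g \<in> FF" "\<forall>ws. length ws = length us + Suc (length vs) \<longrightarrow> f k ws = g k ws"
    using assms by blast
  then show "f k (us @ vadd W a b # vs) = f k (us @ a # vs) + f k (us @ b # vs)" using FF_add ab by simp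
next
  fix k a c and us vs :: "'w list" assume a: "a \<in> homog W"
  obtain g where "g \<in> FF" "\<forall>ws. length ws = length us + Suc (length vs) \<longrightarrow> f k ws = g k ws"
    using assms by blast
  then show "f k (us @ vscale W c a # vs) = c * f k (us @ a # vs)" using FF_scale a by simp
next
  fix k a b and us vs :: "'w list" assume ab: "a \<in> homog W" "b \<in> homog W"
  obtain g where "g \<in> FF" "\<forall>ws. length ws = length us + Suc (Suc (length vs)) \<longrightarrow> f k ws = g k ws"
    using assms by blast
  then show "f k (us @ a # b # vs) = (- 1) ^ (par W a * par W b) * f k (us @ b # a # vs)"
    using FF_swap[of g a b k us vs] ab by simp
qed

lemma weight_complete:
  assumes S: "\<And>n::nat. S n \<in> weight_filt W 0"
    and cauchy: "\<And>j. \<exists>N. \<forall>n\<ge>N. S n - S N \<in> weight_filt W j"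
  shows "\<exists>x\<in>weight_filt W 0. \<forall>j. \<exists>N. \<forall>n\<ge>N. S n - x \<in> weight_filt W j"
proof -
  obtain M where M: "\<And>j n. n \<ge> M j \<Longrightarrow> S n - S (M j) \<in> weight_filt W j" using cauchy by metis
  \<comment> \<open>A difference in step \<open>j\<close> of the filtration vanishes in all weights
    below \<open>j + 2\<close>, so the value in weight 2k + \<open>length ws\<close> is final from
    the index \<open>M (2 * k + length ws)\<close> on.\<close>
  define x where "x k ws = S (M (2 * k + length ws)) k ws" for k and ws :: "'w list"
  have stable: "S n k ws = S (M j) k ws" if "n \<ge> M j" "j \<ge> 2 * k + length ws" for n j k ws
  proof (rule ccontr)
    assume "S n k ws \<noteq> S (M j) k ws"
    then have "(S n - S (M j)) k ws \<noteq> 0" by simp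
    then show False using weight_filtD[OF M[OF that(1)]] that(2) by fastforce
  qed
  have x_eq: "x k ws = S n k ws" if "n \<ge> M (2 * k + length ws)" for n k ws
    using stable[OF that] by (simp add: x_def)
  have xF: "x \<in> FF"
  proof (rule FF_local)
    fix k m
    have "S (M (2 * k + m)) \<in> FF" using S weight_filt_FF by blast
    then show "\<exists>g\<in>FF. \<forall>ws. length ws = m \<longrightarrow> x k ws = g k ws" unfolding x_def
      by (intro bexI[of _ "S (M (2 * k + m))"]) auto
  qed
  then have "x \<in> weight_filt W 0"
    using weight_filtD[OF S] unfolding weight_filt_def x_def by auto
  moreover have "S n - x \<in> weight_filt W j" if n: "n \<ge> M j" for n j
  proof -
    have "S n - x \<in> FF" using xF S weight_filt_FF FF_linear(3) by blast
    moreover have "2 * k + length ws > 2 \<and> 2 * k + length ws \<ge> j + 2" if nz: "(S n - x) k ws \<noteq> 0" for k ws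
    proof -
      let ?m = "max n (M (2 * k + length ws))"
      have "x k ws = S ?m k ws" using x_eq by simp
      then have "(S n - S (M j)) k ws \<noteq> 0 \<or> (S ?m - S (M j)) k ws \<noteq> 0" using nz by auto
      then show ?thesis using weight_filtD[OF M[OF n]] weight_filtD[OF M[of j ?m]] n by fastforce
    qed
    ultimately show ?thesis by (simp add: weight_filt_def)
  qed
  ultimately show ?thesis by blast
qed

lemma weight_filt_linear:
  "0 \<in> weight_filt W j" "f \<in> weight_filt W j \<Longrightarrow> g \<in> weight_filt W j \<Longrightarrow> f + g \<in> weight_filt W j"
  "f \<in> weight_filt W j \<Longrightarrow> ff_scale c f \<in> weight_filt W j"
  by (auto simp: weight_filt_def FF_linear) (metis add.right_neutral)+

lemma weight_filt_inv: "f \<in> weight_filt W j \<Longrightarrow> grinv f \<in> weight_filt W j"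
  by (rule weight_filtI) (auto simp: ff_involution_def FF_inv[unfolded ff_involution_def] weight_filt_FF)

end

context symplectic_functions
begin

section \<open>The operator \<hbar>\<Delta> and the weights\<close>

definition hlap :: "'w formal \<Rightarrow> 'w formal" where "hlap f = hbar_mult (\<Delta> f)"

lemma hlap_linear:
  "hlap (f + g) = hlap f + hlap g" "hlap (f - g) = hlap f - hlap g" "hlap (- f) = - hlap f" "hlap 0 = 0"
  "hlap (ff_scale c f) = ff_scale c (hlap f)"
  by (simp_all add: hlap_def laplacian_linear hbar_mult_linear)

lemma FF_hlap: "f \<in> FF \<Longrightarrow> hlap f \<in> FF"
  by (simp add: hlap_def FF_hbar_mult FF_laplacian)

lemma laplacian_hbar_mult: "\<Delta> (hbar_mult f) = hbar_mult (\<Delta> f)"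
  by (simp add: laplacian_eq hbar_mult_sum partial_hbar_mult)

lemma bracket_hbar_mult: "br (hbar_mult f) g = hbar_mult (br f g)" "br f (hbar_mult g) = hbar_mult (br f g)"
  by (simp_all add: odd_bracket_def involution_hbar_mult hbar_mult_mult_left hbar_mult_mult_right
      laplacian_hbar_mult hbar_mult_linear)

lemma hlap_hlap: "f \<in> FF \<Longrightarrow> hlap (hlap f) = 0"
  by (simp add: hlap_def laplacian_hbar_mult laplacian_square hbar_mult_linear)

lemma diff_hlap: "f \<in> FF \<Longrightarrow> d (hlap f) = - hlap (d f)"
  by (simp add: hlap_def ff_diff_eq coderivation_hbar_mult[of W] diff_laplacian[unfolded ff_diff_eq] hbar_mult_linear)

lemma inv_hlap: "f \<in> FF \<Longrightarrow> hlap (grinv f) = - grinv (hlap f)"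
  by (simp add: hlap_def laplacian_inv hbar_mult_linear involution_hbar_mult)

lemma hlap_bracket: "f \<in> FF \<Longrightarrow> g \<in> FF \<Longrightarrow> hlap (br f g) = br (hlap f) g - br (grinv f) (hlap g)"
  by (simp add: hlap_def laplacian_bracket bracket_hbar_mult hbar_mult_linear)

lemma gdiff_h_dgla: "gdiff (h_dgla W) f = d f + hlap f"
  by (simp add: h_dgla_def hlap_def)

lemma laplacian_nonzero: "\<Delta> f k ws \<noteq> 0 \<Longrightarrow> \<exists>us. f k us \<noteq> 0 \<and> length us = length ws + 2"
proof (rule ccontr)
  assume 0: "\<Delta> f k ws \<noteq> 0" and *: "\<not> (\<exists>us. f k us \<noteq> 0 \<and> length us = length ws + 2)"
  have "f k (ws @ [e i, \<epsilon> i]) = 0" for i using * by auto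
  then show False using 0 by (simp add: laplacian_eq sum_fun_apply2 ff_partial_def)
qed

lemma weight_filt_diff: "f \<in> weight_filt W j \<Longrightarrow> d f \<in> weight_filt W j"
proof (rule weight_filtI)
  fix k ws assume "d f k ws \<noteq> 0"
  then show "\<exists>k' us. f k' us \<noteq> 0 \<and> 2 * k' + length us = 2 * k + length ws"
    using coderivation_nonzero by (metis ff_diff_eq)
qed (auto simp: FF_diff weight_filt_FF)

lemma weight_filt_hlap: "f \<in> weight_filt W j \<Longrightarrow> hlap f \<in> weight_filt W j"
proof (rule weight_filtI)
  fix k ws assume "hlap f k ws \<noteq> 0"
  then obtain l us where "k = Suc l" "f l us \<noteq> 0" "length us = length ws + 2"
    using hbar_mult_nonzero laplacian_nonzero unfolding hlap_def by blast
  then show "\<exists>k' us. f k' us \<noteq> 0 \<and> 2 * k' + length us = 2 * k + length ws"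
    by (intro exI[of _ l] exI[of _ us]) simp
qed (auto simp: FF_hlap weight_filt_FF)

lemma bracket_nonzero:
  assumes fg: "f \<in> FF" "g \<in> FF" and nz: "br f g k ws \<noteq> 0"
  shows "\<exists>j\<le>k. \<exists>us vs. f j us \<noteq> 0 \<and> g (k - j) vs \<noteq> 0 \<and> length us + length vs = length ws + 2"
proof -
  have "\<exists>i<n. (\<delta> (e i) f \<odot> \<delta> (\<epsilon> i) g) k ws \<noteq> 0 \<or> (grinv (\<delta> (\<epsilon> i) f) \<odot> \<delta> (e i) g) k ws \<noteq> 0"
  proof (rule ccontr)
    assume "\<not> ?thesis"
    then have "br f g k ws = (\<Sum>i<n. 0)"
      unfolding bracket_eq[OF fg] sum_fun_apply2 by (intro sum.cong) auto
    then show False using nz by simp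
  qed
  then obtain i where "(\<delta> (e i) f \<odot> \<delta> (\<epsilon> i) g) k ws \<noteq> 0 \<or> (grinv (\<delta> (\<epsilon> i) f) \<odot> \<delta> (e i) g) k ws \<noteq> 0" by blast
  then have "\<exists>j\<le>k. \<exists>us vs x y. f j (us @ [x]) \<noteq> 0 \<and> g (k - j) (vs @ [y]) \<noteq> 0 \<and> length us + length vs = length ws"
    by (elim disjE) (drule ff_mult_nonzero, fastforce simp: ff_partial_def ff_involution_def)+
  then show ?thesis by fastforce
qed

text \<open>Two arguments are consumed, so weights add up to 2 less than their sum. As every weight
  is at least 3, bracketing with any element gains at least 1; \<open>ij\<close> covers the gain on
  either side.\<close>

lemma weight_filt_bracket:
  assumes f: "f \<in> weight_filt W i" and g: "g \<in> weight_filt W j" and ij: "i = 0 \<and> l = Suc j \<or> j = 0 \<and> l = Suc i"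
  shows "br f g \<in> weight_filt W l"
proof -
  have "2 * k + length ws > 2 \<and> 2 * k + length ws \<ge> l + 2" if nz: "br f g k ws \<noteq> 0" for k ws
  proof -
    obtain m us vs where *: "m \<le> k" "f m us \<noteq> 0" "g (k - m) vs \<noteq> 0" "length us + length vs = length ws + 2"
      using bracket_nonzero[OF weight_filt_FF[OF f] weight_filt_FF[OF g] nz] by blast
    then show ?thesis using weight_filtD[OF f *(2)] weight_filtD[OF g *(3)] ij by auto
  qed
  then show ?thesis using FF_bracket f g by (simp add: weight_filt_def)
qed

lemma odd_dgla_h_dgla: "odd_dgla (h_dgla W)"
proof -
  have h: "gsign (h_dgla W) = grinv" "gbracket (h_dgla W) = br" "gfilt (h_dgla W) = weight_filt W"
    "gdiff (h_dgla W) = (\<lambda>f. d f + hlap f)"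
    by (simp_all add: h_dgla_def hlap_def)
  note FF = weight_filt_FF[of _ W 0]
  show ?thesis
  proof (unfold_locales, unfold h gscale_h_dgla, goal_cases)
    case (9 x)
    \<comment> \<open>Separatedness: a non-zero value has a finite weight, which contradicts
      membership in the step with that weight as index.\<close>
    show ?case
    proof (intro ext)
      fix k ws show "x k ws = 0 k ws"
        using weight_filtD[OF 9, of k ws "2 * k + length ws"] by fastforce
    qed
  next
    case 10 then show ?case by (rule weight_complete)
  next
    case 18 then show ?case
      by (simp add: FF FF_diff FF_hlap diff_linear hlap_linear diff_square hlap_hlap diff_hlap)
  next
    case 19 then show ?case
      by (simp add: FF diff_inv inv_hlap ff_involution_linear)
  next
    case 28 then show ?case
      by (simp add: FF FF_bracket diff_bracket hlap_bracket bracket_linear)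
  next
    case 29 then show ?case by (intro jacobi_even FF)
  next
    case 30
    have "2 < m \<and> 0 + 2 \<le> m \<longleftrightarrow> 2 < m" for m :: nat by auto
    then show ?case by (simp add: h_dgla_def weight_filt_def)
  next
    case 31 then show ?case by (intro jacobi_odd FF)
  next
    case 32 then show ?case by (intro bracket_antisym_odd FF)
  next
    case 8 then show ?case by (force simp: weight_filt_def)
  next
    case (24 x j y) then show ?case by (intro weight_filt_bracket[of x j y 0]) auto
  next
    case (25 x y j) then show ?case by (intro weight_filt_bracket[of x 0 y j]) auto
  next
    case 27 then show ?case by (intro bracket_sym_even FF)
  next
    case 2 then show ?case by (simp add: fun_eq_iff algebra_simps)
  next
    case 3 then show ?case by (simp add: fun_eq_iff)
  next
    case 4 then show ?case by (simp add: fun_eq_iff)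
  qed (simp_all add: weight_filt_linear weight_filt_inv weight_filt_diff weight_filt_hlap
      ff_involution_linear diff_linear hlap_linear bracket_linear ff_scale_linear FF inv_bracket)
qed

end

section \<open>The contraction of the formal functions\<close>

text \<open>\<open>spread q r c f\<close> sums \<open>f\<close> over all ways to apply \<open>r\<close> to some arguments and \<open>q\<close> to the
  others, with weight \<open>c m\<close> for \<open>m\<close> arguments of the first kind; it is defined by recursion on the
  reversed list of arguments.\<close>

primrec spread :: "('w \<Rightarrow> 'w) \<Rightarrow> ('w \<Rightarrow> 'w) \<Rightarrow> (nat \<Rightarrow> real) \<Rightarrow> ('w list \<Rightarrow> real) \<Rightarrow> 'w list \<Rightarrow> real" where
  "spread q r c F [] = c 0 * F []"
| "spread q r c F (v # ws) = spread q r c (\<lambda>us. F (us @ [q v])) ws +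
     spread q r (\<lambda>m. c (Suc m)) (\<lambda>us. F (us @ [r v])) ws"

lemma spread_linear:
  "spread q r c (\<lambda>us. F us + G us) ws = spread q r c F ws + spread q r c G ws"
  "spread q r c (\<lambda>us. t * F us) ws = t * spread q r c F ws"
  "spread q r (\<lambda>m. c m - c' m) F ws = spread q r c F ws - spread q r c' F ws"
  by (induction ws arbitrary: F G c c') (auto simp: algebra_simps)

lemma spread_nonzero:
  "spread q r c F ws \<noteq> 0 \<Longrightarrow> \<exists>us. F us \<noteq> 0 \<and> length us = length ws"
proof (induction ws arbitrary: F c)
  case (Cons v ws)
  then have "spread q r c (\<lambda>us. F (us @ [q v])) ws \<noteq> 0 \<or> spread q r (\<lambda>m. c (Suc m)) (\<lambda>us. F (us @ [r v])) ws \<noteq> 0"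
    by auto
  then show ?case using Cons.IH by fastforce
qed auto

lemma spread_project: "spread q r (\<lambda>m. if m = 0 then 1 else 0) F ws = F (rev (map q ws))"
proof -
  have "spread q r (\<lambda>m. 0) G us = 0" for G us by (induction us arbitrary: G) auto
  then show ?thesis by (induction ws arbitrary: F) auto
qed

text \<open>\<open>q\<close> stands for the projection i p onto the image of i, and \<open>r\<close>
  for the complementary projection. The minus sign in \<open>anticommutator\<close> comes from the
  differential of the parity reversion, which is minus that of the original space.
  \<open>laplacian_basic\<close> says that \<Delta> preserves the functions that see their arguments
  through \<open>q\<close> only.\<close>

locale function_retract = symplectic_functions W n e \<epsilon>
  for W :: "'w super_space" and n e \<epsilon> +
  fixes q r s :: "'w \<Rightarrow> 'w"
  assumes q_parts: "v \<in> even_part W \<Longrightarrow> q v \<in> even_part W" "v \<in> odd_part W \<Longrightarrow> q v \<in> odd_part W"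
    and r_parts: "v \<in> even_part W \<Longrightarrow> r v \<in> even_part W" "v \<in> odd_part W \<Longrightarrow> r v \<in> odd_part W"
    and q_add: "q (vadd W a b) = vadd W (q a) (q b)" and q_scale: "q (vscale W c a) = vscale W c (q a)"
    and r_add: "r (vadd W a b) = vadd W (r a) (r b)" and r_scale: "r (vscale W c a) = vscale W c (r a)"
    and q_r_sum: "vadd W (q v) (r v) = v"
    and q_q: "q (q v) = q v" and r_r: "r (r v) = r v"
    and q_r: "q (r v) \<in> even_part W \<inter> odd_part W"
    and s_odd_map: "super_functions.odd_map W s"
    and s_s: "s (s v) \<in> even_part W \<inter> odd_part W"
    and q_s: "q (s v) = s (q v)" and r_s: "r (s v) = s (r v)" and s_q: "s (q v) \<in> even_part W \<inter> odd_part W"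
    and q_d: "q (vdiff W v) = vdiff W (q v)" and r_d: "r (vdiff W v) = vdiff W (r v)"
    and anticommutator: "f \<in> formal_functions W \<Longrightarrow> v \<in> homog W \<Longrightarrow>
      ff_partial (vdiff W (s v)) f + ff_partial (s (vdiff W v)) f = - ff_partial (r v) f"
    and laplacian_basic: "f \<in> formal_functions W \<Longrightarrow> 
      (\<And>k ws. set ws \<subseteq> homog W \<Longrightarrow> f k (map q ws) = f k ws) \<Longrightarrow>
      set ws \<subseteq> homog W \<Longrightarrow> laplacian W f k (map q ws) = laplacian W f k ws"
begin

lemma q_homog: "v \<in> homog W \<Longrightarrow> q v \<in> homog W" and r_homog: "v \<in> homog W \<Longrightarrow> r v \<in> homog W"
  using q_parts r_parts by (auto simp: homog_def)

text \<open>The functional calculus of the operator that counts arguments in the complement: on the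
  part of \<open>f\<close> that is of degree \<open>m\<close> there, \<open>X c\<close> multiplies
  by \<open>c m\<close>. The list is reversed because \<open>spread\<close> consumes the last
  argument of \<open>f\<close> first.\<close>

definition X :: "(nat \<Rightarrow> real) \<Rightarrow> 'w formal \<Rightarrow> 'w formal" where
  "X c f = (\<lambda>k ws. if set ws \<subseteq> homog W then spread q r c (f k) (rev ws) else 0)"

lemma X_off: "\<not> set ws \<subseteq> homog W \<Longrightarrow> X c f k ws = 0"
  by (simp only: X_def if_False)

lemma X_Nil: "X c f k [] = c 0 * f k []"
  by (simp add: X_def)

lemma X_linear:
  "X c (f + g) = X c f + X c g" "X c (ff_scale t f) = ff_scale t (X c f)" "X (\<lambda>m. c m - c' m) f = X c f - X c' f"
  by (auto simp: X_def fun_eq_iff spread_linear plus_fun_def ff_scale_def)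

lemma X_zero: "X c 0 = 0"
  using X_linear(1)[of c 0 0] by simp

lemma X_minus: "X c (- f) = - X c f"
proof -
  have "- f = ff_scale (- 1) f" "- X c f = ff_scale (- 1) (X c f)" by (simp_all add: fun_eq_iff)
  then show ?thesis using X_linear(2) by metis
qed

lemma partial_X:
  assumes "v \<in> homog W" shows "\<delta> v (X c f) = X c (\<delta> (q v) f) + X (\<lambda>m. c (Suc m)) (\<delta> (r v) f)"
  using assms by (auto simp: X_def fun_eq_iff ff_partial_def)

lemma FF_X: assumes "f \<in> FF" shows "X c f \<in> FF"
proof (rule FF_coinduct[of _ "{X c f | c f. f \<in> FF}"], goal_cases)
  case (2 f k ws)
  then obtain c g where "f = X c g" by auto
  then show ?case using X_off 2(2) by simp
next
  case (3 f a b)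
  have "a \<in> homog W" "b \<in> homog W" "vadd W a b \<in> homog W"
    using 3 add_even[of a b] add_odd[of a b] by (auto simp: homog_def)
  then show ?case using 3 q_parts r_parts
    by (auto simp: partial_X partial_add q_add r_add X_linear)
next
  case (4 f a c)
  have "vscale W c a \<in> homog W" using 4 scale_even[of a c] scale_odd[of a c] by (auto simp: homog_def)
  then show ?case using 4 q_homog r_homog
    by (auto simp: partial_X partial_scale q_scale r_scale X_linear ff_scale_linear)
next
  case (5 f a b)
  then have "a \<in> homog W" "b \<in> homog W" by (auto simp: homog_def)
  then show ?case using 5 q_parts r_parts q_homog r_homog
    by (auto simp: partial_X ff_partial_linear FF_partial partial_swap(1)[of _ "q a" "q b"] partial_swap(1)[of _ "r a" "q b"]
        partial_swap(1)[of _ "q a" "r b"] partial_swap(1)[of _ "r a" "r b"] evD algebra_simps)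
next
  case (6 f a b)
  then have "a \<in> homog W" "b \<in> homog W" by (auto simp: homog_def)
  then show ?case using 6 q_parts r_parts
    by (auto simp: partial_X ff_partial_linear FF_partial partial_swap(2)[of _ "q a" "q b"] partial_swap(2)[of _ "r a" "q b"]
        partial_swap(2)[of _ "q a" "r b"] partial_swap(2)[of _ "r a" "r b"] odD X_minus algebra_simps)
next
  case (7 f v)
  then obtain c g where g: "f = X c g" "g \<in> FF" by auto
  let ?X = "{X c f | c f. f \<in> FF}"
  have m: "X c (\<delta> (q v) g) \<in> ?X" "X (\<lambda>m. c (Suc m)) (\<delta> (r v) g) \<in> ?X" using FF_partial[OF g(2)] by blast+
  show ?case unfolding g(1) partial_X[OF 7(2)] by (intro bexI[OF _ m(1)] bexI[OF _ m(2)] refl)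
qed (use assms in auto)

text \<open>A map commuting with both projections keeps a vector in its summand, so its derivation
  preserves the number of arguments in the complement.\<close>

lemma X_coderivation:
  assumes \<phi>: "odd_map \<phi>" and q\<phi>: "\<And>v. q (\<phi> v) = \<phi> (q v)" and r\<phi>: "\<And>v. r (\<phi> v) = \<phi> (r v)" and f: "f \<in> FF"
  shows "X c (T \<phi> f) = T \<phi> (X c f)"
proof (rule FF_eqI)
  show "X c (T \<phi> f) k ws = T \<phi> (X c f) k ws" if "set ws \<subseteq> homog W" for ws k
    using that f
  proof (induction ws arbitrary: f c k rule: rev_induct)
    case Nil then show ?case by (simp add: X_Nil)
  next
    case (snoc v ws)
    then have v: "v \<in> homog W" and ws: "set ws \<subseteq> homog W" by auto
    have \<phi>v: "\<phi> v \<in> homog W" using odd_mapD(3)[OF \<phi> v] .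
    note IH = snoc.IH[OF ws FF_partial[OF snoc.prems(2)]]
    note F = snoc.prems(2) FF_partial FF_X FF_coderivation[OF \<phi>]
    from v show ?case
    proof (rule homog_cases)
      assume m: "v \<in> ev"
      have "\<delta> v (X c (T \<phi> f)) = X c (T \<phi> (\<delta> (q v) f)) + X c (\<delta> (\<phi> (q v)) f) +
          (X (\<lambda>m. c (Suc m)) (T \<phi> (\<delta> (r v) f)) + X (\<lambda>m. c (Suc m)) (\<delta> (\<phi> (r v)) f))"
        by (simp add: partial_X v partial_coderivation q_parts r_parts m F X_linear)
      moreover have "\<delta> v (T \<phi> (X c f)) = T \<phi> (X c (\<delta> (q v) f)) + T \<phi> (X (\<lambda>m. c (Suc m)) (\<delta> (r v) f)) +
          (X c (\<delta> (\<phi> (q v)) f) + X (\<lambda>m. c (Suc m)) (\<delta> (\<phi> (r v)) f))"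
        by (simp add: partial_X v \<phi>v partial_coderivation m F coderivation_linear q\<phi> r\<phi>)
      ultimately show ?thesis unfolding ff_partial_apply by (simp add: IH)
    next
      assume m: "v \<in> od"
      have "\<delta> v (X c (T \<phi> f)) = - (X c (T \<phi> (\<delta> (q v) f)) + X c (\<delta> (\<phi> (q v)) f) +
          (X (\<lambda>m. c (Suc m)) (T \<phi> (\<delta> (r v) f)) + X (\<lambda>m. c (Suc m)) (\<delta> (\<phi> (r v)) f)))"
        using X_linear(1)[of _ "- T \<phi> _" "- \<delta> _ _"]
        by (simp add: partial_X v partial_coderivation \<phi> q_parts r_parts m F X_minus)
      moreover have "\<delta> v (T \<phi> (X c f)) = - (T \<phi> (X c (\<delta> (q v) f)) + T \<phi> (X (\<lambda>m. c (Suc m)) (\<delta> (r v) f)) +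
          (X c (\<delta> (\<phi> (q v)) f) + X (\<lambda>m. c (Suc m)) (\<delta> (\<phi> (r v)) f)))"
        by (simp add: partial_X v \<phi>v partial_coderivation \<phi> m F coderivation_linear q\<phi> r\<phi>)
      ultimately show ?thesis unfolding ff_partial_apply by (simp add: IH)
    qed
  qed
qed (simp_all add: X_off coderivation_off)

lemma X_inv: assumes "f \<in> FF" shows "X c (grinv f) = grinv (X c f)"
proof (rule FF_eqI)
  show "X c (grinv f) k ws = grinv (X c f) k ws" if "set ws \<subseteq> homog W" for ws k
    using that assms
  proof (induction ws arbitrary: f c k rule: rev_induct)
    case Nil then show ?case by (simp add: X_Nil)
  next
    case (snoc v ws)
    then have v: "v \<in> homog W" and ws: "set ws \<subseteq> homog W" by auto
    note IH = snoc.IH[OF ws FF_partial[OF snoc.prems(2)]]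
    from v show ?case unfolding ff_partial_apply
      by (rule homog_cases)
        (simp_all add: partial_X v partial_rules q_parts r_parts snoc.prems FF_X X_minus IH ff_involution_linear)
  qed
qed (simp_all add: X_off inv_off FF_X assms)

abbreviation "Sop \<equiv> coderivation W s"

lemma FF_Sop: "f \<in> FF \<Longrightarrow> Sop f \<in> FF"
  by (rule FF_coderivation[OF s_odd_map])

text \<open>The anticommutator of d and the extension of \<open>s\<close> is the derivation
  extending \<open>r\<close>, that is, the counting operator. The statement carries a general
  \<open>c\<close> so that the induction can shift it.\<close>

lemma anticommutator_X:
  assumes "f \<in> FF" shows "d (Sop (X c f)) + Sop (d (X c f)) = X (\<lambda>m. real m * c m) f"
proof (rule FF_eqI)
  show "(d (Sop (X c f)) + Sop (d (X c f))) k ws = X (\<lambda>m. real m * c m) f k ws" if "set ws \<subseteq> homog W" for ws k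
    using that assms
  proof (induction ws arbitrary: f c k rule: rev_induct)
    case Nil then show ?case by (simp add: X_Nil ff_diff_eq)
  next
    case (snoc v ws)
    then have v: "v \<in> homog W" and ws: "set ws \<subseteq> homog W" by auto
    note FX = FF_X[OF snoc.prems(2), of c]
    have "\<delta> v (d (Sop (X c f)) + Sop (d (X c f))) =
        d (Sop (\<delta> v (X c f))) + Sop (d (\<delta> v (X c f))) - (\<delta> (vdiff W (s v)) (X c f) + \<delta> (s (vdiff W v)) (X c f))"
      unfolding ff_diff_eq using partial_coderivation_anticommutator[OF diff_odd_map s_odd_map FX v] by simp
    also have "\<dots> = d (Sop (\<delta> v (X c f))) + Sop (d (\<delta> v (X c f))) + \<delta> (r v) (X c f)"
      unfolding anticommutator[OF FX v] by simp
    also have "\<delta> (r v) (X c f) = X c (\<delta> (q (r v)) f) + X (\<lambda>m. c (Suc m)) (\<delta> (r v) f)"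
      using partial_X[OF r_homog[OF v]] by (simp add: r_r)
    also have "\<delta> (q (r v)) f = 0" using partial_null[OF snoc.prems(2)] q_r by blast
    also have "X c 0 = 0" by (rule X_zero)
    finally have L0: "\<delta> v (d (Sop (X c f)) + Sop (d (X c f))) =
        d (Sop (\<delta> v (X c f))) + Sop (d (\<delta> v (X c f))) + (0 + X (\<lambda>m. c (Suc m)) (\<delta> (r v) f))" .
    have L: "\<delta> v (d (Sop (X c f)) + Sop (d (X c f))) k ws =
        (d (Sop (X c (\<delta> (q v) f))) + Sop (d (X c (\<delta> (q v) f)))) k ws +
        (d (Sop (X (\<lambda>m. c (Suc m)) (\<delta> (r v) f))) + Sop (d (X (\<lambda>m. c (Suc m)) (\<delta> (r v) f)))) k ws +
        X (\<lambda>m. c (Suc m)) (\<delta> (r v) f) k ws"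
      unfolding L0 unfolding partial_X[OF v] ff_diff_eq coderivation_linear plus_fun_apply by simp
    \<comment> \<open>When the last vector falls into the complement, the remaining arguments
      contribute \<open>m\<close> to the count and the last one contributes the missing 1.\<close>
    have c: "(\<lambda>m. real (Suc m) * c (Suc m) - real m * c (Suc m)) = (\<lambda>m. c (Suc m))"
      by (simp add: fun_eq_iff algebra_simps)
    have "X (\<lambda>m. real (Suc m) * c (Suc m)) (\<delta> (r v) f) =
        X (\<lambda>m. real m * c (Suc m)) (\<delta> (r v) f) + X (\<lambda>m. c (Suc m)) (\<delta> (r v) f)"
      using X_linear(3)[of "\<lambda>m. real (Suc m) * c (Suc m)" "\<lambda>m. real m * c (Suc m)" "\<delta> (r v) f"]
      unfolding c by simp
    then have R: "\<delta> v (X (\<lambda>m. real m * c m) f) k ws = X (\<lambda>m. real m * c m) (\<delta> (q v) f) k ws +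
        X (\<lambda>m. real m * c (Suc m)) (\<delta> (r v) f) k ws + X (\<lambda>m. c (Suc m)) (\<delta> (r v) f) k ws"
      unfolding partial_X[OF v] by simp
    show ?case unfolding ff_partial_apply L R using snoc.IH[OF ws FF_partial[OF snoc.prems(2)]] by simp
  qed
qed (simp_all add: X_off ff_diff_eq coderivation_off)

lemma X_one: assumes "f \<in> FF" shows "X (\<lambda>_. 1) f = f"
proof (rule FF_eqI)
  show "X (\<lambda>_. 1) f k ws = f k ws" if "set ws \<subseteq> homog W" for ws k
    using that assms
  proof (induction ws arbitrary: f k rule: rev_induct)
    case Nil then show ?case by (simp add: X_Nil)
  next
    case (snoc v ws)
    then have v: "v \<in> homog W" and ws: "set ws \<subseteq> homog W" by auto
    have "\<delta> (q v) f + \<delta> (r v) f = \<delta> v f"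
      using partial_add[OF snoc.prems(2), of "q v" "r v"] q_r_sum v q_parts r_parts by (auto simp: homog_def)
    then show ?case unfolding ff_partial_apply partial_X[OF v]
      using snoc.IH[OF ws FF_partial[OF snoc.prems(2)]] by (metis plus_fun_apply)
  qed
qed (simp_all add: X_off FF_off assms)

section \<open>The unperturbed contraction\<close>

definition P0 :: "'w formal \<Rightarrow> 'w formal" where
  "P0 = X (\<lambda>m. if m = 0 then 1 else 0)"

definition K0 :: "'w formal \<Rightarrow> 'w formal" where
  "K0 f = Sop (X (\<lambda>m. if m = 0 then 0 else 1 / real m) f)"

text \<open>Functions depending on the component in the image of \<open>q\<close> only. They turn
  out to be the image of the pullback along p.\<close>

definition basic :: "'w formal set" where
  "basic = {f \<in> FF. \<forall>k ws. set ws \<subseteq> homog W \<longrightarrow> f k (map q ws) = f k ws}"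

lemma FF_K0: "f \<in> FF \<Longrightarrow> K0 f \<in> FF"
  unfolding K0_def by (intro FF_Sop FF_X)

lemma K0_linear:
  "K0 (f + g) = K0 f + K0 g" "K0 (f - g) = K0 f - K0 g" "K0 (- f) = - K0 f" "K0 0 = 0" "K0 (ff_scale c f) = ff_scale c (K0 f)"
proof -
  show A: "K0 (f + g) = K0 f + K0 g" for f g by (simp add: K0_def X_linear coderivation_linear)
  show M: "K0 (- f) = - K0 f" for f by (simp add: K0_def X_minus coderivation_linear)
  show "K0 (f - g) = K0 f - K0 g" using A[of f "- g"] by (simp add: M)
  show "K0 (ff_scale c f) = ff_scale c (K0 f)" for f by (simp add: K0_def X_linear coderivation_linear)
  from this[of 0] show "K0 0 = 0" using M[of 0] A[of 0 0] by simp
qed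

text \<open>\<open>K0\<close> acts on each power of \<hbar> separately, whereas \<open>hlap\<close>
  raises the power. Together this makes the recursion defining the perturbed homotopy
  well-founded.\<close>

lemma K0_local: "(\<And>ws. f k ws = g k ws) \<Longrightarrow> K0 f k ws = K0 g k ws"
proof -
  assume "\<And>ws. f k ws = g k ws"
  then have "f k = g k" by auto
  then show ?thesis by (simp add: K0_def X_def coderivation_def cong: if_cong)
qed

lemma K0_K0: "f \<in> FF \<Longrightarrow> K0 (K0 f) = 0"
  unfolding K0_def
  by (simp add: X_coderivation[OF s_odd_map q_s r_s] FF_X coderivation_square[OF s_odd_map _ s_s])

lemma K0_inv: "f \<in> FF \<Longrightarrow> K0 (grinv f) = - grinv (K0 f)"
  unfolding K0_def by (simp add: X_inv coderivation_inv[OF s_odd_map] FF_X)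

lemma K0_homotopy: assumes "f \<in> FF" shows "d (K0 f) + K0 (d f) = f - P0 f"
proof -
  let ?c = "\<lambda>m. if m = 0 then 0 else 1 / real m"
  have "K0 (d f) = Sop (d (X ?c f))"
    unfolding K0_def ff_diff_eq by (simp add: X_coderivation[OF diff_odd_map q_d r_d assms])
  then have "d (K0 f) + K0 (d f) = X (\<lambda>m. real m * ?c m) f"
    using anticommutator_X[OF assms, of ?c] by (simp add: K0_def)
  also have "(\<lambda>m. real m * ?c m) = (\<lambda>m. 1 - (if m = 0 then 1 else 0))" by auto
  finally show ?thesis unfolding X_linear(3) X_one[OF assms] P0_def .
qed

lemma P0_eq: "P0 f = (\<lambda>k ws. if set ws \<subseteq> homog W then f k (map q ws) else 0)"
  unfolding P0_def X_def spread_project by (auto simp: fun_eq_iff rev_map)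

lemma P0_basic: "f \<in> FF \<Longrightarrow> P0 f \<in> basic"
proof -
  assume f: "f \<in> FF"
  have "P0 f k (map q ws) = P0 f k ws" if "set ws \<subseteq> homog W" for k ws
  proof -
    have "set (map q ws) \<subseteq> homog W" using that q_homog by auto
    then show ?thesis using that unfolding P0_eq by (simp add: q_q comp_def)
  qed
  moreover have "P0 f \<in> FF" unfolding P0_def by (rule FF_X[OF f])
  ultimately show ?thesis by (simp add: basic_def)
qed

text \<open>A basic function sees \<open>s v\<close> through \<open>q (s v)\<close> =
  \<open>s (q v)\<close>, a null vector, on which formal functions vanish.\<close>

lemma Sop_basic: assumes "f \<in> basic" shows "Sop f = 0"
proof (rule FF_eqI)
  fix ws k assume ws: "set ws \<subseteq> homog W"
  have f: "f \<in> FF" "\<And>k ws. set ws \<subseteq> homog W \<Longrightarrow> f k (map q ws) = f k ws" using assms by (auto simp: basic_def)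
  have "f k (ws[j := s (ws ! j)]) = 0" if j: "j < length ws" for j
  proof -
    let ?v = "ws ! j"
    have v: "s ?v \<in> homog W" by (rule odd_mapD(3)[OF s_odd_map]) (use ws j nth_mem in blast)
    have "set (ws[j := s ?v]) \<subseteq> homog W" using ws v set_update_subset_insert by fastforce
    then have "f k (ws[j := s ?v]) = f k (map q (ws[j := s ?v]))" using f by simp
    also have "map q (ws[j := s ?v]) = map q (take j ws) @ s (q ?v) # map q (drop (Suc j) ws)"
      using j by (simp add: upd_conv_take_nth_drop q_s)
    also have "f k \<dots> = 0"
    proof -
      have "s (q ?v) \<in> homog W" using s_q by (auto simp: homog_def)
      then have "f k (map q (take j ws) @ vscale W 0 (s (q ?v)) # map q (drop (Suc j) ws)) = 0"
        using FF_scale[OF f(1), of "s (q ?v)" k _ 0] by simp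
      then show ?thesis using null_vector[of "s (q ?v)"] s_q by simp
    qed
    finally show ?thesis .
  qed
  then show "Sop f k ws = 0 k ws" by (simp add: coderivation_def)
qed (simp_all add: coderivation_off)

lemma K0_basic: assumes "f \<in> basic" shows "K0 f = 0"
proof -
  have "f \<in> FF" using assms by (simp add: basic_def)
  then have "K0 f = X (\<lambda>m. if m = 0 then 0 else 1 / real m) (Sop f)"
    unfolding K0_def by (simp add: X_coderivation[OF s_odd_map q_s r_s])
  then show ?thesis unfolding Sop_basic[OF assms] X_zero .
qed

subsection \<open>Perturbation by the Laplacian\<close>

text \<open>The partial sums of the series of the homological perturbation lemma, the sum over n of
  (- \<open>K0\<close> \<open>hlap\<close>)^n \<open>K0 f\<close>. The coefficient of \<hbar>^k is
  final after \<open>k + 1\<close> steps.\<close>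

definition K_iter :: "'w formal \<Rightarrow> nat \<Rightarrow> 'w formal" where
  "K_iter f m = ((\<lambda>h. K0 (f - hlap h)) ^^ m) 0"

lemma K_iter_0: "K_iter f 0 = 0"
  by (simp add: K_iter_def)

lemma K_iter_Suc: "K_iter f (Suc m) = K0 (f - hlap (K_iter f m))"
  by (simp add: K_iter_def)

text \<open>The solution of \<open>K f = K0 (f - \<hbar> \<Delta> (K f))\<close>, which exists because the right-hand side
  depends on lower powers of \<open>\<hbar>\<close> only.\<close>

definition K :: "'w formal \<Rightarrow> 'w formal" where
  "K f = (\<lambda>k ws. K_iter f (Suc k) k ws)"

lemma hlap_local: "(\<And>l ws. l < k \<Longrightarrow> f l ws = g l ws) \<Longrightarrow> hlap f k ws = hlap g k ws"
  by (cases k) (simp_all add: hlap_def hbar_mult_def laplacian_eq sum_fun_apply2 ff_partial_def)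

lemma step_local:
  assumes "\<And>l ws. l < k \<Longrightarrow> h l ws = h' l ws" shows "K0 (f - hlap h) k ws = K0 (f - hlap h') k ws"
  by (rule K0_local) (use hlap_local[OF assms] in simp)

lemma K_iter_stable: "m > k \<Longrightarrow> K_iter f m k ws = K f k ws"
proof (induction k arbitrary: m ws rule: less_induct)
  case (less k)
  obtain m' where m: "m = Suc m'" using less.prems by (cases m) auto
  have "K_iter f m' l us = K_iter f k l us" if "l < k" for l us
    using less.IH[OF that] less.prems that m by simp
  then have "K0 (f - hlap (K_iter f m')) k ws = K0 (f - hlap (K_iter f k)) k ws"
    by (rule step_local)
  then show ?case by (simp add: K_def m K_iter_Suc)
qed

lemma K_eq: "K f = K0 (f - hlap (K f))"
proof (intro ext)
  fix k ws
  have "K f k ws = K0 (f - hlap (K_iter f k)) k ws"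
    by (simp add: K_def K_iter_Suc)
  also have "\<dots> = K0 (f - hlap (K f)) k ws"
    by (rule step_local) (rule K_iter_stable)
  finally show "K f k ws = K0 (f - hlap (K f)) k ws" .
qed

text \<open>Properties of \<open>K\<close> are obtained by exhibiting a solution of its defining
  equation: linearity, parity, vanishing on basic functions, and the homotopy formula below.\<close>

lemma K_unique:
  assumes "h = K0 (f - hlap h)" shows "h = K f"
proof -
  have "h k ws = K f k ws" for k ws
  proof (induction k arbitrary: ws rule: less_induct)
    case (less k)
    have "K0 (f - hlap h) k ws = K0 (f - hlap (K f)) k ws" by (rule step_local) (rule less.IH)
    then show ?case using assms K_eq by metis
  qed
  then show ?thesis by (intro ext)
qed

lemma K_add: "K (f + g) = K f + K g"
proof (rule K_unique[symmetric])
  have "K0 (f + g - hlap (K f + K g)) = K0 (f - hlap (K f)) + K0 (g - hlap (K g))"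
    unfolding K0_linear(1)[symmetric] by (simp add: hlap_linear algebra_simps)
  then show "K f + K g = K0 (f + g - hlap (K f + K g))" using K_eq by metis
qed

lemma K_scale: "K (ff_scale c f) = ff_scale c (K f)"
proof (rule K_unique[symmetric])
  have "K0 (ff_scale c f - hlap (ff_scale c (K f))) = ff_scale c (K0 (f - hlap (K f)))"
    unfolding K0_linear(5)[symmetric] by (simp add: hlap_linear ff_scale_linear)
  then show "ff_scale c (K f) = K0 (ff_scale c f - hlap (ff_scale c (K f)))" using K_eq by metis
qed

lemma FF_K_iter: "f \<in> FF \<Longrightarrow> K_iter f m \<in> FF"
  unfolding K_iter_def by (induction m) (auto intro!: FF_K0 FF_linear FF_hlap)

lemma FF_K: assumes "f \<in> FF" shows "K f \<in> FF"
proof (rule FF_local)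
  fix k m
  show "\<exists>g\<in>FF. \<forall>ws. length ws = m \<longrightarrow> K f k ws = g k ws"
    unfolding K_def by (intro bexI[OF _ FF_K_iter[OF assms, of "Suc k"]]) auto
qed

lemma K0_nonzero: "K0 f k ws \<noteq> 0 \<Longrightarrow> \<exists>us. f k us \<noteq> 0 \<and> length us = length ws"
proof -
  assume "K0 f k ws \<noteq> 0"
  then obtain vs where vs: "X (\<lambda>m. if m = 0 then 0 else 1 / real m) f k vs \<noteq> 0" "length vs = length ws"
    unfolding K0_def using coderivation_nonzero by blast
  then show ?thesis using spread_nonzero[of q r _ "f k" "rev vs"] by (auto simp: X_def split: if_splits)
qed

lemma weight_filt_K0: "f \<in> weight_filt W j \<Longrightarrow> K0 f \<in> weight_filt W j"
proof (rule weight_filtI)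
  fix k ws assume "K0 f k ws \<noteq> 0"
  then show "\<exists>k' us. f k' us \<noteq> 0 \<and> 2 * k' + length us = 2 * k + length ws"
    using K0_nonzero by metis
qed (auto simp: FF_K0 weight_filt_FF)

lemma weight_filt_minus: "f \<in> weight_filt W j \<Longrightarrow> g \<in> weight_filt W j \<Longrightarrow> f - g \<in> weight_filt W j"
proof -
  assume fg: "f \<in> weight_filt W j" "g \<in> weight_filt W j"
  have "f + ff_scale (- 1) g \<in> weight_filt W j" using fg weight_filt_linear by blast
  moreover have "f + ff_scale (- 1) g = f - g" by (simp add: fun_eq_iff)
  ultimately show ?thesis by simp
qed

lemma weight_filt_K: assumes f: "f \<in> weight_filt W j" shows "K f \<in> weight_filt W j"
proof -
  have "K_iter f m \<in> weight_filt W j" for m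
  proof (induction m)
    case 0 then show ?case by (simp only: K_iter_0 weight_filt_linear(1))
  next
    case (Suc m) then show ?case
      unfolding K_iter_Suc by (intro weight_filt_K0 weight_filt_minus weight_filt_hlap f)
  qed
  then have "K f k ws \<noteq> 0 \<Longrightarrow> 2 * k + length ws > 2 \<and> 2 * k + length ws \<ge> j + 2" for k ws
    unfolding K_def using weight_filtD by blast
  then show ?thesis using FF_K[OF weight_filt_FF[OF f]] by (simp add: weight_filt_def)
qed

lemma K_inv: assumes "f \<in> FF" shows "grinv (K f) = - K (grinv f)"
proof -
  have "K0 (grinv f - hlap (- grinv (K f))) = K0 (grinv (f - hlap (K f)))"
    using FF_K[OF assms] by (simp add: hlap_linear inv_hlap ff_involution_linear)
  also have "\<dots> = - grinv (K f)"
    using K0_inv[of "f - hlap (K f)"] assms FF_K FF_hlap FF_linear(3) K_eq by metis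
  finally have "- grinv (K f) = K (grinv f)" by (intro K_unique) simp
  then show ?thesis by (metis minus_minus)
qed

lemma K_zero: "K 0 = 0"
  by (rule K_unique[symmetric]) (simp add: hlap_linear K0_linear)

lemma K_K: assumes "f \<in> FF" shows "K (K f) = 0"
proof -
  have "K0 (K f) = K0 (K0 (f - hlap (K f)))" using K_eq by metis
  also have "\<dots> = 0" using assms FF_K FF_hlap FF_linear(3) by (intro K0_K0) blast
  finally have 0: "K0 (K f) = 0" .
  have "K (K f) = K0 (K f) - K0 (hlap (K (K f)))" unfolding K0_linear(2)[symmetric] by (rule K_eq)
  then have "K (K f) = K0 (0 - hlap (K (K f)))" unfolding 0 K0_linear(2) K0_linear(4) .
  then show ?thesis using K_unique K_zero by metis
qed

lemma K_basic: "f \<in> basic \<Longrightarrow> K f = 0"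
  by (rule K_unique[symmetric]) (simp add: hlap_linear K0_basic)

lemma hlap_basic: assumes "f \<in> basic" shows "hlap f \<in> basic"
proof -
  have f: "f \<in> FF" "\<And>k ws. set ws \<subseteq> homog W \<Longrightarrow> f k (map q ws) = f k ws" using assms by (auto simp: basic_def)
  show ?thesis
    using FF_hlap[OF f(1)] laplacian_basic[OF f(1)] f(2) by (simp add: basic_def hlap_def hbar_mult_def)
qed

text \<open>With A = f - \<hbar>\<Delta> (K f) one has K f = K0 A, so the unperturbed homotopy
  formula for A applies. It remains to identify K0 (d A) with \<open>K\<close> of the total
  differential of \<open>f\<close>. This follows from uniqueness: K0 (d A) solves the same equation
  up to the term K0 (\<hbar>\<Delta> (P0 A)), which vanishes since \<hbar>\<Delta> preserves basic
  functions.\<close>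

lemma K_homotopy:
  assumes f: "f \<in> FF" shows "f - (d (K f) + hlap (K f)) - K (d f + hlap f) \<in> basic"
proof -
  define A where "A = f - hlap (K f)"
  have F: "K f \<in> FF" "A \<in> FF" "P0 A \<in> basic"
    unfolding A_def using f FF_K FF_hlap FF_linear(3) P0_basic by auto
  have PF: "P0 A \<in> FF" using F(3) by (simp add: basic_def)
  have KA: "K f = K0 A" unfolding A_def by (rule K_eq)
  have dK: "d (K f) = A - P0 A - K0 (d A)" using K0_homotopy[OF F(2)] by (simp add: KA algebra_simps)
  have hA: "hlap A = hlap f" using F f by (simp add: A_def hlap_linear hlap_hlap)
  have "d A = d f - d (hlap (K f))" by (simp add: A_def diff_linear)
  also have "\<dots> = d f + hlap (d (K f))" using diff_hlap[OF F(1)] by simp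
  also have "\<dots> = (d f + hlap f) - hlap (K0 (d A)) - hlap (P0 A)"
    unfolding dK hlap_linear hA by simp
  finally have dA: "d A = (d f + hlap f) - hlap (K0 (d A)) - hlap (P0 A)" .
  have "K0 (d A) = K0 ((d f + hlap f) - hlap (K0 (d A))) - K0 (hlap (P0 A))"
    using arg_cong[OF dA, of K0] unfolding K0_linear(2)[of _ "hlap (P0 A)"] .
  also have "K0 (hlap (P0 A)) = 0" by (intro K0_basic hlap_basic F)
  finally have "K0 (d A) = K (d f + hlap f)" unfolding diff_zero by (rule K_unique)
  then have "f - (d (K f) + hlap (K f)) - K (d f + hlap f) = P0 A"
    unfolding dK by (simp add: A_def)
  then show ?thesis using F by simp
qed

end

section \<open>Canonical bases\<close>

text \<open>Take a biorthogonal system of maximal length, which exists because its first halves are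
  independent. The residual parts \<open>px x\<close> and \<open>py y\<close> are orthogonal to the
  system. If two of them paired non-trivially, they would extend it after rescaling; so all residual
  parts pair to zero and vanish by non-degeneracy.\<close>

lemma biorthogonal_bases:
  fixes P Q :: "'v::real_vector set" and B :: "'v \<Rightarrow> 'v \<Rightarrow> real"
  assumes fin: "\<exists>A :: 'v set. finite A \<and> span A = UNIV"
    and P: "subspace P" and Q: "subspace Q"
    and lin: "\<And>y. linear (\<lambda>x. B x y)" "\<And>x. linear (B x)"
    and nondeg: "\<And>x. x \<in> P \<Longrightarrow> (\<And>y. y \<in> Q \<Longrightarrow> B x y = 0) \<Longrightarrow> x = 0"
      "\<And>y. y \<in> Q \<Longrightarrow> (\<And>x. x \<in> P \<Longrightarrow> B x y = 0) \<Longrightarrow> y = 0"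
  obtains n e \<epsilon> where "\<And>i::nat. i < n \<Longrightarrow> e i \<in> P \<and> \<epsilon> i \<in> Q"
    "\<And>i j. i < n \<Longrightarrow> j < n \<Longrightarrow> B (e i) (\<epsilon> j) = (if i = j then 1 else 0)"
    "\<And>x. x \<in> P \<Longrightarrow> x = (\<Sum>i<n. B x (\<epsilon> i) *\<^sub>R e i)"
    "\<And>y. y \<in> Q \<Longrightarrow> y = (\<Sum>i<n. B (e i) y *\<^sub>R \<epsilon> i)"
proof -
  note B = linear_add[OF lin(1)] linear_add[OF lin(2)] linear_diff[OF lin(1)] linear_diff[OF lin(2)]
    linear_scale[OF lin(1)] linear_scale[OF lin(2)] linear_sum[OF lin(1)] linear_sum[OF lin(2)]
  define good where "good n \<longleftrightarrow> (\<exists>e \<epsilon>. (\<forall>i<n. e i \<in> P \<and> \<epsilon> i \<in> Q) \<and>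
    (\<forall>i<n. \<forall>j<n. B (e i) (\<epsilon> j) = (if i = j then 1 else 0)))" for n :: nat
  obtain A :: "'v set" where A: "finite A" "span A = UNIV" using fin by blast
  have bound: "n \<le> card A" if g: "good n" for n
  proof -
    obtain e \<epsilon> where e: "\<forall>i<n. \<forall>j<n. B (e i) (\<epsilon> j) = (if i = j then 1 else 0)"
      using g unfolding good_def by blast
    have inj: "inj_on e {..<n}"
    proof (rule inj_onI)
      fix i j assume ij: "i \<in> {..<n}" "j \<in> {..<n}" "e i = e j"
      then have "B (e j) (\<epsilon> i) = 1" using e by (metis lessThan_iff)
      then show "i = j" using e ij by (metis lessThan_iff zero_neq_one)
    qed
    have "independent (e ` {..<n})"
    proof (rule independent_if_scalars_zero)
      fix c x assume sum: "(\<Sum>x\<in>e ` {..<n}. c x *\<^sub>R x) = 0" and "x \<in> e ` {..<n}"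
      then obtain j where j: "j < n" "x = e j" by auto
      have "0 = B (\<Sum>i<n. c (e i) *\<^sub>R e i) (\<epsilon> j)"
        using sum linear_0[OF lin(1)] by (simp add: sum.reindex[OF inj])
      also have "\<dots> = (\<Sum>i<n. if i = j then c (e i) else 0)"
        unfolding B by (intro sum.cong refl) (use e j in auto)
      also have "\<dots> = c x" using j by simp
      finally show "c x = 0" by simp
    qed simp
    then have "card (e ` {..<n}) \<le> card A" using independent_span_bound[OF A(1)] A(2) by auto
    then show ?thesis by (simp add: card_image[OF inj])
  qed
  have "good 0" by (simp add: good_def)
  then obtain n where n: "good n" "\<And>m. good m \<Longrightarrow> m \<le> n"
    using ex_has_greatest_nat[of good 0 id "Suc (card A)"] bound by (auto simp: less_Suc_eq_le)
  obtain e \<epsilon> where e: "\<And>i. i < n \<Longrightarrow> e i \<in> P" "\<And>i. i < n \<Longrightarrow> \<epsilon> i \<in> Q"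
    "\<And>i j. i < n \<Longrightarrow> j < n \<Longrightarrow> B (e i) (\<epsilon> j) = (if i = j then 1 else 0)"
    using n(1) unfolding good_def by blast
  define px where "px x = x - (\<Sum>i<n. B x (\<epsilon> i) *\<^sub>R e i)" for x
  define py where "py y = y - (\<Sum>i<n. B (e i) y *\<^sub>R \<epsilon> i)" for y
  have pxP: "px x \<in> P" if "x \<in> P" for x
    unfolding px_def using P that e by (intro subspace_diff subspace_sum subspace_scale) auto
  have pyQ: "py y \<in> Q" if "y \<in> Q" for y
    unfolding py_def using Q that e by (intro subspace_diff subspace_sum subspace_scale) auto
  have px0: "B (px x) (\<epsilon> j) = 0" if "j < n" for x j
  proof -
    have "(\<Sum>i<n. B x (\<epsilon> i) * B (e i) (\<epsilon> j)) = (\<Sum>i<n. if i = j then B x (\<epsilon> j) else 0)"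
      by (intro sum.cong refl) (use that e in auto)
    then show ?thesis unfolding px_def B using that by simp
  qed
  have py0: "B (e j) (py y) = 0" if "j < n" for y j
  proof -
    have "(\<Sum>i<n. B (e i) y * B (e j) (\<epsilon> i)) = (\<Sum>i<n. if i = j then B (e j) y else 0)"
      by (intro sum.cong refl) (use that e in auto)
    then show ?thesis unfolding py_def B using that by simp
  qed
  have pair: "B (px x) (py y) = 0" if xy: "x \<in> P" "y \<in> Q" for x y
  proof (rule ccontr)
    assume nz: "B (px x) (py y) \<noteq> 0"
    let ?e = "\<lambda>i. if i = n then px x else e i" and ?\<epsilon> = "\<lambda>i. if i = n then (1 / B (px x) (py y)) *\<^sub>R py y else \<epsilon> i"
    have "?e j \<in> P \<and> ?\<epsilon> j \<in> Q" if "j < Suc n" for j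
      using that e xy pxP pyQ subspace_scale[OF Q] by (auto simp: less_Suc_eq)
    moreover have "B (?e j) (?\<epsilon> k) = (if j = k then 1 else 0)" if "j < Suc n" "k < Suc n" for j k
      using that e nz px0 py0 by (auto simp: less_Suc_eq B)
    ultimately have "(\<forall>j<Suc n. ?e j \<in> P \<and> ?\<epsilon> j \<in> Q) \<and>
        (\<forall>j<Suc n. \<forall>k<Suc n. B (?e j) (?\<epsilon> k) = (if j = k then 1 else 0))"
      by simp
    then have "good (Suc n)"
      unfolding good_def by (rule exI[of _ ?e, OF exI[of _ ?\<epsilon>]])
    then show False using n(2) by fastforce
  qed
  have split_x: "B (px x) y = B (px x) (py y)" for x y
    unfolding py_def B using px0 by simp
  have split_y: "B x (py y) = B (px x) (py y)" for x y
    unfolding px_def B using py0 by simp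
  have "px x = 0" if "x \<in> P" for x
    by (rule nondeg(1)[OF pxP[OF that]]) (use split_x pair that in simp)
  moreover have "py y = 0" if "y \<in> Q" for y
    by (rule nondeg(2)[OF pyQ[OF that]]) (use split_y pair that in simp)
  ultimately show ?thesis using that[of n e \<epsilon>] e unfolding px_def py_def by auto
qed

context super_functions
begin

lemma lincomb_parts:
  assumes "vzero W \<in> ev \<inter> od"
  shows "(\<And>i. i < n \<Longrightarrow> v i \<in> ev) \<Longrightarrow> lincomb W c v n \<in> ev"
    and "(\<And>i. i < n \<Longrightarrow> v i \<in> od) \<Longrightarrow> lincomb W c v n \<in> od"
  using assms by (induction n) (auto simp: add_even add_odd scale_even scale_odd)

lemma partial_lincomb:
  assumes z: "vzero W \<in> ev \<inter> od" and f: "f \<in> FF"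
    and v: "(\<forall>i<n. v i \<in> ev) \<or> (\<forall>i<n. v i \<in> od)"
  shows "\<delta> (lincomb W c v n) f = (\<Sum>i<n. ff_scale (c i) (\<delta> (v i) f))"
  using v
proof (induction n)
  case 0 then show ?case using partial_null f z by auto
next
  case (Suc n)
  have "lincomb W c v n \<in> ev \<and> vscale W (c n) (v n) \<in> ev \<or> lincomb W c v n \<in> od \<and> vscale W (c n) (v n) \<in> od"
    using Suc.prems lincomb_parts[OF z, of n v c] scale_even scale_odd by (metis less_SucI lessI)
  moreover have "v n \<in> homog W" using Suc.prems by (auto simp: homog_def)
  moreover have "\<delta> (lincomb W c v n) f = (\<Sum>i<n. ff_scale (c i) (\<delta> (v i) f))"
    using Suc by (metis less_SucI)
  ultimately show ?case
    unfolding lincomb.simps sum.lessThan_Suc by (simp only: partial_add[OF f] partial_scale[OF f])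
qed

end

text \<open>The definition of the Laplacian picks one basis by choice. The existence of any
  canonical basis ensures that the picked one is canonical, and the subsequent computations use the
  picked one.\<close>

lemma laplacian_canonical_basis:
  assumes "canonical_basis W n e \<epsilon>"
  obtains n e \<epsilon> where "canonical_basis W n e \<epsilon>"
    "\<And>f. laplacian W f = (\<Sum>i<n. ff_partial (e i) (ff_partial (\<epsilon> i) f))"
proof -
  obtain n' e' \<epsilon>' where *: "(SOME (n, e, \<epsilon>). canonical_basis W n e \<epsilon>) = (n', e', \<epsilon>')"
    by (metis prod_cases3)
  have "case (SOME (n, e, \<epsilon>). canonical_basis W n e \<epsilon>) of (n, e, \<epsilon>) \<Rightarrow> canonical_basis W n e \<epsilon>"
    by (rule someI[of _ "(n, e, \<epsilon>)"]) (use assms in simp)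
  then show ?thesis using that[of n' e' \<epsilon>'] unfolding laplacian_def * by simp
qed

section \<open>Cyclic retracts\<close>

locale cyclic_retract =
  fixes V :: "'v::real_vector super_space" and i :: "'v set \<Rightarrow> 'v" and p :: "'v \<Rightarrow> 'v set" and s :: "'v \<Rightarrow> 'v"
  assumes V: "odd_symmetric_space V" and sdr: "cyclic_sdr V i p s"
begin

abbreviation "H \<equiv> homology V"
abbreviation "W \<equiv> parity_reversion V"
abbreviation "U \<equiv> parity_reversion H"
abbreviation "B \<equiv> form V"

lemma V_ops: "vzero V = 0" "vadd V = (+)" "vscale V = (*\<^sub>R)"
  using V by (auto simp: odd_symmetric_space_def)

lemma parts: "subspace (even_part V)" "subspace (odd_part V)" "even_part V \<inter> odd_part V = {0}"
  using V by (auto simp: odd_symmetric_space_def)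

lemma neg_parts: "x \<in> even_part V \<Longrightarrow> - x \<in> even_part V" "x \<in> odd_part V \<Longrightarrow> - x \<in> odd_part V"
  using subspace_neg parts(1,2) by blast+

lemma split: "\<exists>a\<in>even_part V. \<exists>b\<in>odd_part V. x = a + b"
  using V unfolding odd_symmetric_space_def by blast

lemma d_linear: "linear (vdiff V)" and s_linear: "linear s"
  using V sdr by (auto simp: odd_symmetric_space_def cyclic_sdr_def)

lemma d_parts: "x \<in> even_part V \<Longrightarrow> vdiff V x \<in> odd_part V" "x \<in> odd_part V \<Longrightarrow> vdiff V x \<in> even_part V"
  "vdiff V (vdiff V x) = 0"
  using V by (auto simp: odd_symmetric_space_def)

lemma s_parts: "x \<in> even_part V \<Longrightarrow> s x \<in> odd_part V" "x \<in> odd_part V \<Longrightarrow> s x \<in> even_part V"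
  using sdr by (auto simp: cyclic_sdr_def)

lemma B_linear: "linear (\<lambda>x. B x y)" "linear (B x)"
  using V by (auto simp: odd_symmetric_space_def)

lemma B_same: "x \<in> even_part V \<Longrightarrow> y \<in> even_part V \<Longrightarrow> B x y = 0" "x \<in> odd_part V \<Longrightarrow> y \<in> odd_part V \<Longrightarrow> B x y = 0"
  using V by (auto simp: odd_symmetric_space_def)

lemma B_sym: "x \<in> odd_part V \<Longrightarrow> y \<in> even_part V \<Longrightarrow> B x y = B y x"
proof -
  assume xy: "x \<in> odd_part V" "y \<in> even_part V"
  have "B x y = (- 1) ^ (par V x * par V y) * B y x"
    using V xy unfolding odd_symmetric_space_def homog_def by blast
  then show ?thesis using xy by (simp add: par_def)
qed

lemma B_d: "x \<in> odd_part V \<Longrightarrow> B (vdiff V x) y = B x (vdiff V y)" "x \<in> even_part V \<Longrightarrow> B (vdiff V x) y = - B x (vdiff V y)"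
proof -
  have *: "x \<in> homog V \<Longrightarrow> B (vdiff V x) y + (- 1) ^ par V x * B x (vdiff V y) = 0" for x
    using V unfolding odd_symmetric_space_def by blast
  show "B (vdiff V x) y = - B x (vdiff V y)" if "x \<in> even_part V"
    using *[of x] that by (simp add: homog_def par_def)
  show "B (vdiff V x) y = B x (vdiff V y)" if "x \<in> odd_part V"
  proof (cases "x \<in> even_part V")
    case True
    then have "x = 0" using parts(3) that by blast
    then show ?thesis using linear_0[OF d_linear] linear_0[OF B_linear(1)] by simp
  next
    case False then show ?thesis using *[of x] that by (simp add: homog_def par_def)
  qed
qed

lemma nondegenerate: "(\<And>y. B x y = 0) \<Longrightarrow> x = 0"
  using V by (auto simp: odd_symmetric_space_def)

lemma nondegenerate_odd: "x \<in> odd_part V \<Longrightarrow> (\<And>y. y \<in> even_part V \<Longrightarrow> B x y = 0) \<Longrightarrow> x = 0"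
proof (rule nondegenerate)
  fix y assume x: "x \<in> odd_part V" and *: "\<And>y. y \<in> even_part V \<Longrightarrow> B x y = 0"
  obtain a b where "y = a + b" "a \<in> even_part V" "b \<in> odd_part V" using split by blast
  then show "B x y = 0" using * x B_same(2) linear_add[OF B_linear(2)] by simp
qed

lemma nondegenerate_even: "x \<in> even_part V \<Longrightarrow> (\<And>y. y \<in> odd_part V \<Longrightarrow> B x y = 0) \<Longrightarrow> x = 0"
proof (rule nondegenerate)
  fix y assume x: "x \<in> even_part V" and *: "\<And>y. y \<in> odd_part V \<Longrightarrow> B x y = 0"
  obtain a b where "y = a + b" "a \<in> even_part V" "b \<in> odd_part V" using split by blast
  then show "B x y = 0" using * x B_same(1) linear_add[OF B_linear(2)] by simp
qed

lemma W_ops: "even_part W = odd_part V" "odd_part W = even_part V" "vadd W = (+)" "vscale W = (*\<^sub>R)" "vzero W = 0"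
  "vdiff W x = - vdiff V x" "homog W = homog V"
  by (auto simp: parity_reversion_def V_ops homog_def)

lemma U_ops: "even_part U = odd_part H" "odd_part U = even_part H" "vadd U = vadd H" "vscale U = vscale H" "vzero U = vzero H"
  "vdiff U x = vscale H (- 1) (vdiff H x)" "homog U = homog H"
  by (auto simp: parity_reversion_def homog_def)

lemma form_W: "x \<in> odd_part V \<Longrightarrow> form W x y = - B x y" "x \<in> even_part V \<Longrightarrow> form W x y = B x y"
proof -
  show "form W x y = B x y" if "x \<in> even_part V" using that by (simp add: parity_reversion_def par_def)
  show "form W x y = - B x y" if "x \<in> odd_part V"
  proof (cases "x \<in> even_part V")
    case True
    then have "x = 0" using parts(3) that by blast
    then show ?thesis using linear_0[OF B_linear(1)] by (simp add: parity_reversion_def)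
  qed (simp add: parity_reversion_def par_def)
qed

subsection \<open>The homology as a retract\<close>

lemma p_morphism: "even_morphism V H p" and i_morphism: "even_morphism H V i"
  using sdr by (auto simp: cyclic_sdr_def)

lemma p_carrier: "p x \<in> vcarrier H"
  using p_morphism V by (auto simp: even_morphism_def odd_symmetric_space_def)

lemma p_i: "C \<in> vcarrier H \<Longrightarrow> p (i C) = C"
  using sdr by (auto simp: cyclic_sdr_def)

lemma p_ops: "vadd H (p x) (p y) = p (x + y)" "vscale H c (p x) = p (c *\<^sub>R x)"
  using p_morphism V by (auto simp: even_morphism_def odd_symmetric_space_def)

lemma H_carrier: "C \<in> even_part H \<Longrightarrow> C \<in> vcarrier H" "C \<in> odd_part H \<Longrightarrow> C \<in> vcarrier H"
  by (auto simp: homology_def)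

lemma i_parts: "C \<in> even_part H \<Longrightarrow> i C \<in> even_part V" "C \<in> odd_part H \<Longrightarrow> i C \<in> odd_part V"
  using i_morphism by (auto simp: even_morphism_def)

lemma p_parts: "x \<in> even_part V \<Longrightarrow> p x \<in> even_part H" "x \<in> odd_part V \<Longrightarrow> p x \<in> odd_part H"
  using p_morphism by (auto simp: even_morphism_def)

lemma i_ops:
  "C \<in> vcarrier H \<Longrightarrow> E \<in> vcarrier H \<Longrightarrow> i (vadd H C E) = i C + i E"
  "C \<in> vcarrier H \<Longrightarrow> i (vscale H c C) = c *\<^sub>R i C"
  using i_morphism by (auto simp: even_morphism_def V_ops)

lemma p_zero: "p 0 = vzero H"
proof -
  have "p (s 0) = vzero H" using sdr by (simp add: cyclic_sdr_def)
  then show ?thesis by (simp add: linear_0[OF s_linear])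
qed

definition q :: "'v \<Rightarrow> 'v" where "q x = i (p x)"
definition r :: "'v \<Rightarrow> 'v" where "r x = x - q x"

lemma q_linear: "linear q"
  by (rule linearI) (simp_all add: q_def p_ops[symmetric] i_ops p_carrier)

lemma r_linear: "linear r"
  unfolding r_def using linear_compose_sub[OF linear_id[unfolded id_def] q_linear] .

lemma p_q: "p (q x) = p x" and q_q: "q (q x) = q x"
  by (simp_all add: q_def p_i p_carrier)

lemma q_i: "C \<in> vcarrier H \<Longrightarrow> q (i C) = i C"
  by (simp add: q_def p_i)

lemma q_parts: "x \<in> even_part V \<Longrightarrow> q x \<in> even_part V" "x \<in> odd_part V \<Longrightarrow> q x \<in> odd_part V"
  by (auto simp: q_def i_parts p_parts)

lemma r_parts: "x \<in> even_part V \<Longrightarrow> r x \<in> even_part V" "x \<in> odd_part V \<Longrightarrow> r x \<in> odd_part V"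
  using parts q_parts by (auto simp: r_def subspace_diff)

lemma vdiff_H: "vdiff H C = p 0"
proof -
  have "vdiff H C = vdiff H (p 0)" by (simp add: homology_def)
  also have "\<dots> = p (vdiff V 0)" using p_morphism V by (auto simp: even_morphism_def odd_symmetric_space_def)
  finally show ?thesis by (simp add: linear_0[OF d_linear])
qed

lemma p_d: "p (vdiff V x) = p 0"
  using p_morphism V vdiff_H by (auto simp: even_morphism_def odd_symmetric_space_def)

lemma i_zero: "i (p 0) = 0"
  using linear_0[OF q_linear] by (simp add: q_def)

lemma q_d: "q (vdiff V x) = 0" and d_q: "vdiff V (q x) = 0"
proof -
  show "q (vdiff V x) = 0" by (simp add: q_def p_d i_zero)
  have "vdiff V (i (p x)) = i (vdiff H (p x))" using i_morphism p_carrier by (simp add: even_morphism_def)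
  then show "vdiff V (q x) = 0" by (simp add: q_def vdiff_H i_zero)
qed

lemma q_s: "q (s x) = 0" and s_q: "s (q x) = 0" and s_s: "s (s x) = 0" and ds_sd: "vdiff V (s x) + s (vdiff V x) = r x"
  using sdr p_carrier p_zero i_zero by (auto simp: cyclic_sdr_def q_def r_def)

lemma U_parts: "even_part U = p ` odd_part V" "odd_part U = p ` even_part V"
  unfolding U_ops using p_parts i_parts p_i H_carrier by (auto simp: image_iff) metis+

lemma p_null: "p 0 \<in> even_part U" "p 0 \<in> odd_part U"
  unfolding U_parts using parts subspace_0 by blast+

text \<open>The isometry of i replaces the form on cosets, with its chosen representatives, by the
  form of \<open>V\<close> on the image of \<open>q\<close>.\<close>

lemma form_H: "form H (p x) (p y) = B (q x) (q y)"
  using sdr p_carrier by (simp add: cyclic_sdr_def q_def)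

lemma orthogonal: "B (r x) (q y) = 0"
proof -
  have "p (r x) = vzero H"
    using p_ops(1)[of "r x" "q x"] p_ops(1)[of x "- q x"] p_ops(2)[of "-1" "q x"] p_q p_ops(2)[of "-1" x] p_ops(1)[of x "- x"] p_zero
    by (simp add: r_def)
  then show ?thesis using sdr p_carrier by (auto simp: cyclic_sdr_def q_def)
qed

lemma B_q_left: "B (q x) (q y) = B x (q y)"
  using orthogonal[of x y] linear_diff[OF B_linear(1)] by (simp add: r_def)

lemma B_q_right: "x \<in> odd_part V \<Longrightarrow> y \<in> even_part V \<Longrightarrow> B (q x) (q y) = B (q x) y"
  using B_q_left[of y x] B_sym q_parts by metis

lemma form_U:
  assumes "x \<in> odd_part V" "y \<in> even_part V"
  shows "form U (p x) (p y) = - B (q x) (q y)" "form U (p y) (p x) = B (q x) (q y)"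
proof -
  show "form U (p y) (p x) = B (q x) (q y)"
    using assms p_parts form_H B_sym[of "q x" "q y"] q_parts by (simp add: parity_reversion_def par_def)
  show "form U (p x) (p y) = - B (q x) (q y)"
  proof (cases "p x \<in> even_part H")
    \<comment> \<open>A class of both parities is zero; \<open>par\<close> then returns 0 and both
      sides vanish.\<close>
    case True
    then have "q x = 0" using i_parts assms q_parts parts(3) unfolding q_def by blast
    then show ?thesis using linear_0[OF B_linear(1)] by (simp add: parity_reversion_def form_H)
  qed (simp add: parity_reversion_def par_def form_H)
qed

lemma super_W: "super_functions W"
  using parts by unfold_locales (auto simp: W_ops subspace_add subspace_scale)

lemma super_U: "super_functions U"
proof unfold_locales
  fix a assume "a \<in> even_part U" "a \<in> odd_part U"
  then have "i a \<in> odd_part V \<inter> even_part V" and a: "a = p (i a)" using i_parts p_i H_carrier by (auto simp: U_ops)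
  then have "i a = 0" using parts(3) by blast
  then have "a = p 0" using a by metis
  then show "vscale U 0 a = a" by (simp add: U_ops p_ops)
qed (use parts in \<open>auto simp: U_ops(3,4) U_parts p_ops subspace_add subspace_scale\<close>)

lemma lincomb_W: "lincomb W c v n = (\<Sum>j<n. c j *\<^sub>R v j)"
  by (induction n) (simp_all add: W_ops)

lemma lincomb_U: "lincomb U c (\<lambda>j. p (v j)) n = p (\<Sum>j<n. c j *\<^sub>R v j)"
  by (induction n) (simp_all add: U_ops p_ops p_zero)

lemma finite_dim: "\<exists>A :: 'v set. finite A \<and> span A = UNIV"
  using V unfolding odd_symmetric_space_def by blast

text \<open>Even vectors of \<open>W\<close> are odd in \<open>V\<close>, where the symplectic form
  is - \<open>B\<close>; hence the biorthogonal bases are taken for - \<open>B\<close>.\<close>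

lemma canonical_basis_W: "\<exists>n e \<epsilon>. canonical_basis W n e \<epsilon>"
proof -
  have lin: "linear (\<lambda>x. - B x y)" "linear (\<lambda>y. - B x y)" for x y
    using B_linear linear_compose_neg by blast+
  obtain n e \<epsilon> where e: "\<And>j::nat. j < n \<Longrightarrow> e j \<in> odd_part V \<and> \<epsilon> j \<in> even_part V"
    "\<And>j k. j < n \<Longrightarrow> k < n \<Longrightarrow> - B (e j) (\<epsilon> k) = (if j = k then 1 else 0)"
    "\<And>x. x \<in> odd_part V \<Longrightarrow> x = (\<Sum>j<n. (- B x (\<epsilon> j)) *\<^sub>R e j)"
    "\<And>y. y \<in> even_part V \<Longrightarrow> y = (\<Sum>j<n. (- B (e j) y) *\<^sub>R \<epsilon> j)"
    by (rule biorthogonal_bases[OF finite_dim parts(2) parts(1) lin])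
      (use nondegenerate_odd nondegenerate_even B_sym in auto)
  have f: "form W (e j) (\<epsilon> k) = (if j = k then 1 else 0)" "form W (\<epsilon> k) (e j) = (if j = k then - 1 else 0)"
    if "j < n" "k < n" for j k
    using e(1)[OF that(1)] e(1)[OF that(2)] e(2)[OF that] B_sym by (auto simp: form_W)
  have c1: "c k = 0" if "(\<Sum>j<n. c j *\<^sub>R e j) = 0" "k < n" for c k
  proof -
    have "0 = - B (\<Sum>j<n. c j *\<^sub>R e j) (\<epsilon> k)" using that linear_0[OF B_linear(1)] by simp
    also have "\<dots> = (\<Sum>j<n. c j * - B (e j) (\<epsilon> k))"
      by (simp add: linear_sum[OF B_linear(1)] linear_scale[OF B_linear(1)] sum_negf)
    also have "\<dots> = (\<Sum>j<n. if j = k then c k else 0)" by (intro sum.cong refl) (use e(2) that in auto)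
    finally show ?thesis using that by simp
  qed
  have c2: "c k = 0" if "(\<Sum>j<n. c j *\<^sub>R \<epsilon> j) = 0" "k < n" for c k
  proof -
    have "0 = - B (e k) (\<Sum>j<n. c j *\<^sub>R \<epsilon> j)" using that linear_0[OF B_linear(2)] by simp
    also have "\<dots> = (\<Sum>j<n. c j * - B (e k) (\<epsilon> j))"
      by (simp add: linear_sum[OF B_linear(2)] linear_scale[OF B_linear(2)] sum_negf)
    also have "\<dots> = (\<Sum>j<n. if j = k then c k else 0)" by (intro sum.cong refl) (use e(2) that in auto)
    finally show ?thesis using that by simp
  qed
  have span: "\<exists>c. w = (\<Sum>j<n. c j *\<^sub>R e j)" if "w \<in> odd_part V" for w using e(3)[OF that] by metis
  have span': "\<exists>c. w = (\<Sum>j<n. c j *\<^sub>R \<epsilon> j)" if "w \<in> even_part V" for w using e(4)[OF that] by metis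
  have "canonical_basis W n e \<epsilon>"
    unfolding canonical_basis_def lincomb_W W_ops using e(1) span span' f c1 c2 by blast
  then show ?thesis by blast
qed

text \<open>The basis is constructed inside \<open>V\<close> on the image of \<open>q\<close> and
  then mapped by p. The form stays non-degenerate there because \<open>q\<close> is self-adjoint, so
  pairing an element of the image with \<open>y\<close> is the same as pairing it with
  \<open>q y\<close>.\<close>

lemma canonical_basis_U: "\<exists>n e \<epsilon>. canonical_basis U n e \<epsilon>"
proof -
  let ?P = "q ` odd_part V" and ?Q = "q ` even_part V"
  have lin: "linear (\<lambda>x. - B x y)" "linear (\<lambda>y. - B x y)" for x y
    using B_linear linear_compose_neg by blast+
  have sub: "subspace ?P" "subspace ?Q" using linear_subspace_image[OF q_linear] parts by blast+
  have nd1: "x = 0" if x: "x \<in> ?P" and *: "\<And>y. y \<in> ?Q \<Longrightarrow> - B x y = 0" for x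
  proof (rule nondegenerate_odd)
    show "x \<in> odd_part V" using x q_parts by auto
    fix y assume y: "y \<in> even_part V"
    obtain x' where "x' \<in> odd_part V" "x = q x'" using x by auto
    then show "B x y = 0" using B_q_right[of x' y] y *[of "q y"] by simp
  qed
  have nd2: "y = 0" if y: "y \<in> ?Q" and *: "\<And>x. x \<in> ?P \<Longrightarrow> - B x y = 0" for y
  proof (rule nondegenerate_even)
    show y': "y \<in> even_part V" using y q_parts by auto
    fix x assume x: "x \<in> odd_part V"
    obtain z where "y = q z" using y by auto
    then have "B x y = 0" using B_q_left[of x z] x *[of "q x"] by simp
    then show "B y x = 0" using B_sym[OF x y'] by simp
  qed
  obtain n e \<epsilon> where e: "\<And>j::nat. j < n \<Longrightarrow> e j \<in> ?P \<and> \<epsilon> j \<in> ?Q"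
    "\<And>j k. j < n \<Longrightarrow> k < n \<Longrightarrow> - B (e j) (\<epsilon> k) = (if j = k then 1 else 0)"
    "\<And>x. x \<in> ?P \<Longrightarrow> x = (\<Sum>j<n. (- B x (\<epsilon> j)) *\<^sub>R e j)"
    "\<And>y. y \<in> ?Q \<Longrightarrow> y = (\<Sum>j<n. (- B (e j) y) *\<^sub>R \<epsilon> j)"
    by (rule biorthogonal_bases[OF finite_dim sub lin nd1 nd2]) auto
  have eq: "q (e j) = e j" "q (\<epsilon> j) = \<epsilon> j" "e j \<in> odd_part V" "\<epsilon> j \<in> even_part V" if "j < n" for j
    using e(1)[OF that] q_q q_parts by auto
  have f: "form U (p (e j)) (p (\<epsilon> k)) = (if j = k then 1 else 0)" "form U (p (\<epsilon> k)) (p (e j)) = (if j = k then - 1 else 0)"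
    if "j < n" "k < n" for j k
    using e(2)[OF that] form_U[of "e j" "\<epsilon> k"] eq that by (auto split: if_splits)
  have qsum: "q (\<Sum>j<n. c j *\<^sub>R v j) = (\<Sum>j<n. c j *\<^sub>R v j)" if "\<And>j. j < n \<Longrightarrow> q (v j) = v j" for c v
    using that by (simp add: linear_sum[OF q_linear] linear_scale[OF q_linear])
  have inj: "x = 0" if "q x = x" "p x = vzero H" for x
    using that p_zero i_zero by (metis q_def)
  have c1: "c k = 0" if "p (\<Sum>j<n. c j *\<^sub>R e j) = vzero H" "k < n" for c k
  proof -
    have "(\<Sum>j<n. c j *\<^sub>R e j) = 0" using inj[OF qsum that(1)] eq by simp
    then have "0 = - B (\<Sum>j<n. c j *\<^sub>R e j) (\<epsilon> k)" using that linear_0[OF B_linear(1)] by simp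
    also have "\<dots> = (\<Sum>j<n. c j * - B (e j) (\<epsilon> k))"
      by (simp add: linear_sum[OF B_linear(1)] linear_scale[OF B_linear(1)] sum_negf)
    also have "\<dots> = (\<Sum>j<n. if j = k then c k else 0)" by (intro sum.cong refl) (use e(2) that in auto)
    finally show ?thesis using that by simp
  qed
  have c2: "c k = 0" if "p (\<Sum>j<n. c j *\<^sub>R \<epsilon> j) = vzero H" "k < n" for c k
  proof -
    have "(\<Sum>j<n. c j *\<^sub>R \<epsilon> j) = 0" using inj[OF qsum that(1)] eq by simp
    then have "0 = - B (e k) (\<Sum>j<n. c j *\<^sub>R \<epsilon> j)" using that linear_0[OF B_linear(2)] by simp
    also have "\<dots> = (\<Sum>j<n. c j * - B (e k) (\<epsilon> j))"
      by (simp add: linear_sum[OF B_linear(2)] linear_scale[OF B_linear(2)] sum_negf)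
    also have "\<dots> = (\<Sum>j<n. if j = k then c k else 0)" by (intro sum.cong refl) (use e(2) that in auto)
    finally show ?thesis using that by simp
  qed
  have span1: "\<exists>c. w = p (\<Sum>j<n. c j *\<^sub>R e j)" if w: "w \<in> p ` odd_part V" for w
  proof -
    obtain x where x: "x \<in> odd_part V" "w = p (q x)" using w unfolding p_q by auto
    then show ?thesis using trans[OF x(2) arg_cong[OF e(3)[OF imageI[OF x(1)]], of p]] by (intro exI)
  qed
  have span2: "\<exists>c. w = p (\<Sum>j<n. c j *\<^sub>R \<epsilon> j)" if w: "w \<in> p ` even_part V" for w
  proof -
    obtain x where x: "x \<in> even_part V" "w = p (q x)" using w unfolding p_q by auto
    then show ?thesis using trans[OF x(2) arg_cong[OF e(4)[OF imageI[OF x(1)]], of p]] by (intro exI)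
  qed
  have "canonical_basis U n (\<lambda>j. p (e j)) (\<lambda>j. p (\<epsilon> j))"
    unfolding canonical_basis_def lincomb_U U_parts U_ops(5)
  proof (intro conjI)
    show "\<forall>j<n. p (e j) \<in> p ` odd_part V \<and> p (\<epsilon> j) \<in> p ` even_part V" using eq(3,4) by blast
    show "\<forall>w\<in>p ` odd_part V. \<exists>c. w = p (\<Sum>j<n. c j *\<^sub>R e j)" using span1 by blast
    show "\<forall>w\<in>p ` even_part V. \<exists>c. w = p (\<Sum>j<n. c j *\<^sub>R \<epsilon> j)" using span2 by blast
    show "\<forall>c. p (\<Sum>j<n. c j *\<^sub>R e j) = vzero H \<longrightarrow> (\<forall>j<n. c j = 0)" using c1 by blast
    show "\<forall>c. p (\<Sum>j<n. c j *\<^sub>R \<epsilon> j) = vzero H \<longrightarrow> (\<forall>j<n. c j = 0)" using c2 by blast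
  qed (use f in blast)
  then show ?thesis by blast
qed

text \<open>Expand d of the basis vectors in the basis. Compatibility of d with the form makes the
  coefficients \<open>a\<close> symmetric and \<open>b\<close> antisymmetric; they are contracted
  with anticommuting odd and commuting even derivatives respectively, so both parts of
  \<open>diff_compatible\<close> vanish.\<close>

lemma symplectic_W:
  assumes cb: "canonical_basis W n e \<epsilon>"
    and lap: "\<And>f. laplacian W f = (\<Sum>i<n. ff_partial (e i) (ff_partial (\<epsilon> i) f))"
  shows "symplectic_functions W n e \<epsilon>"
    and "x \<in> odd_part V \<Longrightarrow> x = (\<Sum>j<n. form W x (\<epsilon> j) *\<^sub>R e j)"
    and "y \<in> even_part V \<Longrightarrow> y = (\<Sum>j<n. form W (e j) y *\<^sub>R \<epsilon> j)"
proof -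
  interpret super_functions W by (rule super_W)
  have e: "\<And>j. j < n \<Longrightarrow> e j \<in> odd_part V" "\<And>j. j < n \<Longrightarrow> \<epsilon> j \<in> even_part V"
    "\<And>j k. j < n \<Longrightarrow> k < n \<Longrightarrow> form W (e j) (\<epsilon> k) = (if j = k then 1 else 0)"
    using cb by (auto simp: canonical_basis_def W_ops)
  have B1: "B (e j) (\<epsilon> k) = (if j = k then - 1 else 0)" if "j < n" "k < n" for j k
    using e(3)[OF that] form_W(1)[OF e(1)[OF that(1)], of "\<epsilon> k"] by (auto split: if_splits)
  have lin: "linear (\<lambda>x. B x y)" "linear (B x)" for x y using B_linear by auto
  have ex: "x = (\<Sum>j<n. form W x (\<epsilon> j) *\<^sub>R e j)" if x: "x \<in> odd_part V" for x
  proof -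
    obtain c where c: "x = (\<Sum>j<n. c j *\<^sub>R e j)"
      using cb x unfolding canonical_basis_def lincomb_W W_ops by blast
    have "form W x (\<epsilon> k) = c k" if "k < n" for k
    proof -
      have "B x (\<epsilon> k) = (\<Sum>j<n. c j * B (e j) (\<epsilon> k))"
        unfolding c by (simp add: linear_sum[OF lin(1)] linear_scale[OF lin(1)])
      also have "\<dots> = (\<Sum>j<n. if j = k then - c k else 0)" by (intro sum.cong refl) (use B1 that in auto)
      finally show ?thesis using that form_W(1)[OF x] by simp
    qed
    then show ?thesis using c by simp
  qed
  have e\<epsilon>: "y = (\<Sum>j<n. form W (e j) y *\<^sub>R \<epsilon> j)" if y: "y \<in> even_part V" for y
  proof -
    obtain c where c: "y = (\<Sum>j<n. c j *\<^sub>R \<epsilon> j)"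
      using cb y unfolding canonical_basis_def lincomb_W W_ops by blast
    have "form W (e k) y = c k" if "k < n" for k
    proof -
      have "B (e k) y = (\<Sum>j<n. c j * B (e k) (\<epsilon> j))"
        unfolding c by (simp add: linear_sum[OF lin(2)] linear_scale[OF lin(2)])
      also have "\<dots> = (\<Sum>j<n. if j = k then - c k else 0)" by (intro sum.cong refl) (use B1 that in auto)
      finally show ?thesis using that form_W(1)[OF e(1)[OF that]] by simp
    qed
    then show ?thesis using c by simp
  qed
  show "x \<in> odd_part V \<Longrightarrow> x = (\<Sum>j<n. form W x (\<epsilon> j) *\<^sub>R e j)"
    "y \<in> even_part V \<Longrightarrow> y = (\<Sum>j<n. form W (e j) y *\<^sub>R \<epsilon> j)"
    using ex e\<epsilon> by blast+
  have z: "vzero W \<in> ev \<inter> od" using parts subspace_0 by (auto simp: W_ops)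
  show "symplectic_functions W n e \<epsilon>"
  proof unfold_locales
    show "odd_map (vdiff W)"
      unfolding odd_map_def W_ops(1-4) using d_parts neg_parts
      by (auto simp: W_ops(6) linear_add[OF d_linear] linear_scale[OF d_linear])
    show "vdiff W (vdiff W v) \<in> ev \<inter> od" for v
      using d_parts(3) parts subspace_0 by (auto simp: W_ops linear_neg[OF d_linear])
  next
    fix f assume f: "f \<in> FF"
    define a where "a j k = form W (e k) (vdiff W (e j))" for j k
    define b where "b j k = form W (vdiff W (\<epsilon> j)) (\<epsilon> k)" for j k
    have de: "vdiff W (e j) \<in> even_part V" "vdiff W (\<epsilon> j) \<in> odd_part V" if "j < n" for j
      using e[of j] that d_parts neg_parts by (auto simp: W_ops)
    have a_sym: "a j k = a k j" if "j < n" "k < n" for j k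
    proof -
      have "a j k = B (e k) (vdiff V (e j))" if "k < n" for j k
        using form_W(1)[OF e(1)[OF that]] by (simp add: a_def W_ops linear_neg[OF lin(2)])
      moreover have "B (e k) (vdiff V (e j)) = B (vdiff V (e j)) (e k)"
        using B_sym[OF e(1)[OF that(2)] d_parts(2)[OF e(1)[OF that(1)]]] .
      moreover have "B (vdiff V (e j)) (e k) = B (e j) (vdiff V (e k))"
        using B_d(1)[OF e(1)[OF that(1)]] .
      ultimately show ?thesis using that by simp
    qed
    have b_antisym: "b j k = - b k j" if "j < n" "k < n" for j k
    proof -
      have *: "b j k = B (vdiff V (\<epsilon> j)) (\<epsilon> k)" if "j < n" for j k
        using form_W(1)[OF de(2)[OF that]] by (simp add: b_def W_ops linear_neg[OF lin(1)])
      have "B (vdiff V (\<epsilon> j)) (\<epsilon> k) = - B (\<epsilon> j) (vdiff V (\<epsilon> k))"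
        using B_d(2)[OF e(2)[OF that(1)]] .
      moreover have "B (vdiff V (\<epsilon> k)) (\<epsilon> j) = B (\<epsilon> j) (vdiff V (\<epsilon> k))"
        using B_sym[OF d_parts(1)[OF e(2)[OF that(2)]] e(2)[OF that(1)]] .
      ultimately show ?thesis using * that by simp
    qed
    have 1: "\<delta> (vdiff W (e j)) g = (\<Sum>k<n. ff_scale (a j k) (\<delta> (\<epsilon> k) g))" if "j < n" "g \<in> FF" for j g
    proof -
      have "vdiff W (e j) = lincomb W (a j) \<epsilon> n"
        unfolding lincomb_W a_def using e\<epsilon>[OF de(1)[OF that(1)]] .
      then show ?thesis using partial_lincomb[OF z that(2), of n \<epsilon> "a j"] e by (auto simp: W_ops)
    qed
    have 2: "\<delta> (vdiff W (\<epsilon> j)) g = (\<Sum>k<n. ff_scale (b j k) (\<delta> (e k) g))" if "j < n" "g \<in> FF" for j g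
    proof -
      have "vdiff W (\<epsilon> j) = lincomb W (b j) e n"
        unfolding lincomb_W b_def using ex[OF de(2)[OF that(1)]] .
      then show ?thesis using partial_lincomb[OF z that(2), of n e "b j"] e by (auto simp: W_ops)
    qed
    have A: "(\<Sum>j<n. \<Sum>k<n. ff_scale (a j k) (\<delta> (\<epsilon> k) (\<delta> (\<epsilon> j) f))) = 0"
    proof (rule sum_antisymmetric)
      fix j k assume jk: "j < n" "k < n"
      have "\<delta> (\<epsilon> k) (\<delta> (\<epsilon> j) f) = - \<delta> (\<epsilon> j) (\<delta> (\<epsilon> k) f)"
        by (rule partial_swap(2)[OF f]) (use e jk in \<open>auto simp: W_ops homog_def\<close>)
      then show "ff_scale (a j k) (\<delta> (\<epsilon> k) (\<delta> (\<epsilon> j) f)) = - ff_scale (a k j) (\<delta> (\<epsilon> j) (\<delta> (\<epsilon> k) f))"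
        using a_sym[OF jk] by (simp add: ff_scale_linear)
    qed
    have Bb: "(\<Sum>j<n. \<Sum>k<n. ff_scale (b j k) (\<delta> (e j) (\<delta> (e k) f))) = 0"
    proof (rule sum_antisymmetric)
      fix j k assume jk: "j < n" "k < n"
      have "\<delta> (e j) (\<delta> (e k) f) = \<delta> (e k) (\<delta> (e j) f)"
        by (rule partial_swap(1)[OF f]) (use e jk in \<open>auto simp: W_ops homog_def\<close>)
      then show "ff_scale (b j k) (\<delta> (e j) (\<delta> (e k) f)) = - ff_scale (b k j) (\<delta> (e k) (\<delta> (e j) f))"
        using b_antisym[OF jk] by (simp add: fun_eq_iff)
    qed
    have "(\<Sum>i<n. \<delta> (vdiff W (e i)) (\<delta> (\<epsilon> i) f) + \<delta> (e i) (\<delta> (vdiff W (\<epsilon> i)) f)) =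
       (\<Sum>j<n. (\<Sum>k<n. ff_scale (a j k) (\<delta> (\<epsilon> k) (\<delta> (\<epsilon> j) f))) + (\<Sum>k<n. ff_scale (b j k) (\<delta> (e j) (\<delta> (e k) f))))"
      by (intro sum.cong refl) (simp add: 1 2 f FF_partial ff_partial_sum ff_partial_linear)
    then show "(\<Sum>i<n. \<delta> (vdiff W (e i)) (\<delta> (\<epsilon> i) f) + \<delta> (e i) (\<delta> (vdiff W (\<epsilon> i)) f)) = 0"
      unfolding sum.distrib A Bb by simp
  qed (use e lap in \<open>auto simp: W_ops\<close>)
qed

lemma symplectic_U:
  assumes cb: "canonical_basis U n e \<epsilon>"
    and lap: "\<And>f. laplacian U f = (\<Sum>i<n. ff_partial (e i) (ff_partial (\<epsilon> i) f))"
  shows "symplectic_functions U n e \<epsilon>"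
proof -
  interpret super_functions U by (rule super_U)
  have d: "vdiff U = (\<lambda>_. p 0)" by (auto simp: U_ops vdiff_H p_ops)
  show ?thesis
  proof unfold_locales
    show "odd_map (vdiff U)" unfolding odd_map_def d using p_null by (auto simp: U_ops(3,4) p_ops)
    show "vdiff U (vdiff U v) \<in> ev \<inter> od" for v using p_null by (simp add: d)
    show "(\<Sum>i<n. \<delta> (vdiff U (e i)) (\<delta> (\<epsilon> i) f) + \<delta> (e i) (\<delta> (vdiff U (\<epsilon> i)) f)) = 0" if "f \<in> FF" for f
      using partial_null[OF _ p_null] that FF_partial by (simp add: d ff_partial_linear)
  qed (use cb lap in \<open>auto simp: canonical_basis_def\<close>)
qed

lemma function_retract_W:
  assumes "symplectic_functions W n e \<epsilon>" shows "function_retract W n e \<epsilon> q r s"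
proof -
  interpret symplectic_functions W n e \<epsilon> by (rule assms)
  have 0: "0 \<in> ev \<inter> od" using parts subspace_0 by (auto simp: W_ops)
  note q = linear_add[OF q_linear] linear_scale[OF q_linear] linear_neg[OF q_linear] linear_diff[OF q_linear]
  note r = linear_add[OF r_linear] linear_scale[OF r_linear] linear_neg[OF r_linear] linear_diff[OF r_linear]
  note s = linear_add[OF s_linear] linear_scale[OF s_linear] linear_neg[OF s_linear] linear_diff[OF s_linear]
  note d' = linear_neg[OF d_linear] linear_diff[OF d_linear]
  show ?thesis
  proof unfold_locales
    show "odd_map s" unfolding odd_map_def using s_parts by (auto simp: W_ops s)
    show "s (s v) \<in> ev \<inter> od" "s (q v) \<in> ev \<inter> od" "q (r v) \<in> ev \<inter> od" for v
      using 0 by (simp_all add: s_s s_q r_def q q_q)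
    show "q (s v) = s (q v)" "r (s v) = s (r v)" for v by (simp_all add: q_s s_q r_def s)
    show "q (vdiff W v) = vdiff W (q v)" "r (vdiff W v) = vdiff W (r v)" for v
      by (simp_all add: W_ops q q_d d_q r_def d')
  next
    fix f v assume f: "f \<in> FF" and v: "v \<in> homog W"
    have "vdiff W (s v) \<in> ev \<and> s (vdiff W v) \<in> ev \<or> vdiff W (s v) \<in> od \<and> s (vdiff W v) \<in> od"
      using v s_parts d_parts neg_parts by (auto simp: homog_def W_ops s)
    then have "\<delta> (vdiff W (s v)) f + \<delta> (s (vdiff W v)) f = \<delta> (vadd W (vdiff W (s v)) (s (vdiff W v))) f"
      using partial_add[OF f] by simp
    \<comment> \<open>The identity ds + sd = 1 - ip changes sign because \<open>vdiff W\<close> is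
      minus \<open>vdiff V\<close>.\<close>
    also have "vadd W (vdiff W (s v)) (s (vdiff W v)) = vscale W (- 1) (r v)"
      using ds_sd[of v] by (simp add: W_ops s algebra_simps)
    also have "\<delta> \<dots> f = ff_scale (- 1) (\<delta> (r v) f)"
      by (rule partial_scale[OF f]) (use r_parts v in \<open>auto simp: homog_def W_ops\<close>)
    finally show "\<delta> (vdiff W (s v)) f + \<delta> (s (vdiff W v)) f = - \<delta> (r v) f" by (simp add: fun_eq_iff)
  next
    fix f k ws assume f: "f \<in> FF" and basic: "\<And>k ws. set ws \<subseteq> homog W \<Longrightarrow> f k (map q ws) = f k ws"
      and ws: "set ws \<subseteq> homog W"
    have qh: "v \<in> homog W \<Longrightarrow> q v \<in> homog W" for v using q_parts by (auto simp: homog_def W_ops)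
    \<comment> \<open>The basis vectors inserted by the Laplacian need not lie in the image of
      \<open>q\<close>. Both lists have the same image under \<open>q\<close>, which is idempotent,
      so invariance of \<open>f\<close> applied twice identifies the values.\<close>
    have "f k (map q ws @ [e j, \<epsilon> j]) = f k (ws @ [e j, \<epsilon> j])" if "j < n" for j
    proof -
      have h: "e j \<in> homog W" "\<epsilon> j \<in> homog W" using e_even \<epsilon>_odd that by (auto simp: homog_def)
      have "f k (map q ws @ [e j, \<epsilon> j]) = f k (map q (map q ws @ [e j, \<epsilon> j]))"
        by (rule basic[symmetric]) (use h qh ws in auto)
      also have "\<dots> = f k (map q (ws @ [e j, \<epsilon> j]))" by (simp add: q_q comp_def)
      also have "\<dots> = f k (ws @ [e j, \<epsilon> j])" by (rule basic) (use h ws in auto)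
      finally show ?thesis .
    qed
    then show "\<Delta> f k (map q ws) = \<Delta> f k ws"
      by (simp add: laplacian_eq sum_fun_apply2 ff_partial_def)
  qed (use q_parts r_parts in \<open>auto simp: W_ops q r q_q r_def scaleR_diff_right\<close>)
qed

subsection \<open>The pullback\<close>

abbreviation "\<iota> \<equiv> pullback W p"

lemma p_homog: "v \<in> homog W \<Longrightarrow> p v \<in> homog U"
  using p_parts by (auto simp: homog_def U_ops W_ops)

lemma p_even_odd: "v \<in> even_part W \<Longrightarrow> p v \<in> even_part U" "v \<in> odd_part W \<Longrightarrow> p v \<in> odd_part U"
  using p_parts by (auto simp: U_ops W_ops)

lemma pullback_off: "\<not> set ws \<subseteq> homog W \<Longrightarrow> \<iota> f k ws = 0"
  by (simp only: pullback_def if_False)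

lemma pullback_linear:
  "\<iota> (f + g) = \<iota> f + \<iota> g" "\<iota> (f - g) = \<iota> f - \<iota> g" "\<iota> (- f) = - \<iota> f" "\<iota> (ff_scale c f) = ff_scale c (\<iota> f)" "\<iota> 0 = 0"
  by (auto simp: pullback_def fun_eq_iff)

lemma pullback_sum: "\<iota> (sum f I) = (\<Sum>j\<in>I. \<iota> (f j))"
  by (rule additive_sum[of \<iota>]) (simp_all add: pullback_linear)

lemma partial_pullback: "v \<in> homog W \<Longrightarrow> ff_partial v (\<iota> f) = \<iota> (ff_partial (p v) f)"
  by (auto simp: pullback_def ff_partial_def fun_eq_iff)

sublocale W: super_functions W by (rule super_W)
sublocale U: super_functions U by (rule super_U)

lemma FF_pullback: assumes "f \<in> formal_functions U" shows "\<iota> f \<in> formal_functions W"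
proof (rule W.FF_coinduct[of _ "\<iota> ` formal_functions U"], goal_cases)
  case (2 f k ws)
  then obtain g where "f = \<iota> g" by auto
  then show ?case using pullback_off 2(2) by simp
next
  case (3 f a b)
  then have "a \<in> homog W" "b \<in> homog W" "vadd W a b \<in> homog W"
    using W.add_even[of a b] W.add_odd[of a b] by (auto simp: homog_def)
  moreover have "p (vadd W a b) = vadd U (p a) (p b)" by (simp add: W_ops U_ops p_ops)
  ultimately show ?case using 3 p_even_odd
    by (auto simp: partial_pullback U.partial_add pullback_linear)
next
  case (4 f a c)
  then have "vscale W c a \<in> homog W" using W.scale_even[of a c] W.scale_odd[of a c] by (auto simp: homog_def)
  moreover have "p (vscale W c a) = vscale U c (p a)" by (simp add: W_ops U_ops p_ops)
  ultimately show ?case using 4 p_homog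
    by (auto simp: partial_pullback U.partial_scale pullback_linear)
next
  case (5 f a b)
  then have "a \<in> homog W" "b \<in> homog W" by (auto simp: homog_def)
  then show ?case using 5 p_even_odd p_homog
    by (auto simp: partial_pullback U.partial_swap(1)[of _ "p a" "p b"] pullback_linear)
next
  case (6 f a b)
  then have "a \<in> homog W" "b \<in> homog W" by (auto simp: homog_def)
  then show ?case using 6 p_even_odd p_homog
    by (auto simp: partial_pullback U.partial_swap(2)[of _ "p a" "p b"] pullback_linear)
next
  case (7 f v)
  then obtain g where g: "f = \<iota> g" "g \<in> formal_functions U" by auto
  have m: "\<iota> (ff_partial (p v) g) \<in> \<iota> ` formal_functions U" "\<iota> 0 \<in> \<iota> ` formal_functions U"
    using U.FF_partial[OF g(2)] U.FF_linear(1) by blast+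
  show ?case unfolding g(1) partial_pullback[OF 7(2)]
    by (intro bexI[OF _ m(1)] bexI[OF _ m(2)]) (simp add: pullback_linear)
qed (use assms in auto)

lemma pullback_inv:
  assumes "f \<in> formal_functions U" shows "\<iota> (ff_involution U f) = ff_involution W (\<iota> f)"
proof (rule W.FF_eqI)
  show "\<iota> (ff_involution U f) k ws = ff_involution W (\<iota> f) k ws" if "set ws \<subseteq> homog W" for ws k
    using that assms
  proof (induction ws arbitrary: f k rule: rev_induct)
    case Nil then show ?case by (simp add: pullback_def)
  next
    case (snoc v ws)
    then have v: "v \<in> homog W" and ws: "set ws \<subseteq> homog W" by auto
    note F = snoc.prems(2) U.FF_partial FF_pullback U.FF_inv
    have "(v \<in> even_part W \<longrightarrow> p v \<in> even_part U) \<and> (v \<in> odd_part W \<longrightarrow> p v \<in> odd_part U)" using p_even_odd by blast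
    with v show ?case unfolding ff_partial_apply
      by (elim W.homog_cases) (simp_all add: partial_pullback v W.partial_rules U.partial_rules F pullback_linear
          snoc.IH[OF ws])
  qed
qed (simp_all add: pullback_off W.inv_off FF_pullback assms)

lemma pullback_mult:
  assumes "f \<in> formal_functions U" "g \<in> formal_functions U"
  shows "\<iota> (ff_mult U f g) = ff_mult W (\<iota> f) (\<iota> g)"
proof (rule W.FF_eqI)
  show "\<iota> (ff_mult U f g) k ws = ff_mult W (\<iota> f) (\<iota> g) k ws" if "set ws \<subseteq> homog W" for ws k
    using that assms
  proof (induction ws arbitrary: f g k rule: rev_induct)
    case Nil then show ?case by (simp add: pullback_def ff_mult_Nil)
  next
    case (snoc v ws)
    then have v: "v \<in> homog W" and ws: "set ws \<subseteq> homog W" by auto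
    note F = snoc.prems(2,3) U.FF_partial FF_pullback U.FF_inv
    have "(v \<in> even_part W \<longrightarrow> p v \<in> even_part U) \<and> (v \<in> odd_part W \<longrightarrow> p v \<in> odd_part U)" using p_even_odd by blast
    with v show ?case unfolding ff_partial_apply
      by (elim W.homog_cases) (simp_all add: partial_pullback v W.partial_rules U.partial_rules F pullback_linear
          snoc.IH[OF ws] pullback_inv)
  qed
qed (simp_all add: pullback_off W.mult_off FF_pullback assms)

lemma pullback_nonzero: "\<iota> f k ws \<noteq> 0 \<Longrightarrow> \<exists>us. f k us \<noteq> 0 \<and> length us = length ws"
  by (auto simp: pullback_def intro!: exI[of _ "map p ws"] split: if_splits)

lemma weight_filt_pullback: "f \<in> weight_filt U j \<Longrightarrow> \<iota> f \<in> weight_filt W j"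
proof (rule weight_filtI)
  fix k ws assume "\<iota> f k ws \<noteq> 0"
  then show "\<exists>k' us. f k' us \<noteq> 0 \<and> 2 * k' + length us = 2 * k + length ws"
    using pullback_nonzero by metis
qed (auto simp: FF_pullback weight_filt_FF)

lemma i_homog: "C \<in> homog U \<Longrightarrow> i C \<in> homog W \<and> p (i C) = C"
  using i_parts p_i H_carrier by (auto simp: homog_def U_ops W_ops)

lemma pullback_section:
  assumes "set Cs \<subseteq> homog U" shows "\<iota> f k (map i Cs) = f k Cs"
proof -
  have "set (map i Cs) \<subseteq> homog W" "map p (map i Cs) = Cs"
    using assms i_homog by (auto simp: map_idI subset_iff)
  then show ?thesis by (simp add: pullback_def del: map_map)
qed

text \<open>The witness is the restriction of \<open>f\<close> along i: pulling it back along p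
  evaluates \<open>f\<close> on i p = \<open>q\<close>, which does not change a basic
  function.\<close>

lemma basic_pullback:
  assumes f: "f \<in> formal_functions W" and basic: "\<And>k ws. set ws \<subseteq> homog W \<Longrightarrow> f k (map q ws) = f k ws"
  shows "\<exists>g\<in>formal_functions U. f = \<iota> g"
proof
  let ?g = "\<lambda>k Cs. if set Cs \<subseteq> homog U then f k (map i Cs) else 0"
  have car: "C \<in> homog U \<Longrightarrow> C \<in> vcarrier H" for C using H_carrier by (auto simp: homog_def U_ops)
  show "?g \<in> formal_functions U"
  proof (rule U.FFI)
    fix k us vs a b assume ab: "a \<in> even_part U \<and> b \<in> even_part U \<or> a \<in> odd_part U \<and> b \<in> odd_part U"
    then have h: "a \<in> homog U" "b \<in> homog U" "vadd U a b \<in> homog U"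
      using U.add_even[of a b] U.add_odd[of a b] by (auto simp: homog_def)
    have "i (vadd U a b) = vadd W (i a) (i b)" using car h by (simp add: U_ops W_ops i_ops)
    moreover have "i a \<in> even_part W \<and> i b \<in> even_part W \<or> i a \<in> odd_part W \<and> i b \<in> odd_part W"
      using ab i_parts by (auto simp: U_ops W_ops)
    ultimately show "?g k (us @ vadd U a b # vs) = ?g k (us @ a # vs) + ?g k (us @ b # vs)"
      using h W.FF_add[OF f, of "i a" "i b"] by simp
  next
    fix k us vs a c assume a: "a \<in> homog U"
    then have h: "vscale U c a \<in> homog U" using U.scale_even[of a c] U.scale_odd[of a c] by (auto simp: homog_def)
    have "i (vscale U c a) = vscale W c (i a)" using car a by (simp add: U_ops W_ops i_ops)
    then show "?g k (us @ vscale U c a # vs) = c * ?g k (us @ a # vs)"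
      using h a i_homog W.FF_scale[OF f, of "i a"] by simp
  next
    fix k us vs a b assume ab: "a \<in> homog U" "b \<in> homog U"
    have "par U C = par W (i C)" if "C \<in> homog U" for C
      using i_parts p_parts i_homog[OF that] by (auto simp: par_def U_ops W_ops) metis
    then show "?g k (us @ a # b # vs) = (- 1) ^ (par U a * par U b) * ?g k (us @ b # a # vs)"
      using ab i_homog W.FF_swap[OF f, of "i a" "i b"] by simp
  qed auto
  show "f = \<iota> ?g"
  proof (rule W.FF_eqI)
    fix k ws assume ws: "set ws \<subseteq> homog W"
    then have "set (map p ws) \<subseteq> homog U" using p_homog by auto
    then show "f k ws = \<iota> ?g k ws" using basic[OF ws, symmetric] ws by (simp add: pullback_def q_def[abs_def] comp_def)
  qed (simp_all add: W.FF_off f pullback_off)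
qed

text \<open>The claim is that p maps the bivector of \<open>W\<close> to that of \<open>U\<close>.
  The images of the basis of \<open>W\<close> are expanded in the basis of \<open>U\<close>, and the
  resulting matrix of coefficients is the identity by \<open>orth\<close>. This is where cyclicity
  enters: i is an isometry, and ker p is orthogonal to im i.\<close>

lemma pullback_laplacian:
  assumes cW: "canonical_basis W n e \<epsilon>"
    and lapW: "\<And>f. laplacian W f = (\<Sum>i<n. ff_partial (e i) (ff_partial (\<epsilon> i) f))"
    and cU: "canonical_basis U m h \<eta>"
    and lapU: "\<And>f. laplacian U f = (\<Sum>i<m. ff_partial (h i) (ff_partial (\<eta> i) f))"
    and f: "f \<in> formal_functions U"
  shows "\<iota> (laplacian U f) = laplacian W (\<iota> f)"
proof -
  have e: "\<And>j. j < n \<Longrightarrow> e j \<in> odd_part V" "\<And>j. j < n \<Longrightarrow> \<epsilon> j \<in> even_part V"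
    using cW by (auto simp: canonical_basis_def W_ops)
  have h: "\<And>j. j < m \<Longrightarrow> h j \<in> even_part U" "\<And>j. j < m \<Longrightarrow> \<eta> j \<in> odd_part U"
    "\<And>j k. j < m \<Longrightarrow> k < m \<Longrightarrow> form U (h j) (\<eta> k) = (if j = k then 1 else 0)"
    "\<And>w. w \<in> even_part U \<Longrightarrow> \<exists>c. w = lincomb U c h m" "\<And>w. w \<in> odd_part U \<Longrightarrow> \<exists>c. w = lincomb U c \<eta> m"
    using cU by (auto simp: canonical_basis_def)
  have hi: "i (h j) \<in> odd_part V" "p (i (h j)) = h j" "i (\<eta> j) \<in> even_part V" "p (i (\<eta> j)) = \<eta> j"
    "q (i (h j)) = i (h j)" "q (i (\<eta> j)) = i (\<eta> j)" if "j < m" for j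
    using h(1,2)[OF that] i_parts p_i q_i H_carrier by (auto simp: U_ops)
  have lin: "linear (\<lambda>x. B x y)" "linear (B x)" for x y using B_linear by auto
  have dual: "B (i (h j)) (i (\<eta> k)) = (if j = k then - 1 else 0)" if "j < m" "k < m" for j k
    using form_U(1)[OF hi(1)[OF that(1)] hi(3)[OF that(2)]] hi that h(3)[OF that] by (auto split: if_splits)
  \<comment> \<open>The coordinates of \<open>p x\<close> and \<open>p y\<close>, computed by
    pairing in \<open>V\<close> with lifted dual basis vectors; orthogonality allows
    \<open>x\<close> itself in place of \<open>q x\<close>.\<close>
  define a where "a x k = - B x (i (\<eta> k))" for x k
  define b where "b y k = - B (i (h k)) y" for y k
  have iU: "lincomb U c v m = p (\<Sum>j<m. c j *\<^sub>R i (v j))" if "\<And>j. j < m \<Longrightarrow> p (i (v j)) = v j" for c v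
  proof -
    have "lincomb U c v l = lincomb U c (\<lambda>j. p (i (v j))) l" if "l \<le> m" for l
      using that by (induction l) (simp_all add: \<open>\<And>j. j < m \<Longrightarrow> p (i (v j)) = v j\<close>)
    then show ?thesis using lincomb_U[of c "\<lambda>j. i (v j)" m] by simp
  qed
  have ph: "p x = lincomb U (a x) h m" if x: "x \<in> odd_part V" for x
  proof -
    obtain c where c: "p x = lincomb U c h m" using h(4)[of "p x"] p_parts(2)[OF x] by (auto simp: U_ops)
    have px: "q x = (\<Sum>j<m. c j *\<^sub>R i (h j))"
    proof -
      have "p x = p (\<Sum>j<m. c j *\<^sub>R i (h j))" unfolding c by (rule iU) (rule hi(2))
      then have "q x = q (\<Sum>j<m. c j *\<^sub>R i (h j))" by (simp only: q_def)
      also have "\<dots> = (\<Sum>j<m. c j *\<^sub>R i (h j))"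
        using hi(5) by (simp add: linear_sum[OF q_linear] linear_scale[OF q_linear])
      finally show ?thesis .
    qed
    have "a x k = c k" if k: "k < m" for k
    proof -
      have "B x (i (\<eta> k)) = B (q x) (i (\<eta> k))" using B_q_left[of x "i (\<eta> k)"] hi(6)[OF k] by simp
      also have "\<dots> = (\<Sum>j<m. c j * B (i (h j)) (i (\<eta> k)))"
        unfolding px by (simp add: linear_sum[OF lin(1)] linear_scale[OF lin(1)])
      also have "\<dots> = (\<Sum>j<m. if j = k then - c k else 0)" by (intro sum.cong refl) (use dual k in auto)
      finally show ?thesis using k by (simp add: a_def)
    qed
    then have "lincomb U c h l = lincomb U (a x) h l" if "l \<le> m" for l
      using that by (induction l) simp_all
    then show ?thesis using c by simp
  qed
  have p\<eta>: "p y = lincomb U (b y) \<eta> m" if y: "y \<in> even_part V" for y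
  proof -
    obtain c where c: "p y = lincomb U c \<eta> m" using h(5)[of "p y"] p_parts(1)[OF y] by (auto simp: U_ops)
    have py: "q y = (\<Sum>j<m. c j *\<^sub>R i (\<eta> j))"
    proof -
      have "p y = p (\<Sum>j<m. c j *\<^sub>R i (\<eta> j))" unfolding c by (rule iU) (rule hi(4))
      then have "q y = q (\<Sum>j<m. c j *\<^sub>R i (\<eta> j))" by (simp only: q_def)
      also have "\<dots> = (\<Sum>j<m. c j *\<^sub>R i (\<eta> j))"
        using hi(6) by (simp add: linear_sum[OF q_linear] linear_scale[OF q_linear])
      finally show ?thesis .
    qed
    have "b y k = c k" if k: "k < m" for k
    proof -
      have "B (i (h k)) y = B (i (h k)) (q y)" using B_q_right[OF hi(1)[OF k] y] hi(5)[OF k] by simp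
      also have "\<dots> = (\<Sum>j<m. c j * B (i (h k)) (i (\<eta> j)))"
        unfolding py by (simp add: linear_sum[OF lin(2)] linear_scale[OF lin(2)])
      also have "\<dots> = (\<Sum>j<m. if j = k then - c k else 0)" by (intro sum.cong refl) (use dual k in auto)
      finally show ?thesis using k by (simp add: b_def)
    qed
    then have "lincomb U c \<eta> l = lincomb U (b y) \<eta> l" if "l \<le> m" for l
      using that by (induction l) simp_all
    then show ?thesis using c by simp
  qed
  have z: "vzero U \<in> even_part U \<inter> odd_part U" using p_null p_zero by (simp add: U_ops(5))
  have step: "ff_partial (p (e j)) (ff_partial (p (\<epsilon> j)) f) =
      (\<Sum>k<m. \<Sum>l<m. ff_scale (a (e j) k * b (\<epsilon> j) l) (ff_partial (h k) (ff_partial (\<eta> l) f)))" if "j < n" for j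
  proof -
    have 1: "ff_partial (p (\<epsilon> j)) f = (\<Sum>l<m. ff_scale (b (\<epsilon> j) l) (ff_partial (\<eta> l) f))"
      unfolding p\<eta>[OF e(2)[OF that]] using U.partial_lincomb[OF z f] h(2) by blast
    have 2: "ff_partial (p (e j)) g = (\<Sum>k<m. ff_scale (a (e j) k) (ff_partial (h k) g))"
      if "g \<in> formal_functions U" for g
      unfolding ph[OF e(1)[OF \<open>j < n\<close>]] using U.partial_lincomb[OF z that] h(1) by blast
    have "ff_partial (p (e j)) (ff_partial (p (\<epsilon> j)) f) =
        (\<Sum>k<m. ff_scale (a (e j) k) (ff_partial (h k) (\<Sum>l<m. ff_scale (b (\<epsilon> j) l) (ff_partial (\<eta> l) f))))"
      using 2[OF U.FF_partial[OF f, of "p (\<epsilon> j)"]] unfolding 1 .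
    also have "\<dots> = (\<Sum>k<m. \<Sum>l<m. ff_scale (a (e j) k * b (\<epsilon> j) l) (ff_partial (h k) (ff_partial (\<eta> l) f)))"
      by (intro sum.cong refl)
        (simp add: ff_partial_sum ff_partial_linear fun_eq_iff sum_fun_apply2 sum_distrib_left mult.assoc)
    finally show ?thesis .
  qed
  \<comment> \<open>Expand \<open>i (\<eta> k)\<close> in the basis of \<open>W\<close>, where
    \<open>a (e j) k\<close> are its coordinates, and pair with \<open>i (h l)\<close>.\<close>
  have orth: "(\<Sum>j<n. a (e j) k * b (\<epsilon> j) l) = (if k = l then 1 else 0)" if "k < m" "l < m" for k l
  proof -
    have 1: "i (\<eta> k) = (\<Sum>j<n. form W (e j) (i (\<eta> k)) *\<^sub>R \<epsilon> j)"
      using symplectic_W(3)[OF cW lapW hi(3)[OF that(1)]] .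
    have 2: "(\<Sum>j<n. form W (e j) (i (\<eta> k)) *\<^sub>R \<epsilon> j) = (\<Sum>j<n. a (e j) k *\<^sub>R \<epsilon> j)"
      by (intro sum.cong refl) (simp add: a_def form_W(1) e(1))
    have "- B (i (h l)) (i (\<eta> k)) = - B (i (h l)) (\<Sum>j<n. a (e j) k *\<^sub>R \<epsilon> j)"
      using arg_cong[OF trans[OF 1 2], of "\<lambda>y. - B (i (h l)) y"] .
    also have "\<dots> = (\<Sum>j<n. a (e j) k * b (\<epsilon> j) l)"
      by (simp add: linear_sum[OF lin(2)] linear_scale[OF lin(2)] b_def sum_negf)
    finally show ?thesis using dual[OF that(2) that(1)] by auto
  qed
  have "laplacian W (\<iota> f) = (\<Sum>j<n. \<iota> (ff_partial (p (e j)) (ff_partial (p (\<epsilon> j)) f)))"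
    unfolding lapW by (intro sum.cong refl) (use e in \<open>auto simp: partial_pullback homog_def W_ops\<close>)
  also have "\<dots> = \<iota> (\<Sum>j<n. \<Sum>k<m. \<Sum>l<m. ff_scale (a (e j) k * b (\<epsilon> j) l) (ff_partial (h k) (ff_partial (\<eta> l) f)))"
    unfolding pullback_sum[symmetric] by (rule arg_cong[of _ _ \<iota>], intro sum.cong refl) (use step in auto)
  also have "(\<Sum>j<n. \<Sum>k<m. \<Sum>l<m. ff_scale (a (e j) k * b (\<epsilon> j) l) (ff_partial (h k) (ff_partial (\<eta> l) f))) =
      (\<Sum>k<m. \<Sum>l<m. ff_scale (\<Sum>j<n. a (e j) k * b (\<epsilon> j) l) (ff_partial (h k) (ff_partial (\<eta> l) f)))"
    (is "?L = ?R")
  proof (intro ext)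
    fix k' ws
    have "?L k' ws = (\<Sum>j<n. \<Sum>k<m. \<Sum>l<m. (a (e j) k * b (\<epsilon> j) l) * ff_partial (h k) (ff_partial (\<eta> l) f) k' ws)"
      by (simp add: sum_fun_apply2)
    also have "\<dots> = (\<Sum>k<m. \<Sum>j<n. \<Sum>l<m. (a (e j) k * b (\<epsilon> j) l) * ff_partial (h k) (ff_partial (\<eta> l) f) k' ws)"
      by (rule sum.swap)
    also have "\<dots> = (\<Sum>k<m. \<Sum>l<m. \<Sum>j<n. (a (e j) k * b (\<epsilon> j) l) * ff_partial (h k) (ff_partial (\<eta> l) f) k' ws)"
      by (intro sum.cong refl sum.swap)
    also have "\<dots> = ?R k' ws" by (simp add: sum_fun_apply2 sum_distrib_right)
    finally show "?L k' ws = ?R k' ws" .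
  qed
  also have "?R = (\<Sum>k<m. \<Sum>l<m. if k = l then ff_partial (h k) (ff_partial (\<eta> l) f) else 0)"
    by (intro sum.cong refl) (auto simp: orth fun_eq_iff)
  also have "\<dots> = laplacian U f" unfolding lapU by (simp add: sum.delta)
  finally show ?thesis by simp
qed

text \<open>The differential of the homology vanishes and p sends boundaries to zero, so every
  summand has a zero vector among its arguments.\<close>

lemma diff_pullback: "f \<in> formal_functions U \<Longrightarrow> ff_diff W (\<iota> f) = 0" "f \<in> formal_functions U \<Longrightarrow> ff_diff U f = 0"
proof -
  assume f: "f \<in> formal_functions U"
  have null: "f k (us @ p 0 # vs) = 0" for k us vs
  proof -
    have "f k (us @ vscale U 0 (p 0) # vs) = 0"
      using U.FF_scale[OF f, of "p 0" k us 0 vs] p_null by (simp add: homog_def)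
    then show ?thesis by (simp add: U_ops p_ops)
  qed
  have dU: "vdiff U C = p 0" for C by (simp add: U_ops vdiff_H p_ops)
  have pd: "p (vdiff W v) = p 0" for v
    using p_d[of "- v"] by (simp add: W_ops linear_neg[OF d_linear])
  have "f k (map p (ws[j := vdiff W (ws ! j)])) = 0" if "j < length ws" for k ws j
    using that null by (simp add: upd_conv_take_nth_drop pd)
  then have "\<iota> f k (ws[j := vdiff W (ws ! j)]) = 0" if "j < length ws" for k ws j
    using that by (simp add: pullback_def)
  then show "ff_diff W (\<iota> f) = 0" by (simp add: ff_diff_def fun_eq_iff)
  have "f k (ws[j := vdiff U (ws ! j)]) = 0" if "j < length ws" for k ws j
    using that null by (simp add: upd_conv_take_nth_drop dU)
  then show "ff_diff U f = 0" by (simp add: ff_diff_def fun_eq_iff)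
qed

lemma pullback_hbar_mult: "\<iota> (hbar_mult f) = hbar_mult (\<iota> f)"
  by (auto simp: pullback_def hbar_mult_def fun_eq_iff)

theorem dgla_retract_pullback: "\<exists>K. dgla_retract (h_dgla U) (h_dgla W) \<iota> K"
proof -
  obtain n' e' \<epsilon>' m' h' \<eta>' where "canonical_basis W n' e' \<epsilon>'" "canonical_basis U m' h' \<eta>'"
    using canonical_basis_W canonical_basis_U by blast
  note cb = this
  obtain n e \<epsilon> where cW: "canonical_basis W n e \<epsilon>"
    and lapW: "\<And>f. laplacian W f = (\<Sum>i<n. ff_partial (e i) (ff_partial (\<epsilon> i) f))"
    by (rule laplacian_canonical_basis[OF cb(1)]) blast
  obtain m h \<eta> where cU: "canonical_basis U m h \<eta>"
    and lapU: "\<And>f. laplacian U f = (\<Sum>i<m. ff_partial (h i) (ff_partial (\<eta> i) f))"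
    by (rule laplacian_canonical_basis[OF cb(2)]) blast
  interpret SW: symplectic_functions W n e \<epsilon> by (rule symplectic_W(1)[OF cW lapW])
  interpret SU: symplectic_functions U m h \<eta> by (rule symplectic_U[OF cU lapU])
  interpret R: function_retract W n e \<epsilon> q r s by (rule function_retract_W[OF SW.symplectic_functions_axioms])
  interpret hU: odd_dgla "h_dgla U" by (rule SU.odd_dgla_h_dgla)
  interpret hW: odd_dgla "h_dgla W" by (rule SW.odd_dgla_h_dgla)
  note lap = pullback_laplacian[OF cW lapW cU lapU]
  have D: "gdiff (h_dgla W) = (\<lambda>f. ff_diff W f + SW.hlap f)" "gdiff (h_dgla U) = (\<lambda>f. ff_diff U f + SU.hlap f)"
    using SW.gdiff_h_dgla SU.gdiff_h_dgla by auto
  have h: "gsign (h_dgla X) = ff_involution X" "gbracket (h_dgla X) = odd_bracket X" "gfilt (h_dgla X) = weight_filt X"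
    for X :: "'x super_space" by (simp_all add: h_dgla_def)
  note FU = weight_filt_FF[of _ U] and FW = weight_filt_FF[of _ W]
  have basic: "\<iota> f \<in> R.basic" if "f \<in> formal_functions U" for f
  proof -
    have "\<iota> f k (map q ws) = \<iota> f k ws" if "set ws \<subseteq> homog W" for k ws
    proof -
      have "set (map q ws) \<subseteq> homog W" using that R.q_homog by auto
      then show ?thesis using that by (simp add: pullback_def p_q comp_def)
    qed
    then show ?thesis using FF_pullback[OF that] by (simp add: R.basic_def)
  qed
  \<comment> \<open>Sections along i show that every value of \<open>f\<close> on homogeneous
    classes is also a value of its pullback, in the same weight.\<close>
  have refl: "f \<in> weight_filt U j" if "f \<in> formal_functions U" "\<iota> f \<in> weight_filt W j" for f j
  proof (rule weight_filtI[OF that(2,1)])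
    fix k Cs assume nz: "f k Cs \<noteq> 0"
    then have "set Cs \<subseteq> homog U" using U.FF_off[OF that(1)] by blast
    then have "\<iota> f k (map i Cs) \<noteq> 0" using pullback_section nz by simp
    then show "\<exists>k' us. \<iota> f k' us \<noteq> 0 \<and> 2 * k' + length us = 2 * k + length Cs"
      by (intro exI[of _ k] exI[of _ "map i Cs"]) simp
  qed
  have "dgla_retract (h_dgla U) (h_dgla W) \<iota> R.K"
  proof (intro dgla_retract.intro dgla_retract_axioms.intro gauge_morphism.intro gauge_morphism_axioms.intro
      hU.odd_dgla_axioms hW.odd_dgla_axioms hU.gauge_algebra hW.gauge_algebra, unfold h gscale_h_dgla D, goal_cases)
    case (1 x j) then show ?case by (rule weight_filt_pullback)
  next
    case (4 x)
    then show ?case using FU lap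
      by (simp add: diff_pullback SW.hlap_def SU.hlap_def pullback_hbar_mult)
  next
    case (5 x) then show ?case using FU pullback_inv by blast
  next
    case (6 x y)
    then have "x \<in> formal_functions U" "y \<in> formal_functions U" using FU by auto
    then show ?case unfolding odd_bracket_def
      by (simp add: pullback_linear lap pullback_mult pullback_inv U.FF_inv U.FF_mult SU.FF_laplacian)
  next
    case (7 x)
    have x: "x \<in> formal_functions U" using 7 FU by blast
    show ?case
    proof (rule U.FF_eqI)
      fix Cs k assume "set Cs \<subseteq> homog U"
      then have "x k Cs = \<iota> x k (map i Cs)" using pullback_section by simp
      then show "x k Cs = 0 k Cs" using 7(2) by simp
    qed (use U.FF_off x in simp_all)
  next
    case (8 x j) then show ?case using refl FU by blast
  next
    case (11 u j) then show ?case by (rule R.weight_filt_K)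
  next
    case (12 u) then show ?case using R.K_inv FW by blast
  next
    case (13 u) then show ?case using R.K_K FW by blast
  next
    case (14 y) then show ?case using R.K_basic basic FU by blast
  next
    case (15 u)
    let ?x = "u - (ff_diff W (R.K u) + SW.hlap (R.K u)) - R.K (ff_diff W u + SW.hlap u)"
    have F: "?x \<in> weight_filt W 0"
      using 15 by (intro R.weight_filt_minus R.weight_filt_K W.weight_filt_linear SW.weight_filt_diff SW.weight_filt_hlap)
    have "?x \<in> R.basic" using R.K_homotopy[OF FW[OF 15]] .
    then obtain g where "g \<in> formal_functions U" "?x = \<iota> g"
      using basic_pullback[OF FW[OF F]] unfolding R.basic_def by blast
    then show ?case using refl F by (metis imageI)
  qed (simp_all add: pullback_linear R.K_add R.K_scale)
  then show ?thesis by blast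
qed

end

theorem proposition3p4:
  fixes V :: "'v::real_vector super_space"
    and i :: "'v set \<Rightarrow> 'v" and p :: "'v \<Rightarrow> 'v set" and s :: "'v \<Rightarrow> 'v"
  assumes "odd_symmetric_space V"
    and "cyclic_sdr V i p s"
  shows "let hH = h_dgla (parity_reversion (homology V));
             hV = h_dgla (parity_reversion V);
             \<iota> = pullback (parity_reversion V) p
         in filtered_quasi_iso hH hV \<iota> \<and>
            (\<exists>\<Phi>. bij_betw \<Phi> (MC_moduli hH) (MC_moduli hV) \<and>
               (\<forall>\<xi>\<in>MC hH. \<Phi> (homotopy_rel hH `` {\<xi>}) = homotopy_rel hV `` {\<iota> \<xi>}))"
proof -
  interpret cyclic_retract V i p s by unfold_locales (rule assms)+
  obtain K where "dgla_retract (h_dgla U) (h_dgla W) \<iota> K" using dgla_retract_pullback by blast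
  then interpret dgla_retract "h_dgla U" "h_dgla W" \<iota> K .
  show ?thesis unfolding Let_def using filtered_quasi_iso MC_moduli_bij by blast
qed

end
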